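(* Let a string $dM_0$ be of minimal decay over $\mathbb{A}_{\mathbb{M}}$ for a frequency $\alpha\in\mathbb{R}$. Then $dM_0$ consists of a finite number of point masses, i.e., $dM_0=\sum_{j=1}^n m_j\,\delta(x-a_j)\,dx$ with $n\in\mathbb{N}$, positive $m_j$, and distinct increasingly ordered $a_j\in[0,\ell]$.
   Context: Fix $\ell>0$ and $m>0$. A string is a bounded nonnegative Borel measure $dM$ on $[0,\ell]$; $\delta(x-a)\,dx$ denotes the unit point mass at $a$. For $z\in\mathbb{C}$, $\varphi(\cdot)=\varphi(\cdot,z;dM)$ is the unique continuous solution on $[0,\ell]$ of $\varphi(x)=1-z^2\int_{[0,x]}(x-s)\varphi(s)\,dM(s)$, and $F(z;dM):=\varphi(\ell,z;dM)-iz\int_{[0,\ell]}\varphi(s,z;dM)\,dM(s)$. The set $\Sigma(dM)$ of quasi-eigenvalues of $dM$ is the set of zeroes of $F(\cdot;dM)$ (equivalently, the $\omega\ne0$ for which $-\frac{d^2}{dM\,dx}y=\omega^2y$, $\partial_x^-y(0)=0$, $y(\ell)+\frac{i}{\omega}\partial_x^+y(\ell)=0$ has a nontrivial solution, $dM$ being extended by the zero measure outside $[0,\ell]$). The admissible family is $\mathbb{A}_{\mathbb{M}}:=\{dM: dM\text{ nonnegative Borel measure on }[0,\ell],\ \int_{[0,\ell]}dM\le m\}$, and $\Sigma[\mathbb{A}_{\mathbb{M}}]:=\bigcup_{dM\in\mathbb{A}_{\mathbb{M}}}\Sigma(dM)$. A number $\alpha\in\mathbb{R}$ is an admissible frequency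 if $\alpha=\mathrm{Re}\,\omega$ for some $\omega\in\Sigma[\mathbb{A}_{\mathbb{M}}]$. For such $\alpha$, $\beta_{\min}(\alpha):=\inf\{\beta\in\mathbb{R}:\alpha-i\beta\in\Sigma[\mathbb{A}_{\mathbb{M}}]\}$. If $\omega=\alpha-i\beta_{\min}(\alpha)\in\Sigma(dM)$ for some $dM\in\mathbb{A}_{\mathbb{M}}$, then $\omega$ and $dM$ are said to be of minimal decay for the frequency $\alpha$ over $\mathbb{A}_{\mathbb{M}}$. *)

theory Defs
  imports "HOL-Analysis.Analysis"
begin

text \<open>
  Strings of length \<open>l\<close>: finite Borel measures whose underlying space is the interval
  \<open>[0,l]\<close> itself, so that equality of strings is equality on Borel subsets of \<open>[0,l]\<close>.
\<close>

definition strings :: "real \<Rightarrow> real measure set" where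
  "strings l = {M. sets M = sets (restrict_space borel {0..l}) \<and> finite_measure M}"

text \<open>
  The integral equation determines \<open>\<phi>\<close> only on \<open>[0,l]\<close>; \<open>extensional\<close> fixes the values
  elsewhere so that the solution is unique as a HOL function. The point \<open>x\<close> and both
  end points belong to the domains of integration, i.e. atoms there are counted.
\<close>

definition is_phi :: "real \<Rightarrow> real measure \<Rightarrow> complex \<Rightarrow> (real \<Rightarrow> complex) \<Rightarrow> bool" where
  "is_phi l M z f \<longleftrightarrow>
     f \<in> extensional {0..l} \<and> continuous_on {0..l} f \<and>
     (\<forall>x\<in>{0..l}. f x = 1 - z\<^sup>2 * (LINT s:{0..x}|M. complex_of_real (x - s) * f s))"

definition phi :: "real \<Rightarrow> real measure \<Rightarrow> complex \<Rightarrow> real \<Rightarrow> complex" where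
  "phi l M z = (THE f. is_phi l M z f)"

definition char_fun :: "real \<Rightarrow> real measure \<Rightarrow> complex \<Rightarrow> complex" where
  "char_fun l M z = phi l M z l - \<i> * z * (LINT s:{0..l}|M. phi l M z s)"

definition quasi_eigenvalues :: "real \<Rightarrow> real measure \<Rightarrow> complex set" where
  "quasi_eigenvalues l M = {z. char_fun l M z = 0}"

definition admissible_strings :: "real \<Rightarrow> real \<Rightarrow> real measure set" where
  "admissible_strings l m = {M \<in> strings l. emeasure M {0..l} \<le> ennreal m}"

definition admissible_spectrum :: "real \<Rightarrow> real \<Rightarrow> complex set" where
  "admissible_spectrum l m = (\<Union>M\<in>admissible_strings l m. quasi_eigenvalues l M)"

definition admissible_frequency :: "real \<Rightarrow> real \<Rightarrow> real \<Rightarrow> bool" where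
  "admissible_frequency l m \<alpha> \<longleftrightarrow> (\<exists>\<omega>\<in>admissible_spectrum l m. \<alpha> = Re \<omega>)"

text \<open>
  For an admissible frequency the set below is nonempty, and it is bounded below because all
  quasi-eigenvalues lie in the open lower half-plane; so the infimum in the reals is the
  genuine one. For other \<open>\<alpha>\<close> the value is unspecified and never used.
\<close>

definition beta_min :: "real \<Rightarrow> real \<Rightarrow> real \<Rightarrow> real" where
  "beta_min l m \<alpha> =
     Inf {\<beta>. complex_of_real \<alpha> - \<i> * complex_of_real \<beta> \<in> admissible_spectrum l m}"

definition minimal_decay :: "real \<Rightarrow> real \<Rightarrow> real \<Rightarrow> real measure \<Rightarrow> bool" where
  "minimal_decay l m \<alpha> M \<longleftrightarrow>
     admissible_frequency l m \<alpha> \<and> M \<in> admissible_strings l m \<and>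
     complex_of_real \<alpha> - \<i> * complex_of_real (beta_min l m \<alpha>) \<in> quasi_eigenvalues l M"

end

theory Submission
  imports Defs
begin

text \<open>
  Let \<open>\<omega>\<close> be of minimal decay for \<open>dM\<close>, and \<open>\<phi> = \<phi>(\<cdot>, \<omega>; dM)\<close>. The derivative of \<open>F\<close> in the direction
  \<open>dN - dM\<close> is a nonzero multiple of \<open>\<integral> \<phi>\<^sup>2 (dN - dM)\<close>. If these numbers filled a neighbourhood of \<open>0\<close>,
  Brouwer's theorem would give a resonance \<open>\<omega> + i\<eta>\<close> of an admissible string for small \<open>\<eta> > 0\<close>,
  whatever the multiplicity of \<open>\<omega>\<close>. So there is \<open>\<kappa> \<noteq> 0\<close> such that \<open>dM\<close> maximizes \<open>\<integral> Re (\<kappa> \<phi>\<^sup>2) dN\<close>; testing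
  with one point mass and with the zero string, \<open>dM\<close> sits on the set \<open>S\<close> where \<open>Re (\<kappa> \<phi>\<^sup>2)\<close> attains
  its maximum \<open>c \<ge> 0\<close>.

  For \<open>Re \<omega> \<noteq> 0\<close> the function \<open>\<phi>\<close> has no zero and \<open>arg \<phi>\<close> is strictly monotone behind the left end \<open>a\<close> of
  the support. At a limit point of \<open>S\<close> the one-sided derivative \<open>q\<close> of \<open>\<phi>\<close> then satisfies \<open>Re (\<kappa> q\<^sup>2) < 0\<close>,
  while the masses contribute \<open>- 2 Re (\<omega>\<^sup>2 \<kappa> \<phi>\<^sup>2) dM\<close> to the second derivative of \<open>Re (\<kappa> \<phi>\<^sup>2)\<close>. Following \<open>S\<close> to
  the left shows that this term is nowhere positive, so \<open>Re (\<kappa> \<phi>\<^sup>2)\<close> is strictly concave near the limit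
  point, and \<open>S\<close> is finite. For \<open>Re \<omega> = 0\<close> everything is real, and a comparison with a single mass at
  \<open>l\<close> suffices.
\<close>

text \<open>The string may be singular continuous, so \<phi> has only one-sided derivatives and is
  not analytic in x; nothing excludes at first that S is a Cantor set. What is known at a point of S
  are the signs of the two one-sided derivatives of Re (\<kappa> \<phi>^2) and the strict rotation
  of \<phi>. Put u = \<kappa> \<phi>^2 and v = \<kappa> \<phi> q. If c > 0 and Re v = 0, rotation
  forces Im v \<noteq> 0, and \<kappa> q^2 = v^2 / u turns this into Re (\<kappa> q^2) < 0. If c =
  0, then u crosses the imaginary axis, which a maximum forbids. At x = a both slopes can vanish,
  the rotation is no longer strict, and an expansion in a moment of the mass takes its place.

  Derivatives are represented by integrals over \<open>{..<x}\<close> or \<open>{..x}\<close>, so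
  that atoms and continuous mass are treated alike. In the perturbation step the multiplicity of
  \<omega> never enters because the unknown is the string, not the resonance.\<close>

section \<open>Strings and the Volterra equation\<close>

locale krein_string =
  fixes l :: real and M :: "real measure"
  assumes length_pos: "0 < l" and in_strings: "M \<in> strings l"
begin

lemma sets_M: "sets M = sets (restrict_space borel {0..l})"
  and finite_measure_M: "finite_measure M"
  using in_strings by (auto simp: strings_def)

sublocale finite_measure M
  by (rule finite_measure_M)

lemma space_M [simp]: "space M = {0..l}"
  using sets_eq_imp_space_eq[OF sets_M] by (simp add: space_restrict_space)

lemma borel_measurable_M:
  assumes "f \<in> borel_measurable borel"
  shows "f \<in> borel_measurable M"
  unfolding measurable_cong_sets[OF sets_M refl] by (intro measurable_restrict_space1 assms)

lemma continuous_measurable_M: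
  fixes f :: "real \<Rightarrow> 'b :: topological_space"
  assumes "continuous_on {0..l} f"
  shows "f \<in> borel_measurable M"
  unfolding measurable_cong_sets[OF sets_M refl]
  by (rule borel_measurable_continuous_on_restrict[OF assms])

lemma in_sets_M:
  assumes "A \<in> sets borel"
  shows "A \<inter> {0..l} \<in> sets M"
  using assms by (auto simp: sets_M sets_restrict_space)

lemma integrable_bounded:
  fixes f :: "real \<Rightarrow> 'b :: {banach, second_countable_topology}"
  assumes "f \<in> borel_measurable M" "\<And>x. x \<in> {0..l} \<Longrightarrow> norm (f x) \<le> B"
  shows "integrable M f"
  using assms by (intro integrable_const_bound[of _ B] AE_I2) auto

lemma bounded_continuous:
  fixes f :: "real \<Rightarrow> 'b :: real_normed_vector"
  assumes "continuous_on {0..l} f"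
  obtains B where "0 < B" "\<And>x. x \<in> {0..l} \<Longrightarrow> norm (f x) \<le> B"
proof -
  have "bounded (f ` {0..l})"
    by (intro compact_imp_bounded compact_continuous_image assms) auto
  then show ?thesis using that by (auto simp: bounded_pos)
qed

lemma integrable_continuous:
  fixes f :: "real \<Rightarrow> 'b :: {banach, second_countable_topology}"
  assumes "continuous_on {0..l} f"
  shows "integrable M f"
proof -
  obtain B where "\<And>x. x \<in> {0..l} \<Longrightarrow> norm (f x) \<le> B"
    using bounded_continuous[OF assms] by blast
  then show ?thesis
    by (intro integrable_bounded[of f B] continuous_measurable_M assms) auto
qed

lemma norm_integral_le:
  fixes f :: "real \<Rightarrow> 'b :: {banach, second_countable_topology}"
  assumes "\<And>x. x \<in> {0..l} \<Longrightarrow> norm (f x) \<le> B" and "0 \<le> B"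
  shows "norm (LINT s|M. f s) \<le> B * measure M {0..l}"
proof (cases "integrable M f")
  case True
  have "norm (LINT s|M. f s) \<le> (LINT s|M. norm (f s))"
    by (rule integral_norm_bound)
  also have "\<dots> \<le> (LINT s|M. B)"
    by (intro integral_mono) (use True assms in auto)
  finally show ?thesis by (simp add: mult.commute)
next
  case False
  then show ?thesis by (simp add: not_integrable_integral_eq assms)
qed

text \<open>The weight exp (- \<sigma> k x) works because max 0 t is at most exp (k t) / k: in the
  weighted norm the integral term costs at most L * mass / k, hence at most one half, and is
  absorbed on the left. The absorption gives the factor 2; removing the weight at the maximizer and
  at x gives exp (k l) twice. The sign \<sigma> = -1 serves the integration from the right end in
  \<open>backward_unique\<close>.\<close>

lemma gronwall:
  fixes d :: "real \<Rightarrow> real"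
  assumes cont: "continuous_on {0..l} d" and nn: "\<And>x. x \<in> {0..l} \<Longrightarrow> 0 \<le> d x"
    and L: "0 \<le> L" and D: "0 \<le> D" and k: "0 < k" "2 * L * measure M {0..l} \<le> k"
    and \<sigma>: "\<bar>\<sigma>\<bar> = 1"
    and le: "\<And>x. x \<in> {0..l} \<Longrightarrow> d x \<le> D + L * (LINT s|M. max 0 (\<sigma> * (x - s)) * d s)"
    and x: "x \<in> {0..l}"
  shows "d x \<le> 2 * D * exp (2 * k * l)"
proof -
  define h where "h x = d x * exp (- \<sigma> * k * x)" for x
  have "continuous_on {0..l} h"
    unfolding h_def by (intro continuous_intros cont)
  then obtain y where y: "y \<in> {0..l}" and max: "\<And>x. x \<in> {0..l} \<Longrightarrow> h x \<le> h y"
    using continuous_attains_sup[of "{0..l}" h] length_pos by auto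
  define S where "S = h y"
  have S: "0 \<le> S" using nn[OF y] by (simp add: S_def h_def)
  have sb: "- \<sigma> * k * x \<le> k * l" "\<sigma> * k * x \<le> k * l" if "x \<in> {0..l}" for x
  proof -
    have "\<bar>\<sigma> * k * x\<bar> = k * x" using \<sigma> k that by (simp add: abs_mult)
    moreover have "k * x \<le> k * l" using that k by simp
    ultimately show "- \<sigma> * k * x \<le> k * l" "\<sigma> * k * x \<le> k * l" by linarith+
  qed
  have ker: "max 0 (\<sigma> * (y - s)) * d s \<le> exp (\<sigma> * k * y) * S / k" if "s \<in> {0..l}" for s
  proof -
    have "k * (\<sigma> * (y - s)) \<le> exp (k * (\<sigma> * (y - s)))"
      using exp_ge_add_one_self[of "k * (\<sigma> * (y - s))"] by linarith
    then have "max 0 (\<sigma> * (y - s)) \<le> exp (k * (\<sigma> * (y - s))) / k"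
      using k by (simp add: field_simps max_def)
    then have "max 0 (\<sigma> * (y - s)) * d s \<le> exp (k * (\<sigma> * (y - s))) / k * d s"
      using nn[OF that] by (rule mult_right_mono)
    also have "\<dots> = exp (\<sigma> * k * y) * h s / k"
      by (simp add: h_def algebra_simps exp_diff exp_minus divide_simps)
    also have "\<dots> \<le> exp (\<sigma> * k * y) * S / k"
      using max[OF that] k by (simp add: S_def divide_right_mono)
    finally show ?thesis .
  qed
  have "norm (LINT s|M. max 0 (\<sigma> * (y - s)) * d s) \<le> exp (\<sigma> * k * y) * S / k * measure M {0..l}"
    using ker nn k S by (intro norm_integral_le) auto
  then have "(LINT s|M. max 0 (\<sigma> * (y - s)) * d s) \<le> exp (\<sigma> * k * y) * S / k * measure M {0..l}"
    by simp
  then have "d y \<le> D + L * (exp (\<sigma> * k * y) * S / k * measure M {0..l})"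
    using le[OF y] mult_left_mono[OF _ L] by fastforce
  also have "\<dots> = D + exp (\<sigma> * k * y) * S * (L * measure M {0..l} / k)"
    by simp
  also have "\<dots> \<le> D + exp (\<sigma> * k * y) * S * (1/2)"
    using k S by (intro add_left_mono mult_left_mono) (auto simp: field_simps)
  finally have "S \<le> (D + exp (\<sigma> * k * y) * S * (1/2)) * exp (- \<sigma> * k * y)"
    by (simp add: S_def h_def)
  also have "\<dots> = D * exp (- \<sigma> * k * y) + S / 2 * (exp (\<sigma> * k * y) * exp (- \<sigma> * k * y))"
    by (simp add: algebra_simps)
  also have "\<dots> = D * exp (- \<sigma> * k * y) + S / 2"
    unfolding exp_add[symmetric] by simp
  also have "\<dots> \<le> D * exp (k * l) + S / 2"
    using sb(1)[OF y] D by (intro add_right_mono mult_left_mono) auto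
  finally have "S \<le> 2 * D * exp (k * l)" by simp
  then have "h x \<le> 2 * D * exp (k * l)" using max[OF x] by (simp add: S_def)
  then have "h x * exp (\<sigma> * k * x) \<le> 2 * D * exp (k * l) * exp (k * l)"
    using sb(2)[OF x] D nn[OF x] by (intro mult_mono) auto
  moreover have "h x * exp (\<sigma> * k * x) = d x"
    by (simp add: h_def mult.assoc flip: exp_add)
  ultimately show ?thesis
    by (simp add: mult.assoc flip: exp_add)
qed

text \<open>The kernel vanishes for s >= x, so the integral can run over the whole string. The
  parameter stands for \<open>z\<^sup>2\<close>, and values outside \<open>{0..l}\<close> are free,
  so that conjugates and rescaled fixed points qualify directly.\<close>

definition volterra :: "complex \<Rightarrow> (real \<Rightarrow> complex) \<Rightarrow> bool" where
  "volterra \<nu> f \<longleftrightarrow> continuous_on {0..l} f \<and>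
     (\<forall>x\<in>{0..l}. f x = 1 - \<nu> * (LINT s|M. complex_of_real (max 0 (x - s)) * f s))"

lemma volterra_continuous: "volterra \<nu> f \<Longrightarrow> continuous_on {0..l} f"
  by (simp add: volterra_def)

lemma volterra_eq:
  "volterra \<nu> f \<Longrightarrow> x \<in> {0..l} \<Longrightarrow> f x = 1 - \<nu> * (LINT s|M. complex_of_real (max 0 (x - s)) * f s)"
  by (simp add: volterra_def)

lemma integrable_kernel:
  fixes f :: "real \<Rightarrow> complex"
  assumes "continuous_on {0..l} f"
  shows "integrable M (\<lambda>s. complex_of_real (max 0 (x - s)) * f s)"
  by (intro integrable_continuous continuous_intros assms)

text \<open>A small residual means a small error, by Gronwall for |g - f|. Residual 0 gives
  uniqueness, g = 0 with residual 1 gives the a priori bound \<open>phi_le\<close>, and the solution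
  for another string gives \<open>phi_stable\<close>.\<close>

lemma approximate_solution:
  assumes f: "volterra \<nu> f" and g: "continuous_on {0..l} g"
    and res: "\<And>x. x \<in> {0..l} \<Longrightarrow>
      norm (g x - 1 + \<nu> * (LINT s|M. complex_of_real (max 0 (x - s)) * g s)) \<le> D"
    and k: "0 < k" "2 * norm \<nu> * measure M {0..l} \<le> k" and x: "x \<in> {0..l}"
  shows "norm (g x - f x) \<le> 2 * D * exp (2 * k * l)"
proof -
  have fc: "continuous_on {0..l} f" using f by (rule volterra_continuous)
  have D: "0 \<le> D" using norm_ge_zero res[OF x] by (rule order_trans)
  show ?thesis
  proof (rule gronwall[where d = "\<lambda>x. norm (g x - f x)" and L = "norm \<nu>" and \<sigma> = 1])
    fix x assume x: "x \<in> {0..l}"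
    let ?K = "\<lambda>s. complex_of_real (max 0 (x - s))"
    have "g x - f x = (g x - 1 + \<nu> * (LINT s|M. ?K s * g s)) - \<nu> * (LINT s|M. ?K s * (g s - f s))"
      using volterra_eq[OF f x] integrable_kernel[OF fc, of x] integrable_kernel[OF g, of x]
      by (simp add: right_diff_distrib Bochner_Integration.integral_diff algebra_simps)
    also have "norm \<dots> \<le> norm (g x - 1 + \<nu> * (LINT s|M. ?K s * g s))
        + norm (\<nu> * (LINT s|M. ?K s * (g s - f s)))"
      by (rule norm_triangle_ineq4)
    also have "\<dots> \<le> D + norm \<nu> * (LINT s|M. norm (?K s * (g s - f s)))"
      using res[OF x] integral_norm_bound[of M "\<lambda>s. ?K s * (g s - f s)"]
      by (intro add_mono) (auto simp: norm_mult intro!: mult_left_mono)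
    finally show "norm (g x - f x) \<le> D + norm \<nu> * (LINT s|M. max 0 (1 * (x - s)) * norm (g s - f s))"
      by (simp add: norm_mult)
  qed (use x k D in \<open>auto intro!: continuous_intros fc g\<close>)
qed

lemma volterra_unique:
  assumes "volterra \<nu> f" "volterra \<nu> g" "x \<in> {0..l}"
  shows "f x = g x"
proof -
  have "norm (g x - f x) \<le> 2 * 0 * exp (2 * (2 * norm \<nu> * measure M {0..l} + 1) * l)"
    by (rule approximate_solution[where \<nu> = \<nu>])
       (use assms in \<open>auto simp: volterra_continuous volterra_eq[of \<nu> g] intro!: add_nonneg_pos\<close>)
  then show ?thesis by simp
qed

lemma volterra_exists: "\<exists>f. volterra \<nu> f"
proof -
  define k where "k = 2 * norm \<nu> * measure M {0..l} + 1"
  have k: "0 < k" "2 * norm \<nu> * measure M {0..l} \<le> k"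
    by (auto simp: k_def intro!: add_nonneg_pos)
  \<comment> \<open>The unknown is h x = exp (- k x) f x: with this weight the integral operator
    contracts by |\<nu>| * mass / k <= 1/2 on all of [0,l] at once.\<close>
  define I where "I h x = (LINT s|M. complex_of_real (max 0 (x - s)) * (complex_of_real (exp (k * s)) * h s))"
    for h :: "real \<Rightarrow> complex" and x
  \<comment> \<open>Clamping to [0,l], because the fixed point is sought among the bounded
    continuous functions on the whole line.\<close>
  define c where "c x = max 0 (min l x)" for x
  have c: "c x \<in> {0..l}" for x using length_pos by (auto simp: c_def)
  have c_id: "c x = x" if "x \<in> {0..l}" for x using that by (auto simp: c_def)
  have c_cont: "continuous_on UNIV c" unfolding c_def by (intro continuous_intros)
  define T where "T h x = complex_of_real (exp (- k * c x)) * (1 - \<nu> * I h (c x))" for h x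
  have int: "integrable M (\<lambda>s. complex_of_real (max 0 (x - s)) * (complex_of_real (exp (k * s)) * apply_bcontfun h s))"
    for h :: "real \<Rightarrow>\<^sub>C complex" and x
    by (intro integrable_continuous continuous_intros) simp
  have I_cont: "continuous_on UNIV (I h)" for h :: "real \<Rightarrow>\<^sub>C complex"
  proof -
    have "(exp (k * l) * norm h * measure M {0..l})-lipschitz_on UNIV (I h)"
    proof (rule lipschitz_onI)
      fix x y :: real
      have "I h x - I h y = (LINT s|M. complex_of_real (max 0 (x - s) - max 0 (y - s)) *
          (complex_of_real (exp (k * s)) * h s))"
        unfolding I_def using int[of x h] int[of y h]
        by (subst Bochner_Integration.integral_diff[symmetric]) (simp_all add: algebra_simps)
      also have "norm \<dots> \<le> (dist x y * (exp (k * l) * norm h)) * measure M {0..l}"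
      proof (rule norm_integral_le)
        fix s assume "s \<in> {0..l}"
        then show "norm (complex_of_real (max 0 (x - s) - max 0 (y - s)) *
          (complex_of_real (exp (k * s)) * h s)) \<le> dist x y * (exp (k * l) * norm h)"
          unfolding norm_mult norm_of_real using k
          by (intro mult_mono) (auto simp: dist_real_def max_def norm_bounded)
      qed auto
      finally show "dist (I h x) (I h y) \<le> exp (k * l) * norm h * measure M {0..l} * dist x y"
        by (simp add: dist_norm algebra_simps)
    qed auto
    then show ?thesis by (rule lipschitz_on_continuous_on)
  qed
  have T_cont: "continuous_on UNIV (T h)" for h :: "real \<Rightarrow>\<^sub>C complex"
    unfolding T_def
    by (intro continuous_intros continuous_on_compose2[OF I_cont[of h]] c_cont) auto
  have T_b: "T h \<in> bcontfun" for h :: "real \<Rightarrow>\<^sub>C complex"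
  proof -
    obtain B where B: "\<And>x. x \<in> {0..l} \<Longrightarrow> norm (T h x) \<le> B"
      using bounded_continuous[OF continuous_on_subset[OF T_cont[of h]]] by blast
    have "norm (T h x) \<le> B" for x
      using B[OF c[of x]] c_id[OF c[of x]] by (simp add: T_def)
    then show ?thesis by (intro bcontfun_normI[OF T_cont]) auto
  qed
  define U where "U h = Bcontfun (T (apply_bcontfun h))" for h
  have U: "apply_bcontfun (U h) = T h" for h
    unfolding U_def by (rule Bcontfun_inverse[OF T_b])
  have "\<exists>!h. U h = h"
  proof (rule banach_fix_type[where c = "1/2"])
    show "\<forall>h g. dist (U h) (U g) \<le> 1/2 * dist h g"
    proof (intro allI dist_bound)
      fix h g :: "real \<Rightarrow>\<^sub>C complex" and x
      define y where "y = c x"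
      have y: "y \<in> {0..l}" using c by (simp add: y_def)
      have "I h y - I g y = (LINT s|M. complex_of_real (max 0 (y - s)) * (complex_of_real (exp (k * s)) * (h s - g s)))"
        unfolding I_def using int[of y h] int[of y g]
        by (subst Bochner_Integration.integral_diff[symmetric]) (simp_all add: algebra_simps)
      also have "norm \<dots> \<le> (exp (k * y) / k * dist h g) * measure M {0..l}"
      proof (rule norm_integral_le)
        fix s assume s: "s \<in> {0..l}"
        have "k * (y - s) \<le> exp (k * (y - s))"
          using exp_ge_add_one_self[of "k * (y - s)"] by linarith
        then have "max 0 (y - s) \<le> exp (k * (y - s)) / k"
          using k by (simp add: field_simps max_def)
        then have "\<bar>max 0 (y - s)\<bar> * exp (k * s) \<le> exp (k * (y - s)) / k * exp (k * s)"
          by (intro mult_right_mono) auto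
        also have "\<dots> = exp (k * y) / k"
          by (simp add: right_diff_distrib exp_diff)
        finally have "\<bar>max 0 (y - s)\<bar> * exp (k * s) * norm (h s - g s) \<le> exp (k * y) / k * dist h g"
          using dist_bounded[of h s g] k by (intro mult_mono) (auto simp: dist_norm)
        then show "norm (complex_of_real (max 0 (y - s)) * (complex_of_real (exp (k * s)) * (h s - g s)))
            \<le> exp (k * y) / k * dist h g"
          by (simp add: norm_mult mult.assoc)
      qed (use k in auto)
      finally have I: "norm (I h y - I g y) \<le> exp (k * y) / k * dist h g * measure M {0..l}" .
      have "T h x - T g x = - (complex_of_real (exp (- k * y)) * \<nu> * (I h y - I g y))"
        by (simp add: T_def y_def algebra_simps)
      then have "dist (T h x) (T g x) = exp (- k * y) * norm \<nu> * norm (I h y - I g y)"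
        by (simp add: dist_norm norm_mult)
      also have "\<dots> \<le> exp (- k * y) * norm \<nu> * (exp (k * y) / k * dist h g * measure M {0..l})"
        by (intro mult_left_mono I) auto
      also have "\<dots> = (norm \<nu> * measure M {0..l} / k) * dist h g"
        by (simp add: exp_minus field_simps)
      also have "\<dots> \<le> 1/2 * dist h g"
        using k by (intro mult_right_mono) (auto simp: field_simps)
      finally show "dist (apply_bcontfun (U h) x) (apply_bcontfun (U g) x) \<le> 1/2 * dist h g"
        by (simp add: U)
    qed
  qed auto
  then obtain h where "U h = h" by blast
  then have h: "apply_bcontfun h = T h" using U[of h] by simp
  have "volterra \<nu> (\<lambda>x. complex_of_real (exp (k * x)) * h x)"
    unfolding volterra_def
  proof (intro conjI ballI)
    fix x assume x: "x \<in> {0..l}"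
    have "complex_of_real (exp (k * x)) * h x
        = complex_of_real (exp (k * x)) * complex_of_real (exp (- k * x)) * (1 - \<nu> * I h x)"
      by (subst h) (simp add: T_def c_id[OF x] mult.assoc)
    also have "complex_of_real (exp (k * x)) * complex_of_real (exp (- k * x)) = 1"
      by (simp flip: of_real_mult exp_add)
    finally show "complex_of_real (exp (k * x)) * h x = 1 - \<nu> * (LINT s|M. complex_of_real (max 0 (x - s)) *
        (complex_of_real (exp (k * s)) * h s))"
      by (simp add: I_def)
  qed (intro continuous_intros, simp)
  then show ?thesis by blast
qed

section \<open>Passage from \<open>phi\<close> and \<open>char_fun\<close> to the Volterra
  equation\<close>

lemma set_integral_kernel:
  assumes "x \<in> {0..l}"
  shows "(LINT s:{0..x}|M. complex_of_real (x - s) * f s) = (LINT s|M. complex_of_real (max 0 (x - s)) * f s)"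
  unfolding set_lebesgue_integral_def
  by (intro Bochner_Integration.integral_cong) (auto simp: indicator_def max_def)

lemma is_phi_iff: "is_phi l M z f \<longleftrightarrow> f \<in> extensional {0..l} \<and> volterra (z\<^sup>2) f"
  unfolding is_phi_def volterra_def by (simp add: set_integral_kernel conj_assoc del: of_real_diff)

lemma phi_volterra: "volterra (z\<^sup>2) (phi l M z)"
proof -
  obtain f where f: "volterra (z\<^sup>2) f" using volterra_exists by blast
  have cong: "volterra (z\<^sup>2) (restrict f {0..l})"
    unfolding volterra_def
  proof (intro conjI ballI)
    show "continuous_on {0..l} (restrict f {0..l})"
      by (rule continuous_on_eq[OF volterra_continuous[OF f]]) simp
    fix x assume x: "x \<in> {0..l}"
    have "(LINT s|M. complex_of_real (max 0 (x - s)) * restrict f {0..l} s)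
        = (LINT s|M. complex_of_real (max 0 (x - s)) * f s)"
      by (intro Bochner_Integration.integral_cong) auto
    then show "restrict f {0..l} x = 1 - z\<^sup>2 * (LINT s|M. complex_of_real (max 0 (x - s)) * restrict f {0..l} s)"
      using volterra_eq[OF f x] x by simp
  qed
  have "is_phi l M z (phi l M z)"
    unfolding phi_def
  proof (rule theI[of "is_phi l M z"])
    show "is_phi l M z (restrict f {0..l})"
      using cong by (simp add: is_phi_iff)
    fix g assume "is_phi l M z g"
    then show "g = restrict f {0..l}"
      using volterra_unique[OF _ cong] by (auto simp: is_phi_iff intro: extensionalityI)
  qed
  then show ?thesis by (simp add: is_phi_iff)
qed

lemma char_fun_eq: "char_fun l M z = phi l M z l - \<i> * z * (LINT s|M. phi l M z s)"
  unfolding char_fun_def set_lebesgue_integral_def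
  by (intro arg_cong2[where f = "\<lambda>a b. a - \<i> * z * b"] refl Bochner_Integration.integral_cong) auto

end

section \<open>The Lagrange identity\<close>

context krein_string
begin

lemma indicator_measurable_M:
  assumes "A \<in> sets borel"
  shows "(indicator A :: real \<Rightarrow> real) \<in> borel_measurable M"
  using assms by (intro borel_measurable_M) simp

lemma integrable_indicator:
  fixes f :: "real \<Rightarrow> 'b :: {banach, second_countable_topology}"
  assumes "continuous_on {0..l} f" "A \<in> sets borel"
  shows "integrable M (\<lambda>s. indicat_real A s *\<^sub>R f s)"
proof -
  obtain B where B: "0 < B" "\<And>x. x \<in> {0..l} \<Longrightarrow> norm (f x) \<le> B"
    using bounded_continuous[OF assms(1)] by blast
  have [measurable]: "f \<in> borel_measurable M" "indicat_real A \<in> borel_measurable M"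
    using assms by (auto intro: continuous_measurable_M indicator_measurable_M)
  have "(\<lambda>s. indicat_real A s *\<^sub>R f s) \<in> borel_measurable M"
    by measurable
  then show ?thesis
    by (rule integrable_bounded[where B = B]) (use B in \<open>auto simp: indicator_def less_imp_le\<close>)
qed

text \<open>The factor x - max s r vanishes at r = x, which is why A may contain x or not. The point
  of this form is that the kernel x - max s r is symmetric in s and r.\<close>

lemma volterra_diff:
  assumes g: "volterra \<nu> g" and x: "x \<in> {0..l}" and A: "{..<x} \<subseteq> A" "A \<subseteq> {..x}"
    and s: "s \<in> {0..l}" "s \<in> A"
  shows "g x - g s = - \<nu> * (LINT r|M. indicat_real A r *\<^sub>R (complex_of_real (x - max s r) * g r))"
proof -
  have gc: "continuous_on {0..l} g" using g by (rule volterra_continuous)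
  have "g x - g s = - \<nu> * ((LINT r|M. complex_of_real (max 0 (x - r)) * g r)
      - (LINT r|M. complex_of_real (max 0 (s - r)) * g r))"
    using volterra_eq[OF g x] volterra_eq[OF g s(1)] by (simp add: algebra_simps)
  also have "(LINT r|M. complex_of_real (max 0 (x - r)) * g r)
      - (LINT r|M. complex_of_real (max 0 (s - r)) * g r)
      = (LINT r|M. complex_of_real (max 0 (x - r)) * g r - complex_of_real (max 0 (s - r)) * g r)"
    by (intro Bochner_Integration.integral_diff[symmetric] integrable_kernel gc)
  also have "\<dots> = (LINT r|M. indicat_real A r *\<^sub>R (complex_of_real (x - max s r) * g r))"
  proof (intro Bochner_Integration.integral_cong refl)
    fix r
    have "s \<le> x" using s A by auto
    moreover have "r \<le> x" if "r \<in> A" using A that by auto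
    moreover have "x \<le> r" if "r \<notin> A" using A that by (metis lessThan_iff not_le subsetD)
    ultimately have "max 0 (x - r) - max 0 (s - r) = indicat_real A r * (x - max s r)"
      by (cases "r \<in> A") (auto simp: max_def)
    then have "complex_of_real (max 0 (x - r) - max 0 (s - r)) * g r
        = complex_of_real (indicat_real A r * (x - max s r)) * g r" by simp
    then show "complex_of_real (max 0 (x - r)) * g r - complex_of_real (max 0 (s - r)) * g r
        = indicat_real A r *\<^sub>R (complex_of_real (x - max s r) * g r)"
      by (simp add: algebra_simps scaleR_conv_of_real)
  qed
  finally show ?thesis .
qed

end

text \<open>Green's formula for two strings: up to sign, the integrals on the left are the one-sided
  derivatives of f and g at x. Inserting \<open>volterra_diff\<close> turns each product into a
  single integral minus a double integral; the double integrals agree by Fubini, the kernel being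
  symmetric, and cancel.\<close>

lemma lagrange_identity:
  assumes M: "krein_string l M" and N: "krein_string l N"
    and f: "krein_string.volterra l M \<nu> f" and g: "krein_string.volterra l N \<mu> g"
    and x: "x \<in> {0..l}" and A: "A \<in> sets borel" "{..<x} \<subseteq> A" "A \<subseteq> {..x}"
  shows "g x * (\<nu> * (LINT s|M. indicat_real A s *\<^sub>R f s)) - f x * (\<mu> * (LINT s|N. indicat_real A s *\<^sub>R g s))
    = \<nu> * (LINT s|M. indicat_real A s *\<^sub>R (f s * g s)) - \<mu> * (LINT s|N. indicat_real A s *\<^sub>R (f s * g s))"
proof -
  interpret M: krein_string l M by (rule M)
  interpret N: krein_string l N by (rule N)
  interpret MN: pair_sigma_finite M N ..
  have fc: "continuous_on {0..l} f" using f by (rule M.volterra_continuous)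
  have gc: "continuous_on {0..l} g" using g by (rule N.volterra_continuous)
  define k where "k s r = indicat_real A s *\<^sub>R f s * (indicat_real A r *\<^sub>R (complex_of_real (x - max s r) * g r))" for s r
  have expand: "a x * (\<nu> * (LINT s|M'. indicat_real A s *\<^sub>R b s)) = \<nu> * (LINT s|M'. indicat_real A s *\<^sub>R (b s * a s))
      - \<nu> * \<mu> * (LINT s|M'. (LINT r|N'. indicat_real A s *\<^sub>R b s * (indicat_real A r *\<^sub>R (complex_of_real (x - max s r) * a r))))"
    if "krein_string l M'" "krein_string l N'" "krein_string.volterra l N' \<mu> a" "continuous_on {0..l} b" for M' N' a b \<nu> \<mu>
  proof -
    interpret M': krein_string l M' by fact
    interpret N': krein_string l N' by fact
    have ac: "continuous_on {0..l} a" using that by (intro N'.volterra_continuous)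
    define X Y D where "X = (LINT s|M'. indicat_real A s *\<^sub>R b s)"
      and "Y = (LINT s|M'. indicat_real A s *\<^sub>R (b s * a s))"
      and "D = (LINT s|M'. (LINT r|N'. indicat_real A s *\<^sub>R b s * (indicat_real A r *\<^sub>R (complex_of_real (x - max s r) * a r))))"
    have "a x * (LINT s|M'. indicat_real A s *\<^sub>R b s) - (LINT s|M'. indicat_real A s *\<^sub>R (b s * a s))
        = (LINT s|M'. indicat_real A s *\<^sub>R (a x * b s)) - (LINT s|M'. indicat_real A s *\<^sub>R (b s * a s))"
      by (subst integral_mult_right_zero[symmetric]) (simp add: mult.assoc mult.commute)
    also have "\<dots> = (LINT s|M'. indicat_real A s *\<^sub>R (a x * b s) - indicat_real A s *\<^sub>R (b s * a s))"
      by (intro Bochner_Integration.integral_diff[symmetric] M'.integrable_indicator A continuous_intros ac that)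
    also have "\<dots> = (LINT s|M'. - \<mu> * (LINT r|N'. indicat_real A s *\<^sub>R b s * (indicat_real A r *\<^sub>R (complex_of_real (x - max s r) * a r))))"
    proof (intro Bochner_Integration.integral_cong refl)
      fix s assume "s \<in> space M'"
      then have s: "s \<in> {0..l}" by simp
      show "indicat_real A s *\<^sub>R (a x * b s) - indicat_real A s *\<^sub>R (b s * a s)
         = - \<mu> * (LINT r|N'. indicat_real A s *\<^sub>R b s * (indicat_real A r *\<^sub>R (complex_of_real (x - max s r) * a r)))"
      proof (cases "s \<in> A")
        case True
        have "indicat_real A s *\<^sub>R (a x * b s) - indicat_real A s *\<^sub>R (b s * a s) = b s * (a x - a s)"
          using True by (simp add: algebra_simps)
        also have "\<dots> = - \<mu> * (b s * (LINT r|N'. indicat_real A r *\<^sub>R (complex_of_real (x - max s r) * a r)))"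
          by (subst N'.volterra_diff[OF that(3) x A(2,3) s True]) simp
        finally show ?thesis using True by (simp del: mult_scaleR_right of_real_diff)
      qed simp
    qed
    also have "\<dots> = - \<mu> * D"
      unfolding D_def by (rule integral_mult_right_zero)
    finally have "a x * X - Y = - \<mu> * D"
      by (simp only: X_def Y_def)
    then have aX: "a x * X = - \<mu> * D + Y"
      by (simp only: diff_eq_eq)
    have "a x * (\<nu> * X) = \<nu> * (a x * X)"
      by (rule mult.left_commute)
    also have "\<dots> = \<nu> * Y - \<nu> * \<mu> * D"
      unfolding aX by (simp add: algebra_simps)
    finally have "a x * (\<nu> * X) = \<nu> * Y - \<nu> * \<mu> * D" .
    then show ?thesis unfolding X_def Y_def D_def .
  qed
  have [measurable]: "f \<in> borel_measurable M" "g \<in> borel_measurable N"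
    "(indicator A :: real \<Rightarrow> real) \<in> borel_measurable M" "(indicator A :: real \<Rightarrow> real) \<in> borel_measurable N"
    "(\<lambda>x. x) \<in> borel_measurable M" "(\<lambda>x. x) \<in> borel_measurable N"
    using fc gc A by (auto intro: M.continuous_measurable_M N.continuous_measurable_M
      M.indicator_measurable_M N.indicator_measurable_M continuous_intros)
  obtain Bf where Bf: "0 < Bf" "\<And>x. x \<in> {0..l} \<Longrightarrow> norm (f x) \<le> Bf" using M.bounded_continuous[OF fc] by blast
  obtain Bg where Bg: "0 < Bg" "\<And>x. x \<in> {0..l} \<Longrightarrow> norm (g x) \<le> Bg" using M.bounded_continuous[OF gc] by blast
  have kb: "norm (k s r) \<le> Bf * (l * Bg)" if "s \<in> {0..l}" "r \<in> {0..l}" for s r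
    unfolding k_def norm_mult norm_scaleR using that Bf Bg x
    by (intro mult_mono order_trans[OF mult_left_le_one_le]) (auto simp: indicator_def simp del: of_real_diff)
  interpret P: finite_measure "M \<Otimes>\<^sub>M N"
    by (intro finite_measure_pair_measure M.finite_measure_M N.finite_measure_M)
  have "integrable (M \<Otimes>\<^sub>M N) (case_prod k)"
  proof (rule P.integrable_const_bound[where B = "Bf * (l * Bg)"])
    show "AE p in M \<Otimes>\<^sub>M N. norm (case_prod k p) \<le> Bf * (l * Bg)"
      by (rule AE_I2) (auto simp: space_pair_measure intro!: kb)
    show "case_prod k \<in> borel_measurable (M \<Otimes>\<^sub>M N)"
      unfolding k_def by measurable
  qed
  then have "(LINT r|N. (LINT s|M. k s r)) = (LINT s|M. (LINT r|N. k s r))"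
    by (rule MN.Fubini_integral)
  moreover have "(LINT r|N. (LINT s|M. indicat_real A r *\<^sub>R g r * (indicat_real A s *\<^sub>R (complex_of_real (x - max r s) * f s))))
      = (LINT r|N. (LINT s|M. k s r))"
    by (intro Bochner_Integration.integral_cong) (auto simp: k_def max.commute ac_simps)
  ultimately show ?thesis
    using expand[OF M N g fc, of \<nu>] expand[OF N M f gc, of \<mu>]
    by (simp add: k_def mult.commute)
qed

section \<open>One-sided expansions\<close>

locale string_solution = krein_string +
  fixes \<nu> :: complex and \<phi> :: "real \<Rightarrow> complex"
  assumes solution: "volterra \<nu> \<phi>"
begin

lemma continuous: "continuous_on {0..l} \<phi>"
  by (rule volterra_continuous[OF solution])

lemma phi_eq: "x \<in> {0..l} \<Longrightarrow> \<phi> x = 1 - \<nu> * (LINT s|M. complex_of_real (max 0 (x - s)) * \<phi> s)"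
  by (rule volterra_eq[OF solution])

lemma phi_0: "\<phi> 0 = 1"
proof -
  have "(LINT s|M. complex_of_real (max 0 (0 - s)) * \<phi> s) = (LINT s|M. 0)"
    by (intro Bochner_Integration.integral_cong) auto
  then show ?thesis using phi_eq[of 0] length_pos by simp
qed

text \<open>\<open>slope {..x}\<close> is the right and \<open>slope {..<x}\<close> the left
  derivative of \<phi> at x; they differ by the contribution of an atom at x.\<close>

definition slope :: "real set \<Rightarrow> complex" where
  "slope A = - \<nu> * (LINT s|M. indicat_real A s *\<^sub>R \<phi> s)"

definition side :: "real \<Rightarrow> real \<Rightarrow> real set" where
  "side x y = (if x \<le> y then {..x} else {..<x})"

text \<open>Leaving out x makes the mass of this set tend to 0 with \<delta>, even if x carries an
  atom.\<close>

definition punctured :: "real \<Rightarrow> real \<Rightarrow> real set" where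
  "punctured x \<delta> = {s \<in> {0..l}. 0 < \<bar>s - x\<bar> \<and> \<bar>s - x\<bar> < \<delta>}"

text \<open>The remainder of max 0 (y - s) after the first-order expansion at x in the direction of
  y. It vanishes at s = x, so an atom at x enters \<open>expansion\<close> through the slope
  alone.\<close>

definition kern :: "real \<Rightarrow> real \<Rightarrow> real \<Rightarrow> real" where
  "kern x y s = max 0 (y - s) - max 0 (x - s) - (y - x) * indicat_real (side x y) s"

lemma side_borel [simp]: "side x y \<in> sets borel"
  by (simp add: side_def)

lemma punctured_sets [simp]: "punctured x \<delta> \<in> sets M"
proof -
  have "({x - \<delta> <..< x + \<delta>} - {x}) \<inter> {0..l} \<in> sets M" by (intro in_sets_M) auto
  also have "({x - \<delta> <..< x + \<delta>} - {x}) \<inter> {0..l} = punctured x \<delta>" by (auto simp: punctured_def)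
  finally show ?thesis .
qed

lemma punctured_small:
  assumes "0 < e"
  obtains \<delta> where "0 < \<delta>" "measure M (punctured x \<delta>) < e"
proof -
  have "(\<lambda>n. measure M (punctured x (1 / real (Suc n)))) \<longlonglongrightarrow> measure M (\<Inter>n. punctured x (1 / real (Suc n)))"
  proof (rule finite_Lim_measure_decseq)
    show "decseq (\<lambda>n. punctured x (1 / real (Suc n)))"
    proof (rule decseq_SucI)
      fix n
      have "1 / real (Suc (Suc n)) \<le> 1 / real (Suc n)" by (simp add: field_simps)
      then show "punctured x (1 / real (Suc (Suc n))) \<subseteq> punctured x (1 / real (Suc n))"
        unfolding punctured_def by force
    qed
  qed auto
  also have "(\<Inter>n. punctured x (1 / real (Suc n))) = {}"
  proof -
    have False if *: "\<And>n. s \<in> punctured x (1 / real (Suc n))" for s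
    proof -
      have "0 < \<bar>s - x\<bar>" using *[of 0] by (simp add: punctured_def)
      then obtain n where "1 / real (Suc n) < \<bar>s - x\<bar>" using nat_approx_posE by blast
      then show False using *[of n] by (simp add: punctured_def)
    qed
    then show ?thesis by blast
  qed
  finally have "(\<lambda>n. measure M (punctured x (1 / real (Suc n)))) \<longlonglongrightarrow> 0" by simp
  then have "eventually (\<lambda>n. measure M (punctured x (1 / real (Suc n))) < e) sequentially"
    using assms by (rule order_tendstoD)
  then obtain n where "measure M (punctured x (1 / real (Suc n))) < e"
    by (auto simp: eventually_sequentially)
  then show ?thesis using that[of "1 / real (Suc n)"] by simp
qed

lemma kern_nonneg: "0 \<le> kern x y s"
  by (auto simp: kern_def side_def indicator_def max_def)

lemma kern_le:
  assumes "s \<in> {0..l}" "\<bar>y - x\<bar> < \<delta>"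
  shows "kern x y s \<le> \<bar>y - x\<bar> * indicat_real (punctured x \<delta>) s"
  using assms by (auto simp: kern_def side_def indicator_def max_def punctured_def)

lemma kern_support: "kern x y s \<noteq> 0 \<Longrightarrow> \<bar>s - x\<bar> \<le> \<bar>y - x\<bar>"
  by (auto simp: kern_def side_def indicator_def max_def split: if_splits)

text \<open>This exempts an atom at the right end l from the sign condition of
  \<open>quadratic_upper_bound\<close>.\<close>

lemma kern_end: "x \<le> l \<Longrightarrow> y \<le> l \<Longrightarrow> kern x y l = 0"
  by (auto simp: kern_def side_def indicator_def max_def)

lemma kern_measurable [measurable]: "kern x y \<in> borel_measurable M"
proof -
  have [measurable]: "side x y \<in> sets borel" by simp
  have "(\<lambda>s. max 0 (y - s) - max 0 (x - s) - (y - x) * indicat_real (side x y) s) \<in> borel_measurable borel"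
    by measurable
  then show ?thesis unfolding kern_def[abs_def] by (rule borel_measurable_M)
qed

lemma kern_bounded: "s \<in> {0..l} \<Longrightarrow> \<bar>kern x y s\<bar> \<le> \<bar>y - x\<bar>"
  using kern_le[of s y x "\<bar>y - x\<bar> + 1"] kern_nonneg[of x y s]
  by (cases "s \<in> punctured x (\<bar>y - x\<bar> + 1)") auto

lemma kern_integrable:
  fixes h :: "real \<Rightarrow> 'b :: {banach, second_countable_topology}"
  assumes "continuous_on {0..l} h"
  shows "integrable M (\<lambda>s. kern x y s *\<^sub>R h s)"
proof -
  obtain B where B: "0 < B" "\<And>x. x \<in> {0..l} \<Longrightarrow> norm (h x) \<le> B"
    using bounded_continuous[OF assms] by blast
  have [measurable]: "h \<in> borel_measurable M" by (rule continuous_measurable_M[OF assms])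
  show ?thesis
    by (rule integrable_bounded[where B = "\<bar>y - x\<bar> * B"])
       (use B kern_bounded in \<open>auto intro!: mult_mono\<close>)
qed

lemma kern_integral_le:
  fixes h :: "real \<Rightarrow> 'b :: {banach, second_countable_topology}"
  assumes h: "continuous_on {0..l} h" and B: "\<And>s. s \<in> {0..l} \<Longrightarrow> \<bar>s - x\<bar> \<le> \<bar>y - x\<bar> \<Longrightarrow> norm (h s) \<le> B"
    and \<delta>: "\<bar>y - x\<bar> < \<delta>" and "0 \<le> B"
  shows "norm (LINT s|M. kern x y s *\<^sub>R h s) \<le> B * \<bar>y - x\<bar> * measure M (punctured x \<delta>)"
proof -
  have "norm (LINT s|M. kern x y s *\<^sub>R h s) \<le> (LINT s|M. norm (kern x y s *\<^sub>R h s))"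
    by (rule integral_norm_bound)
  also have "\<dots> \<le> (LINT s|M. B * \<bar>y - x\<bar> * indicat_real (punctured x \<delta>) s)"
  proof (intro integral_mono)
    show "integrable M (\<lambda>s. norm (kern x y s *\<^sub>R h s))"
      by (intro integrable_norm kern_integrable h)
    show "integrable M (\<lambda>s. B * \<bar>y - x\<bar> * indicat_real (punctured x \<delta>) s)"
      by (intro integrable_mult_right integrable_real_indicator) (auto simp: less_top emeasure_eq_measure)
    fix s assume "s \<in> space M"
    then have s: "s \<in> {0..l}" by simp
    show "norm (kern x y s *\<^sub>R h s) \<le> B * \<bar>y - x\<bar> * indicat_real (punctured x \<delta>) s"
    proof (cases "kern x y s = 0")
      case True
      then show ?thesis using \<open>0 \<le> B\<close> by simp
    next
      case False
      then have "norm (h s) \<le> B" using B s kern_support by blast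
      then have "kern x y s * norm (h s) \<le> (\<bar>y - x\<bar> * indicat_real (punctured x \<delta>) s) * B"
        using kern_le[OF s \<delta>] kern_nonneg[of x y s] by (intro mult_mono) auto
      then show ?thesis using kern_nonneg[of x y s] by (simp add: ac_simps)
    qed
  qed
  also have "\<dots> = B * \<bar>y - x\<bar> * measure M (punctured x \<delta>)"
    using sets.sets_into_space[OF punctured_sets[of x \<delta>]] by (simp add: Int_absorb1 Int_commute)
  finally show ?thesis .
qed

lemma expansion:
  assumes x: "x \<in> {0..l}" and y: "y \<in> {0..l}"
  shows "\<phi> y = \<phi> x + (y - x) *\<^sub>R slope (side x y) - \<nu> * (LINT s|M. kern x y s *\<^sub>R \<phi> s)"
proof -
  have combine: "fy = fx + t *\<^sub>R (- \<nu> * J) - \<nu> * K"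
    if "K = Iy - Ix - t *\<^sub>R J" "fx = 1 - \<nu> * Ix" "fy = 1 - \<nu> * Iy" for K Ix Iy J fx fy :: complex and t
  proof -
    have Iy: "Iy = K + Ix + t *\<^sub>R J"
      by (subst that(1)) (simp only: diff_diff_eq add.assoc diff_add_cancel)
    show ?thesis unfolding that(2) that(3) Iy by (simp add: algebra_simps scaleR_conv_of_real)
  qed
  have "(LINT s|M. kern x y s *\<^sub>R \<phi> s) =
      (LINT s|M. complex_of_real (max 0 (y - s)) * \<phi> s - complex_of_real (max 0 (x - s)) * \<phi> s
         - (y - x) *\<^sub>R (indicat_real (side x y) s *\<^sub>R \<phi> s))"
    by (intro Bochner_Integration.integral_cong refl) (simp add: kern_def scaleR_conv_of_real algebra_simps)
  also have "\<dots> = (LINT s|M. complex_of_real (max 0 (y - s)) * \<phi> s) - (LINT s|M. complex_of_real (max 0 (x - s)) * \<phi> s)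
      - (y - x) *\<^sub>R (LINT s|M. indicat_real (side x y) s *\<^sub>R \<phi> s)"
    by (subst Bochner_Integration.integral_diff Bochner_Integration.integral_diff integral_scaleR_right;
        (intro Bochner_Integration.integrable_diff integrable_kernel continuous integrable_scaleR_right integrable_indicator side_borel)?)+
      (rule refl)
  finally show ?thesis
    unfolding slope_def using phi_eq[OF x] phi_eq[OF y] by (rule combine)
qed

lemma phi_bounded:
  obtains B where "0 < B" "\<And>x. x \<in> {0..l} \<Longrightarrow> norm (\<phi> x) \<le> B"
  using bounded_continuous[OF continuous] by blast

text \<open>The remainder is at most |\<nu>| B |y - x| times the mass of a punctured neighbourhood,
  hence o(|y - x|). T may reach to both sides of x if the two slopes agree.\<close>

lemma has_derivative_one_sided:
  assumes x: "x \<in> {0..l}" and T: "T \<subseteq> {0..l}" and q: "\<And>y. y \<in> T \<Longrightarrow> y \<noteq> x \<Longrightarrow> slope (side x y) = q"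
  shows "(\<phi> has_vector_derivative q) (at x within T)"
  unfolding has_vector_derivative_def has_derivative_within_alt
proof (intro conjI allI impI)
  show "bounded_linear (\<lambda>h. h *\<^sub>R q)" by (rule bounded_linear_scaleR_left)
  obtain B where B: "0 < B" "\<And>x. x \<in> {0..l} \<Longrightarrow> norm (\<phi> x) \<le> B" using phi_bounded by blast
  fix e :: real assume e: "0 < e"
  have nB: "0 < norm \<nu> * B + 1" using B by (intro add_nonneg_pos) auto
  obtain \<delta> where \<delta>: "0 < \<delta>" "measure M (punctured x \<delta>) < e / (norm \<nu> * B + 1)"
    using punctured_small[of "e / (norm \<nu> * B + 1)"] e nB by auto
  show "\<exists>d>0. \<forall>y\<in>T. norm (y - x) < d \<longrightarrow> norm (\<phi> y - \<phi> x - (y - x) *\<^sub>R q) \<le> e * norm (y - x)"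
  proof (intro exI[of _ \<delta>] conjI ballI impI)
    fix y assume y: "y \<in> T" "norm (y - x) < \<delta>"
    show "norm (\<phi> y - \<phi> x - (y - x) *\<^sub>R q) \<le> e * norm (y - x)"
    proof (cases "y = x")
      case False
      have "\<phi> y - \<phi> x - (y - x) *\<^sub>R q = - (\<nu> * (LINT s|M. kern x y s *\<^sub>R \<phi> s))"
        using expansion[OF x, of y] q[OF y(1) False] y T by auto
      then have "norm (\<phi> y - \<phi> x - (y - x) *\<^sub>R q) = norm \<nu> * norm (LINT s|M. kern x y s *\<^sub>R \<phi> s)"
        by (simp add: norm_mult)
      also have "\<dots> \<le> norm \<nu> * (B * \<bar>y - x\<bar> * measure M (punctured x \<delta>))"
        using B y by (intro mult_left_mono kern_integral_le continuous) auto
      also have "\<dots> \<le> (norm \<nu> * B + 1) * \<bar>y - x\<bar> * measure M (punctured x \<delta>)"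
        by (simp add: algebra_simps)
      also have "\<dots> \<le> (norm \<nu> * B + 1) * \<bar>y - x\<bar> * (e / (norm \<nu> * B + 1))"
        using \<delta> nB by (intro mult_left_mono) auto
      also have "\<dots> = e * norm (y - x)" using nB by simp
      finally show ?thesis .
    qed simp
  qed (rule \<delta>)
qed

section \<open>Rotation of \<phi> around the origin\<close>

lemma volterra_cnj: "volterra (cnj \<nu>) (\<lambda>x. cnj (\<phi> x))"
  unfolding volterra_def
proof (intro conjI ballI)
  show "continuous_on {0..l} (\<lambda>x. cnj (\<phi> x))" by (intro continuous_intros continuous)
  fix x assume x: "x \<in> {0..l}"
  have "cnj (\<phi> x) = 1 - cnj \<nu> * cnj (LINT s|M. complex_of_real (max 0 (x - s)) * \<phi> s)"
    by (subst phi_eq[OF x]) simp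
  also have "cnj (LINT s|M. complex_of_real (max 0 (x - s)) * \<phi> s)
      = (LINT s|M. cnj (complex_of_real (max 0 (x - s)) * \<phi> s))"
    by (rule Bochner_Integration.integral_cnj[symmetric])
  finally show "cnj (\<phi> x) = 1 - cnj \<nu> * (LINT s|M. complex_of_real (max 0 (x - s)) * cnj (\<phi> s))"
    by (simp only: complex_cnj_mult complex_cnj_complex_of_real)
qed

text \<open>The Lagrange identity for \<phi> and its conjugate on the same string. The left side is
  |\<phi>|^2 times the one-sided derivative of arg \<phi>, so the sign of Im \<nu> fixes the sense
  of rotation.\<close>

lemma flux:
  assumes x: "x \<in> {0..l}" and A: "A \<in> sets borel" "{..<x} \<subseteq> A" "A \<subseteq> {..x}"
  shows "Im (slope A * cnj (\<phi> x)) = - Im \<nu> * (LINT s|M. indicat_real A s * (norm (\<phi> s))\<^sup>2)"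
proof -
  define I where "I = (LINT s|M. indicat_real A s *\<^sub>R \<phi> s)"
  define R where "R = (LINT s|M. indicat_real A s * (norm (\<phi> s))\<^sup>2)"
  have "complex_of_real R = (LINT s|M. complex_of_real (indicat_real A s * (norm (\<phi> s))\<^sup>2))"
    unfolding R_def by (rule integral_complex_of_real[symmetric])
  also have "\<dots> = (LINT s|M. indicat_real A s *\<^sub>R (\<phi> s * cnj (\<phi> s)))"
    unfolding complex_norm_square[symmetric] by (simp add: scaleR_conv_of_real)
  finally have R: "(LINT s|M. indicat_real A s *\<^sub>R (\<phi> s * cnj (\<phi> s))) = complex_of_real R" by simp
  have I: "(LINT s|M. indicat_real A s *\<^sub>R cnj (\<phi> s)) = cnj I"
    unfolding I_def by (subst Bochner_Integration.integral_cnj[symmetric]) (simp only: complex_cnj_scaleR)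
  define Z where "Z = cnj (\<phi> x) * (\<nu> * I)"
  have "Z - cnj Z = \<nu> * complex_of_real R - cnj \<nu> * complex_of_real R"
    using lagrange_identity[OF krein_string_axioms krein_string_axioms solution volterra_cnj x A] unfolding R I
    by (simp add: I_def Z_def)
  from arg_cong[OF this, of Im] have "Im Z = Im \<nu> * R" by simp
  moreover have "slope A * cnj (\<phi> x) = - Z"
    by (simp add: slope_def I_def Z_def)
  ultimately show ?thesis unfolding R_def[symmetric] by simp
qed

lemma energy_integrable:
  assumes "A \<in> sets borel"
  shows "integrable M (\<lambda>s. indicat_real A s * (norm (\<phi> s))\<^sup>2)"
  using integrable_indicator[of "\<lambda>s. (norm (\<phi> s))\<^sup>2" A] assms
  by (simp add: continuous_intros continuous)

text \<open>A zero at x makes the flux vanish, so \<phi> = 0 almost everywhere on the mass up to x;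
  but then the Volterra equation gives \<phi> x = 1.\<close>

lemma phi_nonzero:
  assumes "Im \<nu> \<noteq> 0" and x: "x \<in> {0..l}"
  shows "\<phi> x \<noteq> 0"
proof
  assume 0: "\<phi> x = 0"
  have "(LINT s|M. indicat_real {..x} s * (norm (\<phi> s))\<^sup>2) = 0"
    using flux[OF x, of "{..x}"] 0 assms(1) by (auto simp: subset_eq)
  then have "AE s in M. indicat_real {..x} s * (norm (\<phi> s))\<^sup>2 = 0"
    by (subst (asm) integral_nonneg_eq_0_iff_AE[OF energy_integrable]) auto
  then have "(LINT s|M. complex_of_real (max 0 (x - s)) * \<phi> s) = 0"
    by (intro integral_eq_zero_AE) (auto elim!: eventually_mono simp: indicator_def max_def split: if_splits)
  then show False using phi_eq[OF x] 0 by simp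
qed

lemma flux_pos:
  assumes "Im \<nu> < 0" and x: "x \<in> {0..l}" and A: "A \<in> sets borel" "{..<x} \<subseteq> A" "A \<subseteq> {..x}"
    and pos: "0 < measure M (A \<inter> {0..l})"
  shows "0 < Im (slope A * cnj (\<phi> x))"
proof -
  have "0 \<noteq> (LINT s|M. indicat_real A s * (norm (\<phi> s))\<^sup>2)"
  proof
    assume "0 = (LINT s|M. indicat_real A s * (norm (\<phi> s))\<^sup>2)"
    then have "AE s in M. indicat_real A s * (norm (\<phi> s))\<^sup>2 = 0"
      by (subst integral_nonneg_eq_0_iff_AE[OF energy_integrable[OF A(1)], symmetric]) auto
    then have "AE s in M. s \<notin> A \<inter> {0..l}"
      using AE_space by eventually_elim (use phi_nonzero assms in \<open>auto simp: indicator_def\<close>)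
    then have "A \<inter> {0..l} \<in> null_sets M"
      using AE_iff_null_sets[OF in_sets_M[OF A(1)]] by blast
    then have "measure M (A \<inter> {0..l}) = 0"
      by (rule measure_eq_0_null_sets)
    then show False using pos by simp
  qed
  moreover have "0 \<le> (LINT s|M. indicat_real A s * (norm (\<phi> s))\<^sup>2)"
    by (intro integral_nonneg_AE) auto
  ultimately show ?thesis
    unfolding flux[OF x A] using assms(1) by (intro mult_pos_pos) linarith+
qed

lemma slope_jump: "x \<in> {0..l} \<Longrightarrow> slope {..x} = slope {..<x} - \<nu> * \<phi> x * measure M {x}"
proof -
  assume x: "x \<in> {0..l}"
  have sx: "{x} \<in> sets M" using in_sets_M[of "{x}"] x by auto
  have "(LINT s|M. indicat_real {..x} s *\<^sub>R \<phi> s)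
      = (LINT s|M. indicat_real {..<x} s *\<^sub>R \<phi> s + indicat_real {x} s *\<^sub>R \<phi> x)"
    by (intro Bochner_Integration.integral_cong) (auto simp: indicator_def)
  also have "\<dots> = (LINT s|M. indicat_real {..<x} s *\<^sub>R \<phi> s) + (LINT s|M. indicat_real {x} s *\<^sub>R \<phi> x)"
    by (intro Bochner_Integration.integral_add integrable_indicator continuous continuous_intros) auto
  also have "(LINT s|M. indicat_real {x} s *\<^sub>R \<phi> x) = measure M {x} *\<^sub>R \<phi> x"
  proof (subst integral_scaleR_left)
    show "integrable M (indicat_real {x})"
      using sx by (rule integrable_real_indicator) (simp add: less_top[symmetric])
    have "{x} \<inter> space M = {x}" using x by auto
    then show "(LINT s|M. indicat_real {x} s) *\<^sub>R \<phi> x = measure M {x} *\<^sub>R \<phi> x"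
      using Bochner_Integration.integral_indicator[of M "{x}"] by simp
  qed
  finally show ?thesis by (simp add: slope_def algebra_simps scaleR_conv_of_real)
qed

text \<open>The left end of the support is taken as the supremum of the points with no mass strictly
  to their left; if no mass lies below l, this gives a = l.\<close>

lemma start_of_support:
  obtains a where "a \<in> {0..l}" "AE s in M. a \<le> s"
    "\<And>y. a < y \<Longrightarrow> y \<le> l \<Longrightarrow> 0 < measure M ({..<y} \<inter> {0..l})"
proof -
  define Z where "Z = {x \<in> {0..l}. measure M ({..<x} \<inter> {0..l}) = 0}"
  define a where "a = Sup Z"
  have "{..<0} \<inter> {0..l} = {}" by auto
  then have 0: "0 \<in> Z" using length_pos by (simp add: Z_def)
  have bdd: "bdd_above Z" by (rule bdd_aboveI[of _ l]) (auto simp: Z_def)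
  have a: "a \<in> {0..l}"
  proof -
    have "0 \<le> a" unfolding a_def by (rule cSup_upper[OF 0 bdd])
    moreover have "a \<le> l" unfolding a_def by (rule cSup_least) (use 0 in \<open>auto simp: Z_def\<close>)
    ultimately show ?thesis by simp
  qed
  have "AE s in M. a - 1 / real (Suc n) < s" for n
  proof -
    have "a - 1 / real (Suc n) < a" by simp
    then obtain x where x: "x \<in> Z" "a - 1 / real (Suc n) < x"
      using less_cSup_iff[OF _ bdd] 0 unfolding a_def by blast
    then have "{..<x} \<inter> {0..l} \<in> null_sets M"
      using in_sets_M[of "{..<x}"] by (auto simp: Z_def null_sets_def emeasure_eq_measure)
    then have "AE s in M. s \<notin> {..<x} \<inter> {0..l}" by (rule AE_not_in)
    then show ?thesis using AE_space by eventually_elim (use x in auto)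
  qed
  then have "AE s in M. \<forall>n. a - 1 / real (Suc n) < s" by (simp add: AE_all_countable)
  then have "AE s in M. a \<le> s"
  proof eventually_elim
    case (elim s)
    show ?case
    proof (rule ccontr)
      assume "\<not> a \<le> s"
      then obtain n where "1 / real (Suc n) < a - s" using nat_approx_posE[of "a - s"] by auto
      then show False using elim[rule_format, of n] by simp
    qed
  qed
  moreover have "0 < measure M ({..<y} \<inter> {0..l})" if "a < y" "y \<le> l" for y
  proof (rule ccontr)
    assume "\<not> ?thesis"
    then have "measure M ({..<y} \<inter> {0..l}) = 0" using measure_nonneg[of M "{..<y} \<inter> {0..l}"] by linarith
    then have "y \<in> Z" using that a by (simp add: Z_def)
    then show False using cSup_upper[OF _ bdd, of y] that by (simp add: a_def)
  qed
  ultimately show ?thesis using that a by blast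
qed

end

section \<open>Strings concentrated on a maximum set\<close>

text \<open>The outcome of the variational argument, with \<nu> standing for
  \<open>\<omega>\<^sup>2\<close>. The sign of Im \<nu> is a normalization that
  \<open>finite_support\<close> removes by conjugation.\<close>

locale extremal_solution = string_solution +
  fixes \<kappa> :: complex and c a :: real
  assumes Im_nu: "Im \<nu> < 0" and kappa: "\<kappa> \<noteq> 0" and c_nonneg: "0 \<le> c"
    and le_c: "\<And>x. x \<in> {0..l} \<Longrightarrow> Re (\<kappa> * (\<phi> x)\<^sup>2) \<le> c"
    and AE_eq_c: "AE s in M. Re (\<kappa> * (\<phi> s)\<^sup>2) = c"
    and a_range: "a \<in> {0..l}" and AE_a: "AE s in M. a \<le> s"
    and mass_pos: "\<And>y. a < y \<Longrightarrow> y \<le> l \<Longrightarrow> 0 < measure M ({..<y} \<inter> {0..l})"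
begin

section \<open>The maximum set and the one-sided derivatives on it\<close>

definition g :: "real \<Rightarrow> real" where "g x = Re (\<kappa> * (\<phi> x)\<^sup>2)"

text \<open>Points to the left of a are left out: \<phi> = 1 on [0,a], so g may equal c on that
  whole interval.\<close>

definition S :: "real set" where "S = {x \<in> {a..l}. g x = c}"

lemma g_le: "x \<in> {0..l} \<Longrightarrow> g x \<le> c"
  using le_c by (simp only: g_def)

lemma S_D: "x \<in> S \<Longrightarrow> x \<in> {0..l}" "x \<in> S \<Longrightarrow> g x = c" "x \<in> S \<Longrightarrow> a \<le> x"
  using a_range by (auto simp: S_def)

lemma AE_S: "AE s in M. s \<in> S"
  using AE_eq_c AE_a AE_space by eventually_elim (simp add: S_def g_def)

lemma g_continuous: "continuous_on {0..l} g"
  unfolding g_def by (intro continuous_intros continuous)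

lemma mass_pos_side:
  assumes "a < x" "x \<le> l" "{..<x} \<subseteq> A" "A \<in> sets borel"
  shows "0 < measure M (A \<inter> {0..l})"
proof -
  have "measure M ({..<x} \<inter> {0..l}) \<le> measure M (A \<inter> {0..l})"
    using assms by (intro finite_measure_mono in_sets_M) auto
  then show ?thesis using mass_pos[of x] assms by linarith
qed

lemma phi_1:
  assumes "x \<in> {0..a}"
  shows "\<phi> x = 1"
proof -
  have x: "x \<in> {0..l}" using assms a_range by auto
  have "(LINT s|M. complex_of_real (max 0 (x - s)) * \<phi> s) = 0"
    by (rule integral_eq_zero_AE) (use AE_a assms in \<open>auto elim!: eventually_mono simp: max_def\<close>)
  then show ?thesis using phi_eq[OF x] by simp
qed

lemma g_derivative:
  assumes "(\<phi> has_vector_derivative q) (at x within T)"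
  shows "(g has_real_derivative 2 * Re (\<kappa> * \<phi> x * q)) (at x within T)"
proof -
  have "((\<lambda>x. \<kappa> * (\<phi> x * \<phi> x)) has_vector_derivative \<kappa> * (\<phi> x * q + q * \<phi> x)) (at x within T)"
    by (intro has_vector_derivative_mult_right has_vector_derivative_mult assms)
  from bounded_linear.has_vector_derivative[OF bounded_linear_Re this]
  show ?thesis
    unfolding has_real_derivative_iff_has_vector_derivative g_def power2_eq_square
    by (simp add: algebra_simps)
qed

lemma g_right:
  assumes "x \<in> {0..l}"
  shows "(g has_real_derivative 2 * Re (\<kappa> * \<phi> x * slope {..x})) (at x within {x..l})"
  by (intro g_derivative has_derivative_one_sided) (use assms in \<open>auto simp: side_def\<close>)

lemma g_left:
  assumes "x \<in> {0..l}"
  shows "(g has_real_derivative 2 * Re (\<kappa> * \<phi> x * slope {..<x})) (at x within {0..x})"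
  by (intro g_derivative has_derivative_one_sided) (use assms in \<open>auto simp: side_def\<close>)

lemma right_le:
  assumes "x \<in> S" "x < l"
  shows "Re (\<kappa> * \<phi> x * slope {..x}) \<le> 0"
proof (rule ccontr)
  note x = S_D[OF assms(1)]
  assume "\<not> ?thesis"
  then obtain d where d: "0 < d" "\<And>h. 0 < h \<Longrightarrow> x + h \<in> {x..l} \<Longrightarrow> h < d \<Longrightarrow> g x < g (x + h)"
    using has_real_derivative_pos_inc_right[OF g_right[OF x(1)]] by auto
  define h where "h = min (d / 2) (l - x)"
  have "g x < g (x + h)" using d(1) assms by (intro d(2)) (auto simp: h_def min_def)
  moreover have "g (x + h) \<le> c" using d(1) x(1) assms by (intro g_le) (auto simp: h_def min_def)
  ultimately show False using x by simp
qed

lemma left_ge: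
  assumes "x \<in> S" "0 < x"
  shows "0 \<le> Re (\<kappa> * \<phi> x * slope {..<x})"
proof (rule ccontr)
  note x = S_D[OF assms(1)]
  assume "\<not> ?thesis"
  then obtain d where d: "0 < d" "\<And>h. 0 < h \<Longrightarrow> x - h \<in> {0..x} \<Longrightarrow> h < d \<Longrightarrow> g x < g (x - h)"
    using has_real_derivative_neg_dec_left[OF g_left[OF x(1)]] by auto
  define h where "h = min (d / 2) x"
  have "g x < g (x - h)" using d(1) assms by (intro d(2)) (auto simp: h_def min_def)
  moreover have "g (x - h) \<le> c" using d(1) x(1) assms by (intro g_le) (auto simp: h_def min_def)
  ultimately show False using x by simp
qed

text \<open>
  With \<open>u = \<kappa> \<phi>\<^sup>2\<close> and \<open>v = \<kappa> \<phi> \<phi>'\<close> one has \<open>Im (v * cnj u) = |\<kappa> \<phi>|\<^sup>2 Im (\<phi>' * cnj \<phi>)\<close>, so the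
  monotone rotation of \<open>\<phi>\<close> constrains \<open>v\<close>.
\<close>
lemma rotation:
  assumes "x \<in> {0..l}" "A \<in> sets borel" "{..<x} \<subseteq> A" "A \<subseteq> {..x}" "0 < measure M (A \<inter> {0..l})"
  shows "Re (\<kappa> * \<phi> x * slope A) * Im (\<kappa> * (\<phi> x)\<^sup>2) < Im (\<kappa> * \<phi> x * slope A) * g x"
proof -
  have "0 < (norm (\<kappa> * \<phi> x))\<^sup>2 * Im (slope A * cnj (\<phi> x))"
    using flux_pos[OF Im_nu assms] kappa phi_nonzero[OF _ assms(1)] Im_nu by (intro mult_pos_pos) auto
  also have "\<dots> = Im (complex_of_real ((norm (\<kappa> * \<phi> x))\<^sup>2) * (slope A * cnj (\<phi> x)))" by simp
  also have "complex_of_real ((norm (\<kappa> * \<phi> x))\<^sup>2) * (slope A * cnj (\<phi> x))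
      = (\<kappa> * \<phi> x * slope A) * cnj (\<kappa> * (\<phi> x)\<^sup>2)"
    unfolding complex_norm_square by (simp add: power2_eq_square)
  finally have "0 < Im ((\<kappa> * \<phi> x * slope A) * cnj (\<kappa> * (\<phi> x)\<^sup>2))" .
  moreover have "Im (v * cnj u) = Im v * Re u - Re v * Im u" for u v by simp
  ultimately show ?thesis by (simp only: g_def diff_gt_0_iff_gt)
qed

text \<open>With u = \<kappa> \<phi>^2 and v = \<kappa> \<phi> q one has \<kappa> q^2 = v^2 / u.
  Here v is purely imaginary and Re u = c > 0, so the real part is - (Im v)^2 c / |u|^2.\<close>

lemma square_slope:
  assumes "x \<in> S" "0 < c" "Re (\<kappa> * \<phi> x * q) = 0"
  shows "Re (\<kappa> * q\<^sup>2) \<le> 0" and "Im (\<kappa> * \<phi> x * q) \<noteq> 0 \<Longrightarrow> Re (\<kappa> * q\<^sup>2) < 0"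
proof -
  define u v where "u = \<kappa> * (\<phi> x)\<^sup>2" and "v = \<kappa> * \<phi> x * q"
  have u: "Re u = c" using S_D[OF assms(1)] by (simp add: u_def g_def)
  then have n: "0 < (norm u)\<^sup>2" using assms(2) by auto
  have "Re v = 0" using assms(3) by (simp only: v_def)
  then have "v = \<i> * complex_of_real (Im v)" by (simp add: complex_eq_iff)
  from arg_cong[OF this, of "\<lambda>w. w\<^sup>2"] have v2: "v\<^sup>2 = - complex_of_real ((Im v)\<^sup>2)"
    by (simp add: power_mult_distrib)
  have "(\<kappa> * q\<^sup>2) * complex_of_real ((norm u)\<^sup>2) = v\<^sup>2 * cnj u"
    unfolding complex_norm_square u_def v_def by (simp add: power2_eq_square)
  then have "Re ((\<kappa> * q\<^sup>2) * complex_of_real ((norm u)\<^sup>2)) = Re (- complex_of_real ((Im v)\<^sup>2) * cnj u)"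
    unfolding v2 by simp
  then have eq: "Re (\<kappa> * q\<^sup>2) * (norm u)\<^sup>2 = - ((Im v)\<^sup>2 * c)" using u by simp
  then have "Re (\<kappa> * q\<^sup>2) * (norm u)\<^sup>2 \<le> 0" using assms(2) by simp
  then show "Re (\<kappa> * q\<^sup>2) \<le> 0" using n by (simp add: mult_le_0_iff)
  show "Re (\<kappa> * q\<^sup>2) < 0" if "Im (\<kappa> * \<phi> x * q) \<noteq> 0"
  proof -
    have "Im v \<noteq> 0" using that unfolding v_def .
    then have "0 < (Im v)\<^sup>2 * c" using assms(2) by simp
    then have "Re (\<kappa> * q\<^sup>2) * (norm u)\<^sup>2 < 0" using eq by simp
    then show ?thesis using n by (simp add: mult_less_0_iff)
  qed
qed

text \<open>At a point of S the number u = \<kappa> \<phi>^2 would lie on the imaginary axis and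
  turn strictly in the same sense on both sides, so Re u would change sign. In the inequalities: for
  both slopes Re v has the sign opposite to Im u, whereas a maximum demands Re v >= 0 on the left
  and Re v <= 0 on the right.\<close>

lemma finite_if_c_zero:
  assumes "c = 0"
  shows "S \<subseteq> {a, l}"
proof
  fix x assume x: "x \<in> S"
  note x' = S_D[OF x]
  show "x \<in> {a, l}"
  proof (rule ccontr)
    assume "x \<notin> {a, l}"
    then have ax: "a < x" "x < l" using x' by auto
    then have "0 < x" using a_range by simp
    have "Re (\<kappa> * \<phi> x * slope A) * Im (\<kappa> * (\<phi> x)\<^sup>2) < 0" if "A \<in> {{..<x}, {..x}}" for A
    proof -
      have A: "A \<in> sets borel" "{..<x} \<subseteq> A" "A \<subseteq> {..x}" using that by auto
      show ?thesis
        using rotation[OF x'(1) A mass_pos_side[OF ax(1) less_imp_le[OF ax(2)] A(2,1)]]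
        by (simp only: x'(2) assms mult_zero_right)
    qed
    then have "Re (\<kappa> * \<phi> x * slope {..<x}) * Im (\<kappa> * (\<phi> x)\<^sup>2) < 0"
      "Re (\<kappa> * \<phi> x * slope {..x}) * Im (\<kappa> * (\<phi> x)\<^sup>2) < 0" by blast+
    then show False
      using left_ge[OF x \<open>0 < x\<close>] right_le[OF x ax(2)] by (simp only: mult_less_0_iff) linarith
  qed
qed

section \<open>Isolation of the points of the maximum set behind a\<close>

lemma S_closed: "closed S"
proof -
  have "closed ({a..l} \<inter> g -` {c})"
    by (rule continuous_closed_preimage) (use g_continuous a_range in \<open>auto elim: continuous_on_subset\<close>)
  also have "{a..l} \<inter> g -` {c} = S" by (auto simp: S_def)
  finally show ?thesis .
qed

lemma quadratic_upper_bound: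
  assumes sign: "AE s in M. s < l \<longrightarrow> 0 \<le> Re (\<nu> * \<kappa> * (\<phi> s)\<^sup>2)"
  obtains C where "0 \<le> C" "\<And>x y \<delta>. x \<in> S \<Longrightarrow> y \<in> {0..l} \<Longrightarrow> \<bar>y - x\<bar> < \<delta> \<Longrightarrow>
     g y \<le> c + 2 * (y - x) * Re (\<kappa> * \<phi> x * slope (side x y))
       + (y - x)\<^sup>2 * (Re (\<kappa> * (slope (side x y))\<^sup>2) + C * measure M (punctured x \<delta>))"
proof -
  obtain B where B: "0 < B" "\<And>x. x \<in> {0..l} \<Longrightarrow> norm (\<phi> x) \<le> B" using phi_bounded by blast
  define m where "m = measure M {0..l}"
  \<comment> \<open>Slope and remainder each contribute |\<nu>| B m to the Lipschitz constant of
    \<phi>.\<close>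
  define L where "L = 2 * (norm \<nu> * B * m)"
  have m: "0 \<le> m" and L: "0 \<le> L" using B by (auto simp: m_def L_def)
  have pm: "measure M (punctured x \<delta>) \<le> m" for x \<delta>
    unfolding m_def using sets.sets_into_space[OF punctured_sets] in_sets_M[of UNIV] by (intro finite_measure_mono) auto
  have slope_le: "norm (slope A) \<le> norm \<nu> * B * m" for A
  proof -
    have "norm (LINT s|M. indicat_real A s *\<^sub>R \<phi> s) \<le> B * m"
      unfolding m_def using B by (intro norm_integral_le) (auto simp: indicator_def less_imp_le)
    then show ?thesis by (simp add: slope_def norm_mult mult_left_mono mult.assoc)
  qed
  have lip: "norm (\<phi> y - \<phi> x) \<le> L * \<bar>y - x\<bar>" if "x \<in> {0..l}" "y \<in> {0..l}" for x y
  proof -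
    have "norm (LINT s|M. kern x y s *\<^sub>R \<phi> s) \<le> B * \<bar>y - x\<bar> * measure M (punctured x (\<bar>y - x\<bar> + 1))"
      using B by (intro kern_integral_le continuous) auto
    also have "\<dots> \<le> B * \<bar>y - x\<bar> * m" using B pm by (intro mult_left_mono) auto
    finally have I: "norm (LINT s|M. kern x y s *\<^sub>R \<phi> s) \<le> B * \<bar>y - x\<bar> * m" .
    have "\<phi> y - \<phi> x = (y - x) *\<^sub>R slope (side x y) - \<nu> * (LINT s|M. kern x y s *\<^sub>R \<phi> s)"
      using expansion[OF that] by simp
    also have "norm \<dots> \<le> norm ((y - x) *\<^sub>R slope (side x y)) + norm (\<nu> * (LINT s|M. kern x y s *\<^sub>R \<phi> s))"
      by (rule norm_triangle_ineq4)
    also have "\<dots> \<le> \<bar>y - x\<bar> * (norm \<nu> * B * m) + norm \<nu> * (B * \<bar>y - x\<bar> * m)"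
      unfolding norm_mult norm_scaleR using I slope_le by (intro add_mono mult_left_mono) auto
    also have "\<dots> = L * \<bar>y - x\<bar>" by (simp add: L_def algebra_simps)
    finally show ?thesis .
  qed
  \<comment> \<open>Of 4 L, one half comes from R and the other from the cross term of slope and
    remainder; the last summand comes from the squared remainder.\<close>
  define C where "C = norm \<kappa> * norm \<nu> * B * (4 * L + norm \<nu> * B * m)"
  have "0 \<le> C" using B m L by (auto simp: C_def)
  moreover have "g y \<le> c + 2 * (y - x) * Re (\<kappa> * \<phi> x * slope (side x y))
       + (y - x)\<^sup>2 * (Re (\<kappa> * (slope (side x y))\<^sup>2) + C * measure M (punctured x \<delta>))"
    if xS: "x \<in> S" and y: "y \<in> {0..l}" and \<delta>: "\<bar>y - x\<bar> < \<delta>" for x y \<delta>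
  proof -
    note x = S_D[OF xS]
    define q h \<mu> where "q = slope (side x y)" and "h = y - x" and "\<mu> = measure M (punctured x \<delta>)"
    define I J R where "I = (LINT s|M. kern x y s *\<^sub>R \<phi> s)"
      and "J = (LINT s|M. kern x y s *\<^sub>R (\<phi> s)\<^sup>2)"
      and "R = (LINT s|M. kern x y s *\<^sub>R ((\<phi> s - \<phi> x) * \<phi> s))"
    have mu: "0 \<le> \<mu>" "\<mu> \<le> m" using pm by (auto simp: \<mu>_def)
    have J: "J = \<phi> x * I + R"
    proof -
      have "J = (LINT s|M. \<phi> x * (kern x y s *\<^sub>R \<phi> s) + kern x y s *\<^sub>R ((\<phi> s - \<phi> x) * \<phi> s))"
        unfolding J_def
        by (intro Bochner_Integration.integral_cong refl) (simp add: algebra_simps power2_eq_square)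
      also have "\<dots> = (LINT s|M. \<phi> x * (kern x y s *\<^sub>R \<phi> s)) + R"
        unfolding R_def
        by (intro Bochner_Integration.integral_add integrable_mult_right kern_integrable continuous continuous_intros)
      finally show ?thesis unfolding I_def by (simp del: mult_scaleR_right)
    qed
    have "Re (\<nu> * \<kappa> * J) = (LINT s|M. Re (\<nu> * \<kappa> * (kern x y s *\<^sub>R (\<phi> s)\<^sup>2)))"
    proof -
      have int: "integrable M (\<lambda>s. kern x y s *\<^sub>R (\<phi> s)\<^sup>2)"
        by (intro kern_integrable continuous_intros continuous)
      have "\<nu> * \<kappa> * J = (LINT s|M. \<nu> * \<kappa> * (kern x y s *\<^sub>R (\<phi> s)\<^sup>2))"
        unfolding J_def by (rule integral_mult_right_zero[symmetric])
      then show ?thesis using int by (simp only: integral_Re[OF integrable_mult_right])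
    qed
    also have "\<dots> \<ge> 0"
    proof (rule integral_nonneg_AE)
      show "AE s in M. 0 \<le> Re (\<nu> * \<kappa> * (kern x y s *\<^sub>R (\<phi> s)\<^sup>2))"
        using sign AE_space
      proof eventually_elim
        case (elim s)
        have eq: "Re (\<nu> * \<kappa> * (kern x y s *\<^sub>R (\<phi> s)\<^sup>2)) = kern x y s * Re (\<nu> * \<kappa> * (\<phi> s)\<^sup>2)"
          by (simp only: mult_scaleR_right scaleR_complex.simps)
        show ?case
        proof (cases "s < l")
          case True
          then show ?thesis unfolding eq using elim kern_nonneg by (intro mult_nonneg_nonneg) auto
        next
          case False
          then have "s = l" using elim by auto
          then show ?thesis unfolding eq using kern_end[of x y] x y by simp
        qed
      qed
    qed
    finally have J_pos: "0 \<le> Re (\<nu> * \<kappa> * J)" .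
    have I_le: "norm I \<le> B * \<bar>h\<bar> * \<mu>"
      unfolding I_def h_def \<mu>_def using B \<delta> by (intro kern_integral_le continuous) auto
    have R_le: "norm R \<le> L * \<bar>h\<bar> * B * \<bar>h\<bar> * \<mu>"
      unfolding R_def h_def \<mu>_def
    proof (intro kern_integral_le continuous continuous_intros \<delta>)
      fix s assume s: "s \<in> {0..l}" "\<bar>s - x\<bar> \<le> \<bar>y - x\<bar>"
      have "norm (\<phi> s - \<phi> x) \<le> L * \<bar>y - x\<bar>"
        using lip[OF x(1) s(1)] mult_left_mono[OF s(2) L] by linarith
      then show "norm ((\<phi> s - \<phi> x) * \<phi> s) \<le> L * \<bar>y - x\<bar> * B"
        unfolding norm_mult using B s L by (intro mult_mono) auto
    qed (use L B in auto)
    have q_le: "norm q \<le> L"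
    proof -
      have "0 \<le> norm \<nu> * B * m" using B m by simp
      then show ?thesis unfolding q_def L_def using slope_le[of "side x y"] by linarith
    qed
    have y_eq: "\<phi> y = \<phi> x + h *\<^sub>R q - \<nu> * I"
      unfolding q_def h_def I_def by (rule expansion[OF x(1) y])
    define E where "E = 2 * (\<nu> * \<kappa> * R) - 2 * (h *\<^sub>R (\<kappa> * q * \<nu> * I)) + \<kappa> * \<nu>\<^sup>2 * I\<^sup>2"
    have "\<kappa> * (\<phi> y)\<^sup>2 = \<kappa> * (\<phi> x)\<^sup>2 + (2 * h) *\<^sub>R (\<kappa> * \<phi> x * q) + h\<^sup>2 *\<^sub>R (\<kappa> * q\<^sup>2) - 2 * (\<nu> * \<kappa> * J) + E"
      unfolding y_eq E_def J by (simp add: scaleR_conv_of_real power2_eq_square algebra_simps)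
    then have "Re (\<kappa> * (\<phi> y)\<^sup>2) = Re (\<kappa> * (\<phi> x)\<^sup>2 + (2 * h) *\<^sub>R (\<kappa> * \<phi> x * q) + h\<^sup>2 *\<^sub>R (\<kappa> * q\<^sup>2) - 2 * (\<nu> * \<kappa> * J) + E)"
      by (rule arg_cong)
    also have "\<dots> = Re (\<kappa> * (\<phi> x)\<^sup>2) + (2 * h) * Re (\<kappa> * \<phi> x * q) + h\<^sup>2 * Re (\<kappa> * q\<^sup>2) - 2 * Re (\<nu> * \<kappa> * J) + Re E"
      by simp
    finally have "g y = c + (2 * h) * Re (\<kappa> * \<phi> x * q) + h\<^sup>2 * Re (\<kappa> * q\<^sup>2) - 2 * Re (\<nu> * \<kappa> * J) + Re E"
      using x(2) by (simp only: g_def)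
    moreover have "Re E \<le> h\<^sup>2 * (C * \<mu>)"
    proof -
      have "Re E \<le> norm E" by (rule complex_Re_le_cmod)
      also have "\<dots> \<le> norm (2 * (\<nu> * \<kappa> * R)) + norm (2 * (h *\<^sub>R (\<kappa> * q * \<nu> * I))) + norm (\<kappa> * \<nu>\<^sup>2 * I\<^sup>2)"
        unfolding E_def by (intro order_trans[OF norm_triangle_ineq] add_right_mono norm_triangle_ineq4)
      also have "\<dots> = 2 * (norm \<nu> * norm \<kappa> * norm R) + 2 * (\<bar>h\<bar> * (norm \<kappa> * norm q * norm \<nu> * norm I))
          + norm \<kappa> * (norm \<nu>)\<^sup>2 * (norm I * norm I)"
        by (simp add: norm_mult norm_power power2_eq_square)
      also have "\<dots> \<le> 2 * (norm \<nu> * norm \<kappa> * (L * \<bar>h\<bar> * B * \<bar>h\<bar> * \<mu>))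
          + 2 * (\<bar>h\<bar> * (norm \<kappa> * L * norm \<nu> * (B * \<bar>h\<bar> * \<mu>)))
          + norm \<kappa> * (norm \<nu>)\<^sup>2 * ((B * \<bar>h\<bar> * \<mu>) * (B * \<bar>h\<bar> * m))"
      proof -
        have "B * \<bar>h\<bar> * \<mu> \<le> B * \<bar>h\<bar> * m" using B mu by (intro mult_left_mono) auto
        then have "norm I \<le> B * \<bar>h\<bar> * m" using I_le by linarith
        then show ?thesis
          using I_le R_le q_le B mu L
          by (intro add_mono mult_mono mult_left_mono[of "norm R"]) auto
      qed
      also have "\<dots> = (\<bar>h\<bar> * \<bar>h\<bar>) * (C * \<mu>)"
      proof -
        have "2 * (norm \<nu> * norm \<kappa> * (L * k * B * k * \<mu>)) + 2 * (k * (norm \<kappa> * L * norm \<nu> * (B * k * \<mu>)))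
          + norm \<kappa> * (norm \<nu>)\<^sup>2 * ((B * k * \<mu>) * (B * k * m)) = (k * k) * (C * \<mu>)" for k
          unfolding C_def by (simp add: power2_eq_square algebra_simps)
        then show ?thesis .
      qed
      also have "\<dots> = h\<^sup>2 * (C * \<mu>)" by (simp add: power2_eq_square)
      finally show ?thesis .
    qed
    ultimately have "g y \<le> c + (2 * h) * Re (\<kappa> * \<phi> x * q) + h\<^sup>2 * Re (\<kappa> * q\<^sup>2) + h\<^sup>2 * (C * \<mu>)"
      using J_pos by linarith
    then show ?thesis unfolding q_def h_def \<mu>_def by (simp only: distrib_left add.assoc)
  qed
  ultimately show ?thesis using that by blast
qed

text \<open>If r is nonzero, maximality makes the linear term negative on this side, and it beats
  the quadratic one up to distance 2 |r| / D. If r = 0, strict rotation forces Im (\<kappa> \<phi>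
  q) \<noteq> 0 for the slope q, then \<open>square_slope\<close> gives K < 0, and a small punctured
  mass keeps the quadratic coefficient negative.\<close>

lemma isolated_one_sided:
  assumes sign: "AE s in M. s < l \<longrightarrow> 0 \<le> Re (\<nu> * \<kappa> * (\<phi> s)\<^sup>2)"
    and "0 < c" and x: "x \<in> S" "a < x" and A: "A = {..<x} \<or> A = {..x}"
  obtains \<delta> where "0 < \<delta>" "\<And>y. y \<in> S \<Longrightarrow> y \<noteq> x \<Longrightarrow> side x y = A \<Longrightarrow> \<delta> \<le> \<bar>y - x\<bar>"
proof -
  obtain C where C: "0 \<le> C" "\<And>x y \<delta>. x \<in> S \<Longrightarrow> y \<in> {0..l} \<Longrightarrow> \<bar>y - x\<bar> < \<delta> \<Longrightarrow>
     g y \<le> c + 2 * (y - x) * Re (\<kappa> * \<phi> x * slope (side x y))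
       + (y - x)\<^sup>2 * (Re (\<kappa> * (slope (side x y))\<^sup>2) + C * measure M (punctured x \<delta>))"
    using quadratic_upper_bound[OF sign] by blast
  note x' = S_D[OF x(1)]
  have A': "A \<in> sets borel" "{..<x} \<subseteq> A" "A \<subseteq> {..x}" using A by auto
  define r K where "r = Re (\<kappa> * \<phi> x * slope A)" and "K = Re (\<kappa> * (slope A)\<^sup>2)"
  have upper: "0 \<le> 2 * (y - x) * r + (y - x)\<^sup>2 * (K + C * measure M (punctured x \<delta>))"
    if "y \<in> S" "side x y = A" "\<bar>y - x\<bar> < \<delta>" for y \<delta>
    using C(2)[OF x(1) S_D(1)[OF that(1)] that(3)] S_D(2)[OF that(1)] unfolding that(2) r_def K_def by linarith
  show ?thesis
  proof (cases "r = 0")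
    case False
    define D where "D = \<bar>K\<bar> + C * measure M (punctured x 1) + 1"
    have D: "0 < D" using C(1) by (auto simp: D_def intro!: add_nonneg_pos)
    define \<delta> where "\<delta> = min 1 (2 * \<bar>r\<bar> / D)"
    have "0 < \<delta>" using False D by (simp add: \<delta>_def)
    moreover have "\<delta> \<le> \<bar>y - x\<bar>" if y: "y \<in> S" "y \<noteq> x" "side x y = A" for y
    proof (rule ccontr)
      assume "\<not> \<delta> \<le> \<bar>y - x\<bar>"
      then have less: "\<bar>y - x\<bar> < 1" "\<bar>y - x\<bar> < 2 * \<bar>r\<bar> / D" by (auto simp: \<delta>_def)
      have "(y - x) * r \<le> 0"
      proof (cases "x < y")
        case True
        then have "A = {..x}" using y(3) by (simp add: side_def)
        moreover have "x < l" using True S_D[OF y(1)] by auto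
        ultimately show ?thesis using right_le[OF x(1)] True by (simp only: r_def) (auto intro: mult_nonneg_nonpos)
      next
        case False
        then have "y < x" using y by auto
        then have "A = {..<x}" using y(3) by (auto simp: side_def)
        moreover have "0 < x" using x a_range by auto
        ultimately show ?thesis using left_ge[OF x(1)] \<open>y < x\<close> by (simp only: r_def) (auto intro: mult_nonpos_nonneg)
      qed
      then have "(y - x) * r = - (\<bar>y - x\<bar> * \<bar>r\<bar>)" by (simp flip: abs_mult)
      then have "2 * (\<bar>y - x\<bar> * \<bar>r\<bar>) \<le> (y - x)\<^sup>2 * (K + C * measure M (punctured x 1))"
        using upper[OF y(1) y(3) less(1)] by (simp only: mult.assoc)
      also have "\<dots> \<le> (y - x)\<^sup>2 * D" unfolding D_def by (intro mult_left_mono) auto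
      also have "\<dots> = \<bar>y - x\<bar> * (\<bar>y - x\<bar> * D)"
        unfolding mult.assoc[symmetric] by (simp add: power2_eq_square)
      also have "\<dots> < \<bar>y - x\<bar> * (2 * \<bar>r\<bar>)"
        using less(2) D y(2) by (intro mult_strict_left_mono) (auto simp: field_simps)
      finally show False by simp
    qed
    ultimately show ?thesis using that by blast
  next
    case True
    have xl: "x \<le> l" using x' by simp
    have "r * Im (\<kappa> * (\<phi> x)\<^sup>2) < Im (\<kappa> * \<phi> x * slope A) * g x"
      unfolding r_def using rotation[OF x'(1) A' mass_pos_side[OF x(2) xl A'(2,1)]] .
    then have "Im (\<kappa> * \<phi> x * slope A) \<noteq> 0" using True by auto
    then have K: "K < 0"
      unfolding K_def using square_slope(2)[OF x(1) \<open>0 < c\<close>] True unfolding r_def by blast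
    have "0 < - K / (C + 1)" using K C(1) by (intro divide_pos_pos) auto
    then obtain \<delta> where \<delta>: "0 < \<delta>" "measure M (punctured x \<delta>) < - K / (C + 1)"
      by (rule punctured_small)
    have "C * measure M (punctured x \<delta>) \<le> (C + 1) * measure M (punctured x \<delta>)"
      by (intro mult_right_mono) auto
    also have "\<dots> < - K" using pos_less_divide_eq[THEN iffD1, OF _ \<delta>(2)] C(1) by (simp add: mult.commute)
    finally have neg: "K + C * measure M (punctured x \<delta>) < 0" by simp
    have "\<delta> \<le> \<bar>y - x\<bar>" if y: "y \<in> S" "y \<noteq> x" "side x y = A" for y
    proof (rule ccontr)
      assume "\<not> \<delta> \<le> \<bar>y - x\<bar>"
      then have "0 \<le> (y - x)\<^sup>2 * (K + C * measure M (punctured x \<delta>))"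
        using upper[OF y(1) y(3), of \<delta>] True by simp
      moreover have "(y - x)\<^sup>2 * (K + C * measure M (punctured x \<delta>)) < 0"
        using neg y(2) by (intro mult_pos_neg) auto
      ultimately show False by simp
    qed
    then show ?thesis using that \<delta>(1) by blast
  qed
qed

section \<open>Behaviour of g just behind a\<close>

text \<open>To the right of \<open>a\<close> the solution is \<open>1 - \<nu> D (1 + o(1))\<close>, where \<open>D y\<close> is the following moment.\<close>
definition D :: "real \<Rightarrow> real" where "D y = (LINT s|M. max 0 (y - s))"

definition Z :: "real \<Rightarrow> complex" where "Z y = (LINT s|M. complex_of_real (max 0 (y - s)) * \<phi> s)"

lemma D_integrable: "integrable M (\<lambda>s. max 0 (y - s))"
  by (intro integrable_continuous continuous_intros)

lemma D_nonneg: "0 \<le> D y"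
  unfolding D_def by (intro integral_nonneg_AE) auto

lemma D_pos:
  assumes "a < y" "y \<le> l"
  shows "0 < D y"
proof (rule ccontr)
  assume "\<not> 0 < D y"
  then have "D y = 0" using D_nonneg[of y] by simp
  then have "AE s in M. max 0 (y - s) = 0"
    unfolding D_def by (subst (asm) integral_nonneg_eq_0_iff_AE[OF D_integrable]) auto
  then have "AE s in M. s \<notin> {..<y} \<inter> {0..l}" by eventually_elim auto
  then have "{..<y} \<inter> {0..l} \<in> null_sets M"
    using AE_iff_null_sets[OF in_sets_M[of "{..<y}"]] by simp
  then have "measure M ({..<y} \<inter> {0..l}) = 0" by (rule measure_eq_0_null_sets)
  then show False using mass_pos[OF assms] by simp
qed

lemma D_le: "D y \<le> \<bar>y - a\<bar> * measure M {0..l}"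
proof -
  have "D y \<le> (LINT s|M. \<bar>y - a\<bar>)"
    unfolding D_def
  proof (rule integral_mono_AE)
    show "AE s in M. max 0 (y - s) \<le> \<bar>y - a\<bar>" using AE_a by eventually_elim auto
  qed (auto intro: D_integrable)
  then show ?thesis by (simp add: mult.commute)
qed

lemma phi_Z: "y \<in> {0..l} \<Longrightarrow> \<phi> y = 1 - \<nu> * Z y"
  unfolding Z_def by (rule phi_eq)

text \<open>On the mass below y the solution is close to \<phi> a = 1. The error is measured against
  D y, not y - a, because D y can be arbitrarily small compared with y - a when the mass thins out
  near a.\<close>

lemma Z_approx:
  assumes "0 < e" "a < l"
  obtains \<delta> where "0 < \<delta>" "a + \<delta> \<le> l" "\<And>y. y < a + \<delta> \<Longrightarrow> norm (Z y - complex_of_real (D y)) \<le> e * D y"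
proof -
  obtain d where d: "0 < d" "\<And>s. s \<in> {0..l} \<Longrightarrow> dist s a < d \<Longrightarrow> dist (\<phi> s) (\<phi> a) < e"
    using continuous a_range assms(1) unfolding continuous_on_iff by blast
  define \<delta> where "\<delta> = min d (l - a)"
  have "norm (Z y - complex_of_real (D y)) \<le> e * D y" if y: "y < a + \<delta>" for y
  proof -
    have "Z y - complex_of_real (D y) = (LINT s|M. complex_of_real (max 0 (y - s)) * \<phi> s) - (LINT s|M. complex_of_real (max 0 (y - s)))"
      unfolding Z_def D_def by (simp only: integral_complex_of_real)
    also have "\<dots> = (LINT s|M. complex_of_real (max 0 (y - s)) * \<phi> s - complex_of_real (max 0 (y - s)))"
      by (intro Bochner_Integration.integral_diff[symmetric] integrable_kernel continuous integrable_of_real D_integrable)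
    also have "norm \<dots> \<le> (LINT s|M. norm (complex_of_real (max 0 (y - s)) * \<phi> s - complex_of_real (max 0 (y - s))))"
      by (rule integral_norm_bound)
    also have "\<dots> \<le> (LINT s|M. e * max 0 (y - s))"
    proof (rule integral_mono)
      show "integrable M (\<lambda>s. norm (complex_of_real (max 0 (y - s)) * \<phi> s - complex_of_real (max 0 (y - s))))"
        by (intro integrable_norm Bochner_Integration.integrable_diff integrable_kernel continuous integrable_of_real D_integrable)
      show "integrable M (\<lambda>s. e * max 0 (y - s))" by (intro integrable_mult_right D_integrable)
      fix s assume "s \<in> space M"
      then have s: "s \<in> {0..l}" by simp
      have "norm (complex_of_real (max 0 (y - s)) * \<phi> s - complex_of_real (max 0 (y - s)))
          = norm (complex_of_real (max 0 (y - s)) * (\<phi> s - 1))" by (simp add: algebra_simps)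
      also have "\<dots> = max 0 (y - s) * norm (\<phi> s - 1)" by (simp add: norm_mult)
      also have "\<dots> \<le> max 0 (y - s) * e"
      proof (cases "s < y")
        case True
        have "norm (\<phi> s - 1) \<le> e"
        proof (cases "s \<le> a")
          case True
          then show ?thesis using phi_1[of s] s assms by simp
        next
          case False
          then have "dist s a < d" using True y by (auto simp: dist_real_def \<delta>_def)
          then show ?thesis using d(2)[OF s] phi_1[of a] a_range by (simp add: dist_norm less_imp_le)
        qed
        then show ?thesis by (intro mult_left_mono) auto
      qed simp
      finally show "norm (complex_of_real (max 0 (y - s)) * \<phi> s - complex_of_real (max 0 (y - s))) \<le> e * max 0 (y - s)"
        by (simp add: mult.commute)
    qed
    also have "\<dots> = e * D y" unfolding D_def by (rule integral_mult_right_zero)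
    finally show ?thesis .
  qed
  then show ?thesis using that[of \<delta>] d assms by (auto simp: \<delta>_def)
qed

text \<open>S is closed and carries M, and every right neighbourhood of a has mass.\<close>

lemma a_in_S:
  assumes "a < l"
  shows "a \<in> S"
proof (rule ccontr)
  assume "a \<notin> S"
  then have "open (- S)" "a \<in> - S" using S_closed by auto
  then obtain d where d: "0 < d" "ball a d \<subseteq> - S" by (auto simp: open_contains_ball)
  define y where "y = min l (a + d)"
  have "AE s in M. s \<notin> {..<y} \<inter> {0..l}"
    using AE_S
  proof eventually_elim
    case (elim s)
    then have "s \<notin> ball a d" "a \<le> s" using d S_D by auto
    then show ?case by (auto simp: y_def dist_real_def)
  qed
  then have "{..<y} \<inter> {0..l} \<in> null_sets M"
    using AE_iff_null_sets[OF in_sets_M[of "{..<y}"]] by simp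
  then have "measure M ({..<y} \<inter> {0..l}) = 0" by (rule measure_eq_0_null_sets)
  moreover have "0 < measure M ({..<y} \<inter> {0..l})" using assms d by (intro mass_pos) (auto simp: y_def)
  ultimately show False by simp
qed

lemma c_eq: "a < l \<Longrightarrow> c = Re \<kappa>"
  using S_D(2)[OF a_in_S] phi_1[of a] a_range by (simp add: g_def)

lemma g_Z:
  assumes "a < l" "y \<in> {0..l}"
  shows "g y = c - 2 * Re (\<nu> * \<kappa> * Z y) + Re (\<nu>\<^sup>2 * \<kappa> * (Z y)\<^sup>2)"
proof -
  have "\<kappa> * (\<phi> y)\<^sup>2 = \<kappa> - 2 * (\<nu> * \<kappa> * Z y) + \<nu>\<^sup>2 * \<kappa> * (Z y)\<^sup>2"
    unfolding phi_Z[OF assms(2)] by (simp add: power2_eq_square algebra_simps)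
  from arg_cong[OF this, of Re] show ?thesis
    unfolding g_def c_eq[OF assms(1)] by simp
qed

lemma g_first_order:
  assumes "0 < e" "a < l"
  obtains \<delta> where "0 < \<delta>" "a + \<delta> \<le> l"
    "\<And>y. a < y \<Longrightarrow> y < a + \<delta> \<Longrightarrow> \<bar>g y - c + 2 * (Re (\<nu> * \<kappa>) * D y)\<bar> \<le> e * D y"
proof -
  define N m where "N = norm (\<nu> * \<kappa>) + norm (\<nu>\<^sup>2 * \<kappa>) + 1" and "m = measure M {0..l} + 1"
  have N: "0 < N" "norm (\<nu> * \<kappa>) \<le> N" "norm (\<nu>\<^sup>2 * \<kappa>) \<le> N" by (auto simp: N_def intro!: add_nonneg_pos)
  have m: "0 < m" "measure M {0..l} \<le> m" by (auto simp: m_def intro!: add_nonneg_pos)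
  \<comment> \<open>Half of e pays for replacing Z y by D y, the other half for the quadratic term,
    which is of order D y times y - a.\<close>
  define \<epsilon> where "\<epsilon> = min 1 (e / (4 * N))"
  have eps: "0 < \<epsilon>" "\<epsilon> \<le> 1" "2 * N * \<epsilon> \<le> e / 2"
    using assms N by (auto simp: \<epsilon>_def min_def field_simps)
  obtain \<delta>1 where \<delta>1: "0 < \<delta>1" "a + \<delta>1 \<le> l" "\<And>y. y < a + \<delta>1 \<Longrightarrow> norm (Z y - complex_of_real (D y)) \<le> \<epsilon> * D y"
    using Z_approx[OF eps(1) assms(2)] by blast
  define \<delta> where "\<delta> = min \<delta>1 (e / (8 * N * m))"
  have "\<bar>g y - c + 2 * (Re (\<nu> * \<kappa>) * D y)\<bar> \<le> e * D y" if y: "a < y" "y < a + \<delta>" for y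
  proof -
    define E where "E = Z y - complex_of_real (D y)"
    have E: "norm E \<le> \<epsilon> * D y" unfolding E_def using y by (intro \<delta>1(3)) (auto simp: \<delta>_def)
    have "D y \<le> \<bar>y - a\<bar> * m" using D_le[of y] m mult_left_mono[OF m(2), of "\<bar>y - a\<bar>"] by linarith
    also have "\<dots> \<le> e / (8 * N * m) * m" using y m by (intro mult_right_mono) (auto simp: \<delta>_def)
    finally have Dle: "4 * N * D y \<le> e / 2" using m N by (simp add: field_simps)
    have "norm (Z y) \<le> norm E + norm (complex_of_real (D y))"
      using norm_triangle_ineq[of E "complex_of_real (D y)"] by (simp add: E_def)
    also have "\<dots> \<le> \<epsilon> * D y + D y" using E D_nonneg[of y] by simp
    also have "\<dots> \<le> 2 * D y" using mult_right_mono[OF eps(2) D_nonneg[of y]] by simp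
    finally have Z: "norm (Z y) \<le> 2 * D y" .
    have yl: "y \<in> {0..l}" using y a_range \<delta>1 by (auto simp: \<delta>_def)
    have lin: "g y - c + 2 * X = V - 2 * W" if "g y = c - 2 * U + V" "U = X + W" for U V W X
      using that by simp
    have "Re (\<nu> * \<kappa> * Z y) = Re (\<nu> * \<kappa>) * D y + Re (\<nu> * \<kappa> * E)"
    proof -
      have "\<nu> * \<kappa> * Z y = \<nu> * \<kappa> * complex_of_real (D y) + \<nu> * \<kappa> * E" by (simp add: E_def algebra_simps)
      moreover have "Re (w * complex_of_real r) = Re w * r" for w r by simp
      ultimately show ?thesis by (simp only: plus_complex.simps)
    qed
    from lin[OF g_Z[OF assms(2) yl] this] have "\<bar>g y - c + 2 * (Re (\<nu> * \<kappa>) * D y)\<bar> \<le> norm (\<nu>\<^sup>2 * \<kappa> * (Z y)\<^sup>2) + 2 * norm (\<nu> * \<kappa> * E)"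
      using abs_Re_le_cmod[of "\<nu>\<^sup>2 * \<kappa> * (Z y)\<^sup>2"] abs_Re_le_cmod[of "\<nu> * \<kappa> * E"] by linarith
    also have "\<dots> = norm (\<nu>\<^sup>2 * \<kappa>) * (norm (Z y) * norm (Z y)) + 2 * (norm (\<nu> * \<kappa>) * norm E)"
      by (simp add: norm_mult norm_power power2_eq_square)
    also have "\<dots> \<le> N * ((2 * D y) * (2 * D y)) + 2 * (N * (\<epsilon> * D y))"
      using N Z E D_nonneg[of y] by (intro add_mono mult_mono mult_left_mono) auto
    also have "\<dots> = (4 * N * D y) * D y + (2 * N * \<epsilon>) * D y" by simp
    also have "\<dots> \<le> (e / 2) * D y + (e / 2) * D y"
      using Dle eps D_nonneg[of y] by (intro add_mono mult_right_mono) auto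
    finally show ?thesis by simp
  qed
  moreover have "0 < \<delta>" using \<delta>1 assms N m by (simp add: \<delta>_def)
  moreover have "a + \<delta> \<le> l" using \<delta>1 by (simp add: \<delta>_def)
  ultimately show ?thesis using that by blast
qed

text \<open>Otherwise \<open>g_first_order\<close> would push g above c just behind a.\<close>

lemma start_sign:
  assumes "a < l"
  shows "0 \<le> Re (\<nu> * \<kappa>)"
proof (rule ccontr)
  assume "\<not> ?thesis"
  then have neg: "0 < - Re (\<nu> * \<kappa>)" by simp
  obtain \<delta> where \<delta>: "0 < \<delta>" "a + \<delta> \<le> l"
    "\<And>y. a < y \<Longrightarrow> y < a + \<delta> \<Longrightarrow> \<bar>g y - c + 2 * (Re (\<nu> * \<kappa>) * D y)\<bar> \<le> - Re (\<nu> * \<kappa>) * D y"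
    using g_first_order[OF neg assms] by blast
  define y where "y = a + \<delta> / 2"
  have y: "a < y" "y < a + \<delta>" "y \<le> l" using \<delta> by (auto simp: y_def)
  have "0 < - Re (\<nu> * \<kappa>) * D y" using neg D_pos[of y] y by (intro mult_pos_pos) auto
  moreover have "g y \<le> c" using y a_range by (intro g_le) auto
  ultimately show False using \<delta>(3)[OF y(1,2)] by linarith
qed

text \<open>This replaces \<open>isolated_one_sided\<close> at x = a. If Re (\<nu> \<kappa>) > 0,
  then g falls like - 2 Re (\<nu> \<kappa>) D y. If it is 0, then \<nu> \<kappa> is purely imaginary
  and c = Re \<kappa> > 0 forces P > 0, so the quadratic term decides.\<close>

lemma right_isolated_start:
  assumes "a < l" "0 < c"
  obtains \<delta> where "0 < \<delta>" "\<And>y. a < y \<Longrightarrow> y < a + \<delta> \<Longrightarrow> g y < c"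
proof (cases "Re (\<nu> * \<kappa>) = 0")
  case False
  then have pos: "0 < Re (\<nu> * \<kappa>)" using start_sign assms by simp
  obtain \<delta> where \<delta>: "0 < \<delta>" "a + \<delta> \<le> l"
    "\<And>y. a < y \<Longrightarrow> y < a + \<delta> \<Longrightarrow> \<bar>g y - c + 2 * (Re (\<nu> * \<kappa>) * D y)\<bar> \<le> Re (\<nu> * \<kappa>) * D y"
    using g_first_order[OF pos assms(1)] by blast
  have "g y < c" if y: "a < y" "y < a + \<delta>" for y
  proof -
    have "0 < Re (\<nu> * \<kappa>) * D y" using pos D_pos[of y] y \<delta> by (intro mult_pos_pos) auto
    then show ?thesis using \<delta>(3)[OF y] by linarith
  qed
  then show ?thesis using that \<delta> by blast
next
  case True
  define P where "P = - Re (\<nu>\<^sup>2 * \<kappa>)"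
  have P: "0 < P"
  proof -
    define \<tau> where "\<tau> = Im (\<nu> * \<kappa>)"
    have nk: "\<nu> * \<kappa> = \<i> * complex_of_real \<tau>" using True by (simp add: complex_eq_iff \<tau>_def)
    have "Re \<kappa> * (norm \<nu>)\<^sup>2 = Re (\<kappa> * complex_of_real ((norm \<nu>)\<^sup>2))" by simp
    also have "\<kappa> * complex_of_real ((norm \<nu>)\<^sup>2) = (\<nu> * \<kappa>) * cnj \<nu>" unfolding complex_norm_square by simp
    also have "Re \<dots> = \<tau> * Im \<nu>" unfolding nk by simp
    finally have "\<tau> * Im \<nu> = c * (norm \<nu>)\<^sup>2" using c_eq assms by simp
    moreover have "\<nu>\<^sup>2 * \<kappa> = \<nu> * (\<nu> * \<kappa>)" by (simp add: power2_eq_square)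
    then have "P = \<tau> * Im \<nu>" unfolding P_def nk by simp
    moreover have "0 < c * (norm \<nu>)\<^sup>2" using Im_nu assms by (intro mult_pos_pos) auto
    ultimately show ?thesis by simp
  qed
  define N where "N = norm (\<nu>\<^sup>2 * \<kappa>)"
  have N: "P \<le> N" unfolding N_def P_def using abs_Re_le_cmod[of "\<nu>\<^sup>2 * \<kappa>"] by linarith
  \<comment> \<open>The product E (2 D y + E) will be at most 3 \<epsilon> (D y)^2 in norm, and 3 N
    \<epsilon> < P.\<close>
  define \<epsilon> where "\<epsilon> = P / (4 * N)"
  have eps: "0 < \<epsilon>" "\<epsilon> \<le> 1" "4 * N * \<epsilon> = P" using P N by (auto simp: \<epsilon>_def field_simps)
  obtain \<delta> where \<delta>: "0 < \<delta>" "a + \<delta> \<le> l" "\<And>y. y < a + \<delta> \<Longrightarrow> norm (Z y - complex_of_real (D y)) \<le> \<epsilon> * D y"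
    using Z_approx[OF eps(1) assms(1)] by blast
  have "g y < c" if y: "a < y" "y < a + \<delta>" for y
  proof -
    have yl: "y \<in> {0..l}" using y \<delta> a_range by auto
    \<comment> \<open>An error o(D y) in the linear term could swamp (D y)^2, so its exact sign is
      needed. It holds pointwise under the integral: Re (\<nu> \<kappa> \<phi> s) equals P D s up to
      a fraction of that quantity.\<close>
    have "0 \<le> Re (\<nu> * \<kappa> * Z y)"
    proof -
      have "\<nu> * \<kappa> * Z y = (LINT s|M. \<nu> * \<kappa> * (complex_of_real (max 0 (y - s)) * \<phi> s))"
        unfolding Z_def by (rule integral_mult_right_zero[symmetric])
      then have "Re (\<nu> * \<kappa> * Z y) = (LINT s|M. Re (\<nu> * \<kappa> * (complex_of_real (max 0 (y - s)) * \<phi> s)))"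
        by (simp only: integral_Re[OF integrable_mult_right[OF integrable_kernel[OF continuous]]])
      also have "\<dots> \<ge> 0"
      proof (rule integral_nonneg_AE, rule AE_I2)
        fix s assume "s \<in> space M"
        then have s: "s \<in> {0..l}" by simp
        have eq: "Re (\<nu> * \<kappa> * (complex_of_real (max 0 (y - s)) * \<phi> s)) = max 0 (y - s) * Re (\<nu> * \<kappa> * \<phi> s)"
        proof -
          have "Re (w * (complex_of_real r * z)) = r * Re (w * z)" for w z r by (simp add: algebra_simps)
          then show ?thesis .
        qed
        show "0 \<le> Re (\<nu> * \<kappa> * (complex_of_real (max 0 (y - s)) * \<phi> s))"
        proof (cases "s < y")
          case True
          define E where "E = Z s - complex_of_real (D s)"
          have E: "norm E \<le> \<epsilon> * D s" unfolding E_def using True y by (intro \<delta>) auto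
          have "\<nu> * \<kappa> * \<phi> s = \<nu> * \<kappa> - \<nu>\<^sup>2 * \<kappa> * complex_of_real (D s) - \<nu>\<^sup>2 * \<kappa> * E"
            unfolding phi_Z[OF s] E_def by (simp add: algebra_simps power2_eq_square)
          from arg_cong[OF this, of Re] have "Re (\<nu> * \<kappa> * \<phi> s) = Re (\<nu> * \<kappa>) - Re (\<nu>\<^sup>2 * \<kappa> * complex_of_real (D s)) - Re (\<nu>\<^sup>2 * \<kappa> * E)"
            by (simp only: minus_complex.simps)
          also have "Re (\<nu>\<^sup>2 * \<kappa> * complex_of_real (D s)) = - P * D s" unfolding P_def by simp
          finally have "Re (\<nu> * \<kappa> * \<phi> s) = P * D s - Re (\<nu>\<^sup>2 * \<kappa> * E)" using \<open>Re (\<nu> * \<kappa>) = 0\<close> by linarith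
          moreover have "Re (\<nu>\<^sup>2 * \<kappa> * E) \<le> P * D s"
          proof -
            have "Re (\<nu>\<^sup>2 * \<kappa> * E) \<le> N * norm E"
              unfolding N_def norm_mult[symmetric] by (rule complex_Re_le_cmod)
            also have "\<dots> \<le> N * (\<epsilon> * D s)" using E N P by (intro mult_left_mono) auto
            also have "\<dots> = (N * \<epsilon>) * D s" by simp
            also have "\<dots> \<le> P * D s" using eps P D_nonneg[of s] by (intro mult_right_mono) auto
            finally show ?thesis .
          qed
          ultimately show ?thesis unfolding eq by (intro mult_nonneg_nonneg) auto
        qed simp
      qed
      finally show ?thesis .
    qed
    moreover have "Re (\<nu>\<^sup>2 * \<kappa> * (Z y)\<^sup>2) < 0"
    proof -
      have D: "0 < D y" using D_pos[of y] y yl by auto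
      define E where "E = Z y - complex_of_real (D y)"
      have E: "norm E \<le> \<epsilon> * D y" unfolding E_def using y by (intro \<delta>) auto
      have E2: "norm E \<le> D y" using E mult_right_mono[OF eps(2), of "D y"] D by linarith
      have "\<nu>\<^sup>2 * \<kappa> * (Z y)\<^sup>2 = \<nu>\<^sup>2 * \<kappa> * complex_of_real (D y * D y) + \<nu>\<^sup>2 * \<kappa> * (E * (2 * complex_of_real (D y) + E))"
        unfolding E_def by (simp add: algebra_simps power2_eq_square)
      from arg_cong[OF this, of Re] have "Re (\<nu>\<^sup>2 * \<kappa> * (Z y)\<^sup>2) = Re (\<nu>\<^sup>2 * \<kappa> * complex_of_real (D y * D y)) + Re (\<nu>\<^sup>2 * \<kappa> * (E * (2 * complex_of_real (D y) + E)))"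
        by (simp only: plus_complex.simps)
      also have "Re (\<nu>\<^sup>2 * \<kappa> * complex_of_real (D y * D y)) = - (P * (D y * D y))"
      proof -
        have "Re (w * complex_of_real r) = Re w * r" for w r by simp
        then show ?thesis unfolding P_def by (simp only: mult_minus_left minus_minus)
      qed
      finally have *: "Re (\<nu>\<^sup>2 * \<kappa> * (Z y)\<^sup>2) = - (P * (D y * D y)) + Re (\<nu>\<^sup>2 * \<kappa> * (E * (2 * complex_of_real (D y) + E)))" .
      have "Re (\<nu>\<^sup>2 * \<kappa> * (E * (2 * complex_of_real (D y) + E))) \<le> N * (norm E * norm (2 * complex_of_real (D y) + E))"
        unfolding N_def norm_mult[symmetric] by (rule complex_Re_le_cmod)
      also have "\<dots> \<le> N * ((\<epsilon> * D y) * (3 * D y))"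
      proof -
        have "norm (2 * complex_of_real (D y) + E) \<le> norm (2 * complex_of_real (D y)) + norm E" by (rule norm_triangle_ineq)
        also have "\<dots> \<le> 3 * D y" using E2 D by (simp add: norm_mult)
        finally show ?thesis using E D eps N P by (intro mult_left_mono mult_mono) auto
      qed
      also have "\<dots> = (3 * N * \<epsilon>) * (D y * D y)" by simp
      also have "\<dots> < P * (D y * D y)" using eps(3) P D by (intro mult_strict_right_mono) auto
      finally show ?thesis using * by linarith
    qed
    ultimately show ?thesis using g_Z[OF assms(1) yl] by linarith
  qed
  then show ?thesis using that \<delta> by blast
qed

section \<open>Sign of the contribution of the masses to the second derivative of g\<close>

definition w :: "real \<Rightarrow> real" where "w x = Re (\<nu> * \<kappa> * (\<phi> x)\<^sup>2)"

text \<open>The points of S that violate the sign condition of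
  \<open>quadratic_upper_bound\<close>.\<close>

definition Q :: "real set" where "Q = {x \<in> S. x < l \<and> w x < 0}"

lemma w_continuous: "continuous_on {0..l} w"
  unfolding w_def by (intro continuous_intros continuous)

text \<open>An atom at such a point would raise the derivative of g by - 2 w x times its mass, while
  at a maximum the right derivative cannot exceed the left one. Hence there is no atom and the
  derivative is 0. The point a is excluded by \<open>start_sign\<close>.\<close>

lemma Q_D:
  assumes "x \<in> Q"
  shows "x \<in> S" "x < l" "a < x" "w x < 0"
    and "Re (\<kappa> * \<phi> x * slope {..<x}) = 0" "slope {..x} = slope {..<x}"
proof -
  show x: "x \<in> S" "x < l" "w x < 0" using assms by (auto simp: Q_def)
  note x' = S_D[OF x(1)]
  have "a < l" using x x' by linarith
  then have "0 \<le> w a" using start_sign phi_1[of a] a_range by (simp add: w_def)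
  then have "x \<noteq> a" using x by auto
  then show ax: "a < x" using x' by simp
  then have "0 < x" using a_range by simp
  have "Re (\<kappa> * \<phi> x * slope {..x}) = Re (\<kappa> * \<phi> x * slope {..<x}) - w x * measure M {x}"
  proof -
    have "\<kappa> * \<phi> x * slope {..x} = \<kappa> * \<phi> x * slope {..<x} - \<nu> * \<kappa> * (\<phi> x)\<^sup>2 * complex_of_real (measure M {x})"
      unfolding slope_jump[OF x'(1)] by (simp add: power2_eq_square algebra_simps)
    moreover have "Re (v * complex_of_real r) = Re v * r" for v r by simp
    ultimately show ?thesis unfolding w_def by (simp only: minus_complex.simps)
  qed
  moreover have "w x * measure M {x} \<le> 0" using x by (intro mult_nonpos_nonneg) auto
  ultimately have "Re (\<kappa> * \<phi> x * slope {..<x}) = 0 \<and> w x * measure M {x} = 0"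
    using left_ge[OF x(1) \<open>0 < x\<close>] right_le[OF x(1,2)] by linarith
  then show "Re (\<kappa> * \<phi> x * slope {..<x}) = 0" "slope {..x} = slope {..<x}"
    using x slope_jump[OF x'(1)] by auto
qed

lemma rotation_S:
  assumes "x \<in> S" "a < x" "Re (\<kappa> * \<phi> x * slope {..<x}) = 0" "0 < c"
  shows "0 < Im (\<kappa> * \<phi> x * slope {..<x})"
proof -
  note x = S_D[OF assms(1)]
  have xl: "x \<le> l" using x by simp
  have sub: "{..<x} \<subseteq> {..x}" by auto
  have "Re (\<kappa> * \<phi> x * slope {..<x}) * Im (\<kappa> * (\<phi> x)\<^sup>2) < Im (\<kappa> * \<phi> x * slope {..<x}) * g x"
    by (rule rotation[OF x(1) _ _ sub mass_pos_side[OF assms(2) xl]]) auto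
  then show ?thesis using assms(4) unfolding assms(3) x(2) by (simp only: mult_zero_left zero_less_mult_iff) linarith
qed

text \<open>In a gap of S there is no mass and \<phi> is affine. With z the last point of S before
  the gap and q the slope at x, this gives g z = c + (z - x)^2 Re (\<kappa> q^2), which is below c
  although z is in S.\<close>

lemma no_left_gap:
  assumes "x \<in> Q" "0 < c" "0 < e"
  obtains s where "s \<in> S" "x - e < s" "s < x"
proof (rule ccontr)
  assume "\<not> thesis"
  then have none: "\<not> (s \<in> S \<and> x - e < s \<and> s < x)" for s using that by blast
  note x = Q_D[OF assms(1)]
  note x' = S_D[OF x(1)]
  define F where "F = S \<inter> {..x - e}"
  have "a \<in> F" using none[of a] a_in_S x by (auto simp: F_def)
  have "closed F" unfolding F_def by (intro closed_Int S_closed) auto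
  moreover have bdd: "bdd_above F" by (rule bdd_aboveI[of _ l]) (auto simp: F_def S_def)
  ultimately have zF: "Sup F \<in> F" using \<open>a \<in> F\<close> by (intro closed_contains_Sup) auto
  define z where "z = Sup F"
  have z: "z \<in> S" "z \<le> x - e" using zF by (auto simp: z_def F_def)
  note z' = S_D[OF z(1)]
  have zx: "z < x" using z assms by simp
  have gap: "s \<le> z \<or> x \<le> s" if "s \<in> S" for s
    using none[of s] that cSup_upper[OF _ bdd, of s] by (auto simp: z_def F_def not_less)
  have "(LINT s|M. kern x z s *\<^sub>R \<phi> s) = 0"
  proof (rule integral_eq_zero_AE)
    show "AE s in M. kern x z s *\<^sub>R \<phi> s = 0"
      using AE_S
    proof eventually_elim
      case (elim s)
      then have "kern x z s = 0"
        using gap[OF elim] zx by (auto simp: kern_def side_def indicator_def max_def)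
      then show ?case by simp
    qed
  qed
  moreover have "side x z = {..<x}" using zx by (simp add: side_def)
  ultimately have pz: "\<phi> z = \<phi> x + (z - x) *\<^sub>R slope {..<x}"
    using expansion[OF x'(1) z'(1)] by simp
  have "\<kappa> * (\<phi> z)\<^sup>2 = \<kappa> * (\<phi> x)\<^sup>2 + (2 * (z - x)) *\<^sub>R (\<kappa> * \<phi> x * slope {..<x}) + (z - x)\<^sup>2 *\<^sub>R (\<kappa> * (slope {..<x})\<^sup>2)"
    unfolding pz by (simp add: scaleR_conv_of_real power2_eq_square algebra_simps)
  from arg_cong[OF this, of Re] have "g z = g x + (2 * (z - x)) * Re (\<kappa> * \<phi> x * slope {..<x}) + (z - x)\<^sup>2 * Re (\<kappa> * (slope {..<x})\<^sup>2)"
    unfolding g_def by (simp only: plus_complex.simps scaleR_complex.simps)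
  then have "(z - x)\<^sup>2 * Re (\<kappa> * (slope {..<x})\<^sup>2) = 0"
    unfolding z'(2) x'(2) x(5) by simp
  moreover have "Re (\<kappa> * (slope {..<x})\<^sup>2) < 0"
    using square_slope(2)[OF x(1) assms(2) x(5)] rotation_S[OF x(1,3,5) assms(2)] by linarith
  ultimately show False using zx by (simp only: mult_eq_0_iff) auto
qed

text \<open>Without an atom the derivative is two-sided. It equals 2 Re (\<nu> v) = - 2 Im \<nu> Im
  v for the purely imaginary v = \<kappa> \<phi> \<phi>', and rotation makes Im v > 0.\<close>

lemma w_increasing:
  assumes "x \<in> Q" "0 < c"
  shows "\<exists>d. DERIV w x :> d \<and> 0 \<le> d"
proof -
  note x = Q_D[OF assms(1)]
  note x' = S_D[OF x(1)]
  define q where "q = slope {..<x}"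
  have "(\<phi> has_vector_derivative q) (at x within {0..l})"
    by (rule has_derivative_one_sided) (use x x' in \<open>auto simp: side_def q_def\<close>)
  moreover have "at x within {0..l} = at x"
    by (rule at_within_interior) (use x a_range in \<open>auto simp: interior_atLeastAtMost_real\<close>)
  ultimately have d: "(\<phi> has_vector_derivative q) (at x)" by simp
  have "((\<lambda>x. (\<nu> * \<kappa>) * (\<phi> x * \<phi> x)) has_vector_derivative (\<nu> * \<kappa>) * (\<phi> x * q + q * \<phi> x)) (at x)"
    by (intro has_vector_derivative_mult_right has_vector_derivative_mult d)
  from bounded_linear.has_vector_derivative[OF bounded_linear_Re this]
  have "DERIV w x :> Re ((\<nu> * \<kappa>) * (\<phi> x * q + q * \<phi> x))"
    unfolding has_real_derivative_iff_has_vector_derivative w_def power2_eq_square .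
  moreover have "Re ((\<nu> * \<kappa>) * (\<phi> x * q + q * \<phi> x)) = - 2 * Im \<nu> * Im (\<kappa> * \<phi> x * q)"
  proof -
    have "(\<nu> * \<kappa>) * (\<phi> x * q + q * \<phi> x) = 2 * (\<nu> * (\<kappa> * \<phi> x * q))" by (simp add: algebra_simps)
    moreover have "Re (2 * (v * u)) = - 2 * Im v * Im u" if "Re u = 0" for u v using that by simp
    ultimately show ?thesis using x(5) unfolding q_def by (simp only:)
  qed
  moreover have "0 \<le> - 2 * Im \<nu> * Im (\<kappa> * \<phi> x * q)"
    using rotation_S[OF x(1,3,5) assms(2)] Im_nu unfolding q_def by (intro mult_nonneg_nonneg[of "- 2 * Im \<nu>"]) linarith+
  ultimately show ?thesis by auto
qed

text \<open>
  A point of \<open>Q\<close> would be the right end of an interval contained in \<open>Q\<close>, which extends to the left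
  until it reaches \<open>a\<close>, as \<open>w\<close> increases along it; but \<open>a\<close> is not in \<open>Q\<close>.
\<close>
lemma Q_empty:
  assumes "0 < c"
  shows "Q = {}"
proof (rule ccontr)
  assume "Q \<noteq> {}"
  then obtain x where xQ: "x \<in> Q" by blast
  note x = Q_D[OF xQ]
  define Y where "Y = {z \<in> {a..x}. {z..x} \<subseteq> Q}"
  have "x \<in> Y" using xQ x by (auto simp: Y_def)
  have bdd: "bdd_below Y" by (rule bdd_belowI[of _ a]) (auto simp: Y_def)
  define y where "y = Inf Y"
  have yx: "y \<le> x" unfolding y_def by (rule cInf_lower[OF \<open>x \<in> Y\<close> bdd])
  have ay: "a \<le> y" unfolding y_def by (rule cInf_greatest) (use \<open>x \<in> Y\<close> in \<open>auto simp: Y_def\<close>)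
  have sub: "{y<..x} \<subseteq> Q"
  proof
    fix s assume s: "s \<in> {y<..x}"
    then obtain z where "z \<in> Y" "z < s" using cInf_less_iff[OF _ bdd] \<open>x \<in> Y\<close> unfolding y_def by auto
    then show "s \<in> Q" using s by (auto simp: Y_def)
  qed
  have "y \<in> S"
  proof (cases "y = x")
    case False
    then have "y \<in> closure {y<..x}" using yx by simp
    also have "\<dots> \<subseteq> S" using sub Q_D(1) by (intro closure_minimal S_closed) auto
    finally show ?thesis .
  qed (use x in simp)
  note y' = S_D[OF this]
  have "w y \<le> w x"
  proof (rule DERIV_nonneg_imp_increasing_open[OF yx])
    show "\<exists>d. DERIV w s :> d \<and> 0 \<le> d" if "y < s" "s < x" for s
      using that sub by (intro w_increasing assms) auto
    show "continuous_on {y..x} w"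
      using y' x by (intro continuous_on_subset[OF w_continuous]) auto
  qed
  \<comment> \<open>The monotonicity of w carries the strict inequality w x < 0 to the limit point
    y, which closedness of S alone would not.\<close>
  then have yQ: "y \<in> Q" using \<open>y \<in> S\<close> x yx by (auto simp: Q_def)
  note y = Q_D[OF yQ]
  obtain d where d: "0 < d" "\<And>s. s \<in> {0..l} \<Longrightarrow> dist s y < d \<Longrightarrow> dist (w s) (w y) < - w y"
    using w_continuous y'(1) y(4) unfolding continuous_on_iff by (metis neg_0_less_iff_less)
  have w_neg: "w s < 0" if "s \<in> {0..l}" "\<bar>s - y\<bar> < d" for s
    using d(2)[OF that(1)] that(2) by (simp add: dist_real_def abs_less_iff)
  \<comment> \<open>By continuity w < 0 a little to the left of y. If a point r there were not in S,
    the first point f of S to its right would lie in Q and have a gap on its left, against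
    \<open>no_left_gap\<close>.\<close>
  have S_left: "r \<in> S" if r: "a \<le> r" "y - d < r" "r \<le> y" for r
  proof (rule ccontr)
    assume rS: "r \<notin> S"
    define F where "F = S \<inter> {r..y}"
    have "y \<in> F" using \<open>y \<in> S\<close> r by (simp add: F_def)
    have bF: "bdd_below F" by (rule bdd_belowI[of _ r]) (auto simp: F_def)
    have "closed F" unfolding F_def by (intro closed_Int S_closed) auto
    then have fF: "Inf F \<in> F" using \<open>y \<in> F\<close> bF by (intro closed_contains_Inf) auto
    define f where "f = Inf F"
    have f: "f \<in> S" "r \<le> f" "f \<le> y" using fF by (auto simp: f_def F_def)
    then have rf: "r < f" using rS by (cases "r = f") auto
    have "f \<in> Q" using f S_D(1)[OF f(1)] w_neg[of f] r y by (auto simp: Q_def)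
    then obtain s where s: "s \<in> S" "f - (f - r) < s" "s < f"
      using no_left_gap[of f "f - r"] assms rf by auto
    then have "s \<in> F" using f by (auto simp: F_def)
    then show False using cInf_lower[OF _ bF, of s] s by (simp add: f_def)
  qed
  define r where "r = max a (y - d / 2)"
  have r: "a \<le> r" "y - d < r" "r < y" using d y by (auto simp: r_def)
  have "r \<in> Y"
    unfolding Y_def
  proof (safe)
    show "r \<in> {a..x}" using r yx by auto
    fix s assume s: "s \<in> {r..x}"
    show "s \<in> Q"
    proof (cases "y < s")
      case False
      then have "s \<in> S" using s r by (intro S_left) auto
      moreover have "w s < 0" using False s r S_D(1)[OF \<open>s \<in> S\<close>] by (intro w_neg) auto
      ultimately show ?thesis using False y by (auto simp: Q_def)
    qed (use sub s in auto)
  qed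
  then have "y \<le> r" unfolding y_def by (rule cInf_lower[OF _ bdd])
  then show False using r by simp
qed

lemma finite_S: "finite S"
proof (cases "c = 0")
  case True
  then show ?thesis using finite_if_c_zero by (intro finite_subset[of S "{a, l}"]) auto
next
  case False
  then have c: "0 < c" using c_nonneg by simp
  have sign: "AE s in M. s < l \<longrightarrow> 0 \<le> Re (\<nu> * \<kappa> * (\<phi> s)\<^sup>2)"
    using AE_S
  proof eventually_elim
    case (elim s)
    then show ?case using Q_empty[OF c] unfolding Q_def w_def by (auto simp only: not_less mem_Collect_eq)
  qed
  show ?thesis
  proof (rule ccontr)
    assume "infinite S"
    moreover have "bounded S" by (rule bounded_subset[of "{a..l}"]) (auto simp: S_def)
    then have "compact S" using S_closed by (simp add: compact_eq_bounded_closed)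
    ultimately obtain x where x: "x \<in> S" "x islimpt S"
      using compact_eq_Bolzano_Weierstrass by blast
    have limpt: "\<exists>y\<in>S. y \<noteq> x \<and> \<bar>y - x\<bar> < d" if "0 < d" for d
      using x(2) that by (auto simp: islimpt_approachable dist_real_def)
    show False
    proof (cases "x = a")
      case True
      obtain y0 where "y0 \<in> S" "y0 \<noteq> x" using limpt[of 1] by auto
      then have "a < l" using S_D[of y0] True by auto
      obtain \<delta> where \<delta>: "0 < \<delta>" "\<And>y. a < y \<Longrightarrow> y < a + \<delta> \<Longrightarrow> g y < c"
        using right_isolated_start[OF \<open>a < l\<close> c] by blast
      obtain y where "y \<in> S" "y \<noteq> a" "\<bar>y - a\<bar> < \<delta>" using limpt[OF \<delta>(1)] True by blast
      then show False using \<delta>(2)[of y] S_D[of y] by auto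
    next
      case False
      then have ax: "a < x" using S_D[OF x(1)] by simp
      obtain \<delta>1 where \<delta>1: "0 < \<delta>1" "\<And>y. y \<in> S \<Longrightarrow> y \<noteq> x \<Longrightarrow> side x y = {..<x} \<Longrightarrow> \<delta>1 \<le> \<bar>y - x\<bar>"
        using isolated_one_sided[OF sign c x(1) ax, of "{..<x}"] by blast
      obtain \<delta>2 where \<delta>2: "0 < \<delta>2" "\<And>y. y \<in> S \<Longrightarrow> y \<noteq> x \<Longrightarrow> side x y = {..x} \<Longrightarrow> \<delta>2 \<le> \<bar>y - x\<bar>"
        using isolated_one_sided[OF sign c x(1) ax, of "{..x}"] by blast
      obtain y where "y \<in> S" "y \<noteq> x" "\<bar>y - x\<bar> < min \<delta>1 \<delta>2" using limpt[of "min \<delta>1 \<delta>2"] \<delta>1 \<delta>2 by auto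
      moreover have "side x y = {..<x} \<or> side x y = {..x}" by (simp add: side_def)
      ultimately show False using \<delta>1(2)[of y] \<delta>2(2)[of y] by auto
    qed
  qed
qed

end

context string_solution
begin

lemma finite_support_lower:
  assumes "Im \<nu> < 0" "\<kappa> \<noteq> 0" "0 \<le> c"
    and "\<And>x. x \<in> {0..l} \<Longrightarrow> Re (\<kappa> * (\<phi> x)\<^sup>2) \<le> c"
    and "AE s in M. Re (\<kappa> * (\<phi> s)\<^sup>2) = c"
  shows "\<exists>X. finite X \<and> X \<subseteq> {0..l} \<and> (AE s in M. s \<in> X)"
proof -
  obtain a where a: "a \<in> {0..l}" "AE s in M. a \<le> s"
    "\<And>y. a < y \<Longrightarrow> y \<le> l \<Longrightarrow> 0 < measure M ({..<y} \<inter> {0..l})"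
    using start_of_support by blast
  interpret extremal_solution l M \<nu> \<phi> \<kappa> c a
    by unfold_locales (use assms a in auto)
  show ?thesis using finite_S AE_S S_D(1) by blast
qed

text \<open>Conjugating \<kappa>, \<nu> and \<phi> preserves Re (\<kappa> \<phi>^2) and reverses the
  sign of Im \<nu>.\<close>

lemma finite_support:
  assumes "Im \<nu> \<noteq> 0" "\<kappa> \<noteq> 0" "0 \<le> c"
    and "\<And>x. x \<in> {0..l} \<Longrightarrow> Re (\<kappa> * (\<phi> x)\<^sup>2) \<le> c"
    and "AE s in M. Re (\<kappa> * (\<phi> s)\<^sup>2) = c"
  shows "\<exists>X. finite X \<and> X \<subseteq> {0..l} \<and> (AE s in M. s \<in> X)"
proof (cases "Im \<nu> < 0")
  case True
  then show ?thesis using assms by (intro finite_support_lower)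
next
  case False
  interpret conj: string_solution l M "cnj \<nu>" "\<lambda>x. cnj (\<phi> x)"
    by unfold_locales (rule volterra_cnj)
  have eq: "Re (cnj \<kappa> * (cnj (\<phi> x))\<^sup>2) = Re (\<kappa> * (\<phi> x)\<^sup>2)" for x
    by (metis complex_cnj_mult complex_cnj_power complex_cnj(1) cnj.simps(1))
  show ?thesis
    by (rule conj.finite_support_lower[of "cnj \<kappa>" c]) (use False assms in \<open>auto simp only: eq cnj.simps complex_cnj_zero_iff\<close>)
qed

end

section \<open>Mixtures of strings\<close>

definition mix :: "real \<Rightarrow> real \<Rightarrow> 'a measure \<Rightarrow> 'a measure \<Rightarrow> 'a measure" where
  "mix p q M N = measure_of (space M) (sets M) (\<lambda>A. ennreal p * emeasure M A + ennreal q * emeasure N A)"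

lemma sets_mix [simp]: "sets (mix p q M N) = sets M"
  by (simp add: mix_def)

lemma space_mix [simp]: "space (mix p q M N) = space M"
  by (rule sets_eq_imp_space_eq) simp

lemma emeasure_mix:
  assumes "sets N = sets M" "A \<in> sets M"
  shows "emeasure (mix p q M N) A = ennreal p * emeasure M A + ennreal q * emeasure N A"
  unfolding mix_def
proof (rule emeasure_measure_of_sigma)
  show "sigma_algebra (space M) (sets M)" ..
  show "positive (sets M) (\<lambda>A. ennreal p * emeasure M A + ennreal q * emeasure N A)"
    by (simp add: positive_def)
  show "countably_additive (sets M) (\<lambda>A. ennreal p * emeasure M A + ennreal q * emeasure N A)"
  proof (rule countably_additiveI)
    fix A :: "nat \<Rightarrow> _" assume A: "range A \<subseteq> sets M" "disjoint_family A"
    have "(\<Sum>i. ennreal p * emeasure M (A i) + ennreal q * emeasure N (A i))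
        = (\<Sum>i. ennreal p * emeasure M (A i)) + (\<Sum>i. ennreal q * emeasure N (A i))"
      by (intro suminf_add[symmetric] summableI)
    then show "(\<Sum>i. ennreal p * emeasure M (A i) + ennreal q * emeasure N (A i))
        = ennreal p * emeasure M (\<Union>i. A i) + ennreal q * emeasure N (\<Union>i. A i)"
      using A assms by (simp add: suminf_emeasure)
  qed
qed (rule assms)

lemma nn_integral_mix:
  assumes N: "sets N = sets M" and f: "f \<in> borel_measurable M"
  shows "(\<integral>\<^sup>+x. f x \<partial>mix p q M N) = ennreal p * (\<integral>\<^sup>+x. f x \<partial>M) + ennreal q * (\<integral>\<^sup>+x. f x \<partial>N)"
  using f
proof (induction rule: borel_measurable_induct)
  case (cong f g)
  have "space N = space M" by (rule sets_eq_imp_space_eq[OF N])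
  then have eq: "integral\<^sup>N M f = integral\<^sup>N M g" "integral\<^sup>N N f = integral\<^sup>N N g"
    "integral\<^sup>N (mix p q M N) f = integral\<^sup>N (mix p q M N) g"
    using cong(3) by (auto intro!: nn_integral_cong)
  show ?case unfolding eq by (rule cong(4))
next
  case (set A)
  then show ?case using N by (simp add: emeasure_mix[OF N])
next
  case (mult u c)
  have [measurable]: "u \<in> borel_measurable N" "u \<in> borel_measurable (mix p q M N)"
    using mult(2) by (simp_all add: measurable_cong_sets[OF N refl] measurable_cong_sets[OF sets_mix refl])
  show ?case using mult by (simp add: nn_integral_cmult algebra_simps)
next
  case (add u v)
  have [measurable]: "u \<in> borel_measurable N" "u \<in> borel_measurable (mix p q M N)"
    "v \<in> borel_measurable N" "v \<in> borel_measurable (mix p q M N)"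
    using add by (simp_all add: measurable_cong_sets[OF N refl] measurable_cong_sets[OF sets_mix refl])
  show ?case using add by (simp add: nn_integral_add algebra_simps)
next
  case (seq U)
  have [measurable]: "U i \<in> borel_measurable N" "U i \<in> borel_measurable (mix p q M N)" for i
    using seq by (simp_all add: measurable_cong_sets[OF N refl] measurable_cong_sets[OF sets_mix refl])
  have inc: "incseq (\<lambda>i. c * (\<integral>\<^sup>+x. U i x \<partial>L))" for c :: ennreal and L
    using seq by (auto simp: incseq_def le_fun_def intro!: mult_left_mono nn_integral_mono)
  have "(\<integral>\<^sup>+x. (SUP i. U i) x \<partial>mix p q M N) = (SUP i. \<integral>\<^sup>+x. U i x \<partial>mix p q M N)"
    unfolding SUP_apply by (intro nn_integral_monotone_convergence_SUP seq) auto
  also have "\<dots> = (SUP i. ennreal p * (\<integral>\<^sup>+x. U i x \<partial>M) + ennreal q * (\<integral>\<^sup>+x. U i x \<partial>N))"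
    using seq by simp
  also have "\<dots> = (SUP i. ennreal p * (\<integral>\<^sup>+x. U i x \<partial>M)) + (SUP i. ennreal q * (\<integral>\<^sup>+x. U i x \<partial>N))"
    by (intro ennreal_SUP_add inc)
  also have "\<dots> = ennreal p * (\<integral>\<^sup>+x. (SUP i. U i) x \<partial>M) + ennreal q * (\<integral>\<^sup>+x. (SUP i. U i) x \<partial>N)"
    using seq unfolding SUP_apply
    by (subst (1 2) nn_integral_monotone_convergence_SUP) (auto simp: SUP_mult_left_ennreal)
  finally show ?case .
qed

lemma krein_stringI: "0 < l \<Longrightarrow> M \<in> strings l \<Longrightarrow> krein_string l M"
  by (rule krein_string.intro)

lemma mix_in_strings:
  assumes "M \<in> strings l" "N \<in> strings l"
  shows "mix p q M N \<in> strings l"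
proof -
  have sets: "sets N = sets M" using assms by (simp add: strings_def)
  have "space N = space M" by (rule sets_eq_imp_space_eq[OF sets])
  moreover have "emeasure M (space M) \<noteq> \<infinity>" "emeasure N (space N) \<noteq> \<infinity>"
    using assms by (auto simp: strings_def finite_measure.emeasure_finite)
  ultimately have "emeasure (mix p q M N) (space (mix p q M N)) \<noteq> \<infinity>"
    by (simp add: emeasure_mix[OF sets] ennreal_mult_eq_top_iff)
  then show ?thesis using assms by (auto simp: strings_def intro: finite_measureI)
qed

lemma integral_mix:
  fixes f :: "real \<Rightarrow> complex"
  assumes l: "0 < l" and MN: "M \<in> strings l" "N \<in> strings l" and pq: "0 \<le> p" "0 \<le> q"
    and f: "continuous_on {0..l} f"
  shows "(LINT s|mix p q M N. f s) = p *\<^sub>R (LINT s|M. f s) + q *\<^sub>R (LINT s|N. f s)"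
proof -
  interpret M: krein_string l M by (rule krein_stringI[OF l MN(1)])
  interpret N: krein_string l N by (rule krein_stringI[OF l MN(2)])
  interpret K: krein_string l "mix p q M N" by (rule krein_stringI[OF l mix_in_strings[OF MN]])
  have sets: "sets N = sets M" by (simp add: M.sets_M N.sets_M)
  have nonneg: "(LINT s|mix p q M N. h s) = p * (LINT s|M. h s) + q * (LINT s|N. h s)"
    if h: "continuous_on {0..l} h" "\<And>s. s \<in> {0..l} \<Longrightarrow> 0 \<le> h s" for h :: "real \<Rightarrow> real"
  proof -
    have pos: "0 \<le> (LINT s|M. h s)" "0 \<le> (LINT s|N. h s)" "0 \<le> (LINT s|mix p q M N. h s)"
      using h(2) by (auto intro!: integral_nonneg_AE)
    have nn: "(\<integral>\<^sup>+s. ennreal (h s) \<partial>L) = ennreal (LINT s|L. h s)" if "krein_string l L" for L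
    proof -
      interpret L: krein_string l L by fact
      show ?thesis by (intro nn_integral_eq_integral L.integrable_continuous h(1)) (use h(2) in auto)
    qed
    have "(\<lambda>s. ennreal (h s)) \<in> borel_measurable M"
      using M.continuous_measurable_M[OF h(1)] by measurable
    from nn_integral_mix[OF sets this, of p q]
    have "ennreal (LINT s|mix p q M N. h s) = ennreal (p * (LINT s|M. h s) + q * (LINT s|N. h s))"
      using pos pq by (simp add: nn M.krein_string_axioms N.krein_string_axioms K.krein_string_axioms ennreal_mult ennreal_plus)
    then show ?thesis using pos pq by (subst (asm) ennreal_inj) auto
  qed
  \<comment> \<open>Adding a bound B of |h| reduces the claim to nonnegative functions, for which it
    comes from \<open>nn_integral_mix\<close>.\<close>
  have real: "(LINT s|mix p q M N. h s) = p * (LINT s|M. h s) + q * (LINT s|N. h s)"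
    if h: "continuous_on {0..l} h" for h :: "real \<Rightarrow> real"
  proof -
    obtain B where B: "0 < B" "\<And>x. x \<in> {0..l} \<Longrightarrow> norm (h x) \<le> B" using M.bounded_continuous[OF h] by blast
    have shift: "(LINT s|L. h s + B) = (LINT s|L. h s) + (LINT s|L. B)" if "krein_string l L" for L
    proof -
      interpret L: krein_string l L by fact
      show ?thesis by (intro Bochner_Integration.integral_add L.integrable_continuous h continuous_intros)
    qed
    have "(LINT s|mix p q M N. h s + B) = p * (LINT s|M. h s + B) + q * (LINT s|N. h s + B)"
      using B(2) by (intro nonneg continuous_intros h) (force simp: abs_le_iff)
    moreover have "(LINT s|mix p q M N. B) = p * (LINT s|M. B) + q * (LINT s|N. B)"
      using B(1) by (intro nonneg continuous_intros) auto
    ultimately show ?thesis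
      by (simp only: shift M.krein_string_axioms N.krein_string_axioms K.krein_string_axioms distrib_left)
  qed
  have cx: "integrable L f" if "krein_string l L" for L
  proof -
    interpret L: krein_string l L by fact
    show ?thesis by (rule L.integrable_continuous[OF f])
  qed
  have "continuous_on {0..l} (\<lambda>s. Re (f s))" "continuous_on {0..l} (\<lambda>s. Im (f s))"
    by (intro continuous_intros f)+
  from this[THEN real] show ?thesis
    by (simp add: complex_eq_iff cx M.krein_string_axioms N.krein_string_axioms K.krein_string_axioms)
qed

text \<open>Later arguments see the mixture only through integrals of continuous functions; the
  total mass is the case f = 1.\<close>

lemma finite_mixture:
  assumes l: "0 < l" and M: "M \<in> strings l" and J: "finite J" "\<And>j. j \<in> J \<Longrightarrow> N j \<in> strings l"
    and e: "\<And>j. j \<in> J \<Longrightarrow> 0 \<le> e j" and t: "0 \<le> t"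
  shows "\<exists>K\<in>strings l. \<forall>f::real \<Rightarrow> complex. continuous_on {0..l} f \<longrightarrow>
    (LINT s|K. f s) = t *\<^sub>R (LINT s|M. f s) + (\<Sum>j\<in>J. e j *\<^sub>R (LINT s|N j. f s))"
  using J e
proof (induction J rule: finite_induct)
  case empty
  show ?case
    by (rule bexI[OF _ mix_in_strings[OF M M, of t 0]]) (simp add: integral_mix[OF l M M t])
next
  case (insert j J)
  then obtain K where K: "K \<in> strings l" "\<And>f::real \<Rightarrow> complex. continuous_on {0..l} f \<Longrightarrow>
    (LINT s|K. f s) = t *\<^sub>R (LINT s|M. f s) + (\<Sum>j\<in>J. e j *\<^sub>R (LINT s|N j. f s))"
    by auto
  have Nj: "N j \<in> strings l" "0 \<le> e j" using insert by auto
  show ?case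
    by (rule bexI[OF _ mix_in_strings[OF K(1) Nj(1), of 1 "e j"]])
       (use insert in \<open>simp add: integral_mix[OF l K(1) Nj(1)] K(2) Nj(2)\<close>)
qed

section \<open>Perturbation of resonances\<close>

lemma admissible_iff:
  assumes "0 < l" "0 \<le> m"
  shows "M \<in> admissible_strings l m \<longleftrightarrow> M \<in> strings l \<and> measure M {0..l} \<le> m"
proof (cases "M \<in> strings l")
  case True
  then interpret krein_string l M by (rule krein_stringI[OF assms(1)])
  show ?thesis
    using True assms by (simp add: admissible_strings_def emeasure_eq_measure)
qed (simp add: admissible_strings_def)

section \<open>Bounds and stability, uniform over the admissible strings\<close>

context krein_string
begin

lemma phi_solution: "string_solution l M (z\<^sup>2) (phi l M z)"
  by unfold_locales (rule phi_volterra)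

lemma phi_le:
  assumes "measure M {0..l} \<le> m" "norm z \<le> R" "x \<in> {0..l}"
  shows "norm (phi l M z x) \<le> 2 * exp (2 * (2 * R\<^sup>2 * m + 1) * l)"
proof -
  have m: "0 \<le> m" using assms(1) measure_nonneg[of M "{0..l}"] by linarith
  have "norm (z\<^sup>2) \<le> R\<^sup>2" using assms(2) by (simp add: norm_power power_mono)
  then have "2 * norm (z\<^sup>2) * measure M {0..l} \<le> 2 * R\<^sup>2 * m"
    using assms(1) m by (intro mult_mono) auto
  moreover have "0 \<le> 2 * R\<^sup>2 * m" using m by simp
  ultimately have k: "0 < 2 * R\<^sup>2 * m + 1" "2 * norm (z\<^sup>2) * measure M {0..l} \<le> 2 * R\<^sup>2 * m + 1"
    by linarith+
  have "norm (0 - phi l M z x) \<le> 2 * 1 * exp (2 * (2 * R\<^sup>2 * m + 1) * l)"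
    by (rule approximate_solution[OF phi_volterra[of z] _ _ k assms(3)]) auto
  then show ?thesis by simp
qed

end

text \<open>
  The number \<open>\<rho>\<close> bounds the total variation of \<open>M - M'\<close>, tested against continuous functions only.
\<close>
definition variation_le :: "real \<Rightarrow> real measure \<Rightarrow> real measure \<Rightarrow> real \<Rightarrow> bool" where
  "variation_le l M M' \<rho> \<longleftrightarrow> (\<forall>(f::real \<Rightarrow> complex) B. continuous_on {0..l} f \<longrightarrow>
     (\<forall>x\<in>{0..l}. norm (f x) \<le> B) \<longrightarrow> norm ((LINT s|M. f s) - (LINT s|M'. f s)) \<le> \<rho> * B)"

lemma variation_leD:
  fixes f :: "real \<Rightarrow> complex"
  assumes "variation_le l M M' \<rho>" "continuous_on {0..l} f" "\<And>x. x \<in> {0..l} \<Longrightarrow> norm (f x) \<le> B"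
  shows "norm ((LINT s|M. f s) - (LINT s|M'. f s)) \<le> \<rho> * B"
  using assms unfolding variation_le_def by blast

text \<open>The solution for M' and z' is an approximate solution for M and z: the residual is
  \<open>z\<^sup>2 * (A - B) + (z\<^sup>2 - z'\<^sup>2) * B\<close>, where A and B are its kernel
  integrals against M and M'.\<close>

lemma phi_stable:
  assumes l: "0 < l" and m: "0 \<le> m"
  shows "\<exists>K\<ge>0. \<forall>M M' z z' \<rho>. M \<in> admissible_strings l m \<longrightarrow> M' \<in> admissible_strings l m \<longrightarrow>
    norm z \<le> R \<longrightarrow> norm z' \<le> R \<longrightarrow> variation_le l M M' \<rho> \<longrightarrow> 0 \<le> \<rho> \<longrightarrow>
    (\<forall>x\<in>{0..l}. norm (phi l M' z' x - phi l M z x) \<le> K * (\<rho> + norm (z - z')))"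
proof -
  define k where "k = 2 * R\<^sup>2 * m + 1"
  define \<Phi> where "\<Phi> = 2 * exp (2 * k * l)"
  define K where "K = 2 * exp (2 * k * l) * (l * \<Phi> * (R\<^sup>2 + 2 * \<bar>R\<bar> * m))"
  have \<Phi>: "0 < \<Phi>" by (simp add: \<Phi>_def)
  have "0 \<le> K" using l m \<Phi> by (simp add: K_def)
  moreover have "norm (phi l M' z' x - phi l M z x) \<le> K * (\<rho> + norm (z - z'))"
    if M: "M \<in> admissible_strings l m" and M': "M' \<in> admissible_strings l m"
      and z: "norm z \<le> R" and z': "norm z' \<le> R" and \<rho>: "variation_le l M M' \<rho>" "0 \<le> \<rho>" and x: "x \<in> {0..l}"
    for M M' z z' \<rho> x
  proof -
    have mass: "M \<in> strings l" "measure M {0..l} \<le> m" "M' \<in> strings l" "measure M' {0..l} \<le> m"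
      using M M' admissible_iff[OF l m] by auto
    interpret M: krein_string l M by (rule krein_stringI[OF l mass(1)])
    interpret M': krein_string l M' by (rule krein_stringI[OF l mass(3)])
    let ?f = "phi l M' z'"
    have fc: "continuous_on {0..l} ?f" by (rule M'.volterra_continuous[OF M'.phi_volterra])
    have f_le: "norm (?f x) \<le> \<Phi>" if "x \<in> {0..l}" for x
      unfolding \<Phi>_def k_def by (rule M'.phi_le[OF mass(4) z' that])
    have z2: "norm (z\<^sup>2) \<le> R\<^sup>2" using z by (simp add: norm_power power_mono)
    have "2 * norm (z\<^sup>2) * measure M {0..l} \<le> 2 * R\<^sup>2 * m"
      using z2 mass(2) m by (intro mult_mono) auto
    moreover have "0 \<le> 2 * R\<^sup>2 * m" using m by simp
    ultimately have k: "0 < k" "2 * norm (z\<^sup>2) * measure M {0..l} \<le> k"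
      unfolding k_def by linarith+
    define D where "D = l * \<Phi> * (R\<^sup>2 + 2 * \<bar>R\<bar> * m) * (\<rho> + norm (z - z'))"
    have "norm (?f x - phi l M z x) \<le> 2 * D * exp (2 * k * l)"
    proof (rule M.approximate_solution[OF M.phi_volterra fc _ k x])
      fix x assume x: "x \<in> {0..l}"
      define A B where "A = (LINT s|M. complex_of_real (max 0 (x - s)) * ?f s)"
        and "B = (LINT s|M'. complex_of_real (max 0 (x - s)) * ?f s)"
      have le: "norm (complex_of_real (max 0 (x - s)) * ?f s) \<le> l * \<Phi>" if "s \<in> {0..l}" for s
        unfolding norm_mult using that x f_le l by (intro mult_mono) auto
      have kc: "continuous_on {0..l} (\<lambda>s. complex_of_real (max 0 (x - s)) * ?f s)"
        by (intro continuous_intros fc)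
      have AB: "norm (A - B) \<le> \<rho> * (l * \<Phi>)"
        unfolding A_def B_def by (rule variation_leD[OF \<rho>(1) kc le])
      have B_le: "norm B \<le> l * \<Phi> * m"
      proof -
        have "norm B \<le> l * \<Phi> * measure M' {0..l}"
          unfolding B_def using le l \<Phi> by (intro M'.norm_integral_le) auto
        also have "\<dots> \<le> l * \<Phi> * m" using mass(4) l \<Phi> by (intro mult_left_mono) auto
        finally show ?thesis .
      qed
      have zz: "norm (z\<^sup>2 - z'\<^sup>2) \<le> 2 * \<bar>R\<bar> * norm (z - z')"
      proof -
        have "z\<^sup>2 - z'\<^sup>2 = (z + z') * (z - z')" by (simp add: power2_eq_square algebra_simps)
        moreover have "norm (z + z') \<le> 2 * \<bar>R\<bar>" using norm_triangle_ineq[of z z'] z z' by linarith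
        ultimately show ?thesis by (simp add: norm_mult mult_right_mono)
      qed
      have "?f x - 1 + z\<^sup>2 * A = z\<^sup>2 * (A - B) + (z\<^sup>2 - z'\<^sup>2) * B"
        using M'.volterra_eq[OF M'.phi_volterra x, of z'] unfolding B_def[symmetric]
        by (simp add: algebra_simps)
      then have "norm (?f x - 1 + z\<^sup>2 * A) \<le> norm (z\<^sup>2) * norm (A - B) + norm (z\<^sup>2 - z'\<^sup>2) * norm B"
        using norm_triangle_ineq[of "z\<^sup>2 * (A - B)" "(z\<^sup>2 - z'\<^sup>2) * B"] by (simp add: norm_mult)
      also have "\<dots> \<le> R\<^sup>2 * (\<rho> * (l * \<Phi>)) + (2 * \<bar>R\<bar> * norm (z - z')) * (l * \<Phi> * m)"
        using z2 AB zz B_le \<rho> by (intro add_mono mult_mono) auto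
      also have "\<dots> = l * \<Phi> * (R\<^sup>2 * \<rho> + 2 * \<bar>R\<bar> * m * norm (z - z'))"
        by (simp add: algebra_simps)
      also have "\<dots> \<le> l * \<Phi> * (R\<^sup>2 * (\<rho> + norm (z - z')) + 2 * \<bar>R\<bar> * m * (\<rho> + norm (z - z')))"
        using l \<Phi> \<rho> m by (intro mult_left_mono add_mono) auto
      also have "\<dots> = D" by (simp add: D_def algebra_simps)
      finally show "norm (?f x - 1 + z\<^sup>2 * (LINT s|M. complex_of_real (max 0 (x - s)) * ?f s)) \<le> D"
        unfolding A_def .
    qed
    also have "\<dots> = K * (\<rho> + norm (z - z'))" by (simp add: D_def K_def)
    finally show ?thesis .
  qed
  ultimately show ?thesis by blast
qed

text \<open>Supplies the continuity in the string that Brouwer's theorem asks for. In the proof A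
  carries the change of the measure and B the change of the solution.\<close>

lemma char_fun_lipschitz:
  assumes l: "0 < l" and m: "0 \<le> m"
  shows "\<exists>K\<ge>0. \<forall>M M' \<rho>. M \<in> admissible_strings l m \<longrightarrow> M' \<in> admissible_strings l m \<longrightarrow>
    variation_le l M M' \<rho> \<longrightarrow> 0 \<le> \<rho> \<longrightarrow> norm (char_fun l M z - char_fun l M' z) \<le> K * \<rho>"
proof -
  obtain K where K: "0 \<le> K" "\<And>M M' \<rho> x. M \<in> admissible_strings l m \<Longrightarrow> M' \<in> admissible_strings l m \<Longrightarrow>
    variation_le l M M' \<rho> \<Longrightarrow> 0 \<le> \<rho> \<Longrightarrow> x \<in> {0..l} \<Longrightarrow> norm (phi l M' z x - phi l M z x) \<le> K * \<rho>"
    using phi_stable[OF l m, of "norm z"] by fastforce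
  define \<Phi> where "\<Phi> = 2 * exp (2 * (2 * (norm z)\<^sup>2 * m + 1) * l)"
  define L where "L = K + norm z * (\<Phi> + K * m)"
  have "0 \<le> L" using K m by (simp add: L_def \<Phi>_def)
  moreover have "norm (char_fun l M z - char_fun l M' z) \<le> L * \<rho>"
    if M: "M \<in> admissible_strings l m" "M' \<in> admissible_strings l m" and \<rho>: "variation_le l M M' \<rho>" "0 \<le> \<rho>" for M M' \<rho>
  proof -
    have mass: "M \<in> strings l" "measure M {0..l} \<le> m" "M' \<in> strings l" "measure M' {0..l} \<le> m"
      using M admissible_iff[OF l m] by auto
    interpret M: krein_string l M by (rule krein_stringI[OF l mass(1)])
    interpret M': krein_string l M' by (rule krein_stringI[OF l mass(3)])
    let ?f = "phi l M z" and ?g = "phi l M' z"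
    have fc: "continuous_on {0..l} ?f" by (rule M.volterra_continuous[OF M.phi_volterra])
    have gc: "continuous_on {0..l} ?g" by (rule M'.volterra_continuous[OF M'.phi_volterra])
    have diff: "norm (?g x - ?f x) \<le> K * \<rho>" if "x \<in> {0..l}" for x by (rule K(2)[OF M \<rho> that])
    define A B where "A = (LINT s|M. ?f s) - (LINT s|M'. ?f s)" and "B = (LINT s|M'. ?g s - ?f s)"
    have "norm A \<le> \<rho> * \<Phi>"
      unfolding A_def \<Phi>_def by (intro variation_leD[OF \<rho>(1) fc] M.phi_le[OF mass(2)]) auto
    moreover have "norm B \<le> K * \<rho> * m"
    proof -
      have "norm B \<le> K * \<rho> * measure M' {0..l}"
        unfolding B_def using diff K \<rho> by (intro M'.norm_integral_le) auto
      also have "\<dots> \<le> K * \<rho> * m" using mass K \<rho> by (intro mult_left_mono) auto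
      finally show ?thesis .
    qed
    ultimately have AB: "norm (A - B) \<le> \<rho> * \<Phi> + K * \<rho> * m" using norm_triangle_ineq4[of A B] by linarith
    have B: "B = (LINT s|M'. ?g s) - (LINT s|M'. ?f s)"
      unfolding B_def by (intro Bochner_Integration.integral_diff M'.integrable_continuous fc gc)
    have "char_fun l M z - char_fun l M' z = - (?g l - ?f l) - \<i> * z * (A - B)"
      unfolding M.char_fun_eq M'.char_fun_eq A_def B by (simp add: algebra_simps)
    also have "norm \<dots> \<le> norm (?g l - ?f l) + norm z * norm (A - B)"
      using norm_triangle_ineq4[of "- (?g l - ?f l)" "\<i> * z * (A - B)"] by (simp add: norm_mult norm_minus_commute)
    also have "\<dots> \<le> K * \<rho> + norm z * (\<rho> * \<Phi> + K * \<rho> * m)"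
      using diff[of l] AB l by (intro add_mono mult_left_mono) auto
    also have "\<dots> = L * \<rho>" by (simp add: L_def algebra_simps)
    finally show ?thesis .
  qed
  ultimately show ?thesis by blast
qed

text \<open>Being exact, this identity also covers multiple zeros \<open>\<omega>\<close>.\<close>
lemma char_fun_variation:
  assumes l: "0 < l" and M: "M \<in> strings l" and K: "K \<in> strings l"
    and zero: "char_fun l M \<omega> = 0" and nz: "z \<noteq> 0" "\<omega> \<noteq> 0"
  shows "\<i> * z * phi l M \<omega> l * char_fun l K z = \<i> * (z - \<omega>) * phi l K z l * phi l M \<omega> l
    + z\<^sup>2 * (LINT s|K. phi l K z s * phi l M \<omega> s) - \<omega>\<^sup>2 * (LINT s|M. phi l K z s * phi l M \<omega> s)"
proof -
  interpret M: krein_string l M by (rule krein_stringI[OF l M])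
  interpret K: krein_string l K by (rule krein_stringI[OF l K])
  let ?f = "phi l K z" and ?g = "phi l M \<omega>"
  have all: "(LINT s|L. indicat_real {..l} s *\<^sub>R h s) = (LINT s|L. h s)" if "krein_string l L" for L and h :: "real \<Rightarrow> complex"
  proof -
    interpret L: krein_string l L by fact
    show ?thesis by (intro Bochner_Integration.integral_cong) auto
  qed
  note all = all[OF M.krein_string_axioms] all[OF K.krein_string_axioms]
  have lag: "?g l * (z\<^sup>2 * (LINT s|K. ?f s)) - ?f l * (\<omega>\<^sup>2 * (LINT s|M. ?g s))
    = z\<^sup>2 * (LINT s|K. ?f s * ?g s) - \<omega>\<^sup>2 * (LINT s|M. ?f s * ?g s)"
    using lagrange_identity[OF K.krein_string_axioms M.krein_string_axioms K.phi_volterra M.phi_volterra, of l "{..l}" \<omega> z] l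
    unfolding all by (simp add: subset_eq)
  define I J F where "I = (LINT s|K. ?f s)" and "J = (LINT s|M. ?g s)" and "F = char_fun l K z"
  have F: "F = ?f l - \<i> * z * I" by (simp add: F_def I_def K.char_fun_eq)
  have G: "?g l = \<i> * \<omega> * J" using zero by (simp add: J_def M.char_fun_eq)
  have "\<i> * z * ?g l * F = \<i> * z * ?g l * ?f l + z\<^sup>2 * I * ?g l"
    unfolding F by (simp add: algebra_simps power2_eq_square)
  moreover have "\<omega>\<^sup>2 * J = - (\<i> * \<omega> * ?g l)"
  proof -
    have "\<i> * \<omega> * ?g l = (\<i> * \<i>) * (\<omega>\<^sup>2 * J)" unfolding G by (simp only: power2_eq_square ac_simps)
    then show ?thesis by simp
  qed
  ultimately have "\<i> * z * ?g l * F = \<i> * (z - \<omega>) * ?f l * ?g l + (?g l * (z\<^sup>2 * I) - ?f l * (\<omega>\<^sup>2 * J))"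
    by (simp add: algebra_simps)
  then show ?thesis
    using lag unfolding I_def J_def F_def by simp
qed

text \<open>The target z = \<omega> + i \<eta> is kept fixed and F(z; K w) = 0 is solved for w,
  where K w is a mixture over which \<psi>^2 has the integral v + w. By
  \<open>char_fun_variation\<close> the normalized function H w is w, up to a part of order \<eta>
  from moving \<omega> to z and a part of order |w| (|w| + \<eta>) from the change of the solution.
  So w - H w maps a small disc into itself, and its fixed point is a zero of H.\<close>

lemma resonance_perturbation:
  assumes l: "0 < l" and m: "0 < m" and M: "M \<in> admissible_strings l m"
    and zero: "char_fun l M \<omega> = 0" and Re: "Re \<omega> \<noteq> 0" and end_nz: "phi l M \<omega> l \<noteq> 0"
    and int: "(LINT s|M. (phi l M \<omega> s)\<^sup>2) \<in> interior ((\<lambda>N. LINT s|N. (phi l M \<omega> s)\<^sup>2) ` admissible_strings l m)"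
  shows "\<exists>\<eta>>0. \<exists>K\<in>admissible_strings l m. char_fun l K (\<omega> + \<i> * complex_of_real \<eta>) = 0"
proof -
  have m': "0 \<le> m" using m by simp
  note adm = admissible_iff[OF l m']
  have Ms: "M \<in> strings l" "measure M {0..l} \<le> m" using M adm by auto
  interpret M: krein_string l M by (rule krein_stringI[OF l Ms(1)])
  define \<psi> where "\<psi> = phi l M \<omega>"
  have psi_c: "continuous_on {0..l} \<psi>"
    unfolding \<psi>_def by (rule M.volterra_continuous[OF M.phi_volterra])
  have om: "\<omega> \<noteq> 0" using Re by auto
  define v where "v = (LINT s|M. (\<psi> s)\<^sup>2)"
  obtain \<delta> where \<delta>: "0 < \<delta>" "cball v \<delta> \<subseteq> (\<lambda>N. LINT s|N. (\<psi> s)\<^sup>2) ` admissible_strings l m"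
    using int by (auto simp: mem_interior_cball v_def \<psi>_def)
  \<comment> \<open>Four directions, because mixing weights must be nonnegative: they will carry the
    positive and negative parts of Re w and Im w.\<close>
  define U where "U = {1, -1, \<i>, -\<i>}"
  have "card U = 4" by (simp add: U_def complex_eq_iff)
  then have U: "finite U" "card U = 4" "\<And>u. u \<in> U \<Longrightarrow> norm u = 1"
    by (auto simp: U_def)
  have "\<forall>u\<in>U. \<exists>N. N \<in> admissible_strings l m \<and> (LINT s|N. (\<psi> s)\<^sup>2) = v + \<delta> *\<^sub>R u"
  proof
    fix u assume "u \<in> U"
    then have "v + \<delta> *\<^sub>R u \<in> cball v \<delta>" using \<delta> U by (simp add: dist_norm)
    then show "\<exists>N. N \<in> admissible_strings l m \<and> (LINT s|N. (\<psi> s)\<^sup>2) = v + \<delta> *\<^sub>R u"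
      using \<delta>(2) by (metis (no_types, lifting) image_iff subsetD)
  qed
  then obtain N where N: "\<And>u. u \<in> U \<Longrightarrow> N u \<in> admissible_strings l m"
    "\<And>u. u \<in> U \<Longrightarrow> (LINT s|N u. (\<psi> s)\<^sup>2) = v + \<delta> *\<^sub>R u"
    using bchoice[of U] by metis
  have Ns: "N u \<in> strings l" "measure (N u) {0..l} \<le> m" if "u \<in> U" for u using N that adm by auto

  define e where "e w u = max 0 (Re (cnj u * w)) / \<delta>" for w u
  have e_nonneg: "0 \<le> e w u" for w u using \<delta> by (simp add: e_def)
  have e_lip: "\<bar>e w u - e w' u\<bar> \<le> norm (w - w') / \<delta>" if "u \<in> U" for u w w'
  proof -
    have "\<bar>Re (cnj u * w) - Re (cnj u * w')\<bar> = \<bar>Re (cnj u * (w - w'))\<bar>" by (simp add: algebra_simps)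
    also have "\<dots> \<le> norm (w - w')" using abs_Re_le_cmod[of "cnj u * (w - w')"] U(3)[OF that] by (simp add: norm_mult)
    finally have "\<bar>max 0 (Re (cnj u * w)) - max 0 (Re (cnj u * w'))\<bar> \<le> norm (w - w')" by linarith
    then show ?thesis using \<delta>(1) unfolding e_def diff_divide_distrib[symmetric] by (simp add: divide_right_mono)
  qed
  have e0: "e 0 u = 0" for u by (simp add: e_def)
  have e_sum: "(\<Sum>u\<in>U. e w u *\<^sub>R (\<delta> *\<^sub>R u)) = w" for w
    using \<delta>(1) by (simp add: U_def e_def complex_eq_iff max_def)
  \<comment> \<open>Each of the four weights is at most |w| / \<delta>, so |w| <= \<delta> / 4
    leaves M a nonnegative weight.\<close>
  have e_le: "(\<Sum>u\<in>U. e w u) \<le> 1" if "norm w \<le> \<delta> / 4" for w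
  proof -
    have "(\<Sum>u\<in>U. e w u) \<le> of_nat (card U) * (norm w / \<delta>)"
      using e_lip[of _ w 0] e0 by (intro sum_bounded_above) (simp add: abs_le_iff)
    also have "\<dots> \<le> 1" using that \<delta>(1) by (simp add: U(2) field_simps)
    finally show ?thesis .
  qed
  have "\<forall>w\<in>cball 0 (\<delta> / 4). \<exists>K. K \<in> strings l \<and> (\<forall>f::real \<Rightarrow> complex. continuous_on {0..l} f \<longrightarrow>
    (LINT s|K. f s) = (1 - (\<Sum>u\<in>U. e w u)) *\<^sub>R (LINT s|M. f s) + (\<Sum>u\<in>U. e w u *\<^sub>R (LINT s|N u. f s)))"
  proof
    fix w assume w: "w \<in> cball (0::complex) (\<delta> / 4)"
    show "\<exists>K. K \<in> strings l \<and> (\<forall>f::real \<Rightarrow> complex. continuous_on {0..l} f \<longrightarrow>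
      (LINT s|K. f s) = (1 - (\<Sum>u\<in>U. e w u)) *\<^sub>R (LINT s|M. f s) + (\<Sum>u\<in>U. e w u *\<^sub>R (LINT s|N u. f s)))"
      using finite_mixture[OF l Ms(1) U(1), of N "e w" "1 - (\<Sum>u\<in>U. e w u)"] Ns e_nonneg e_le[of w] w by auto
  qed
  from bchoice[OF this] obtain K where K': "\<forall>w\<in>cball 0 (\<delta> / 4). K w \<in> strings l \<and> (\<forall>f::real \<Rightarrow> complex. continuous_on {0..l} f \<longrightarrow>
    (LINT s|K w. f s) = (1 - (\<Sum>u\<in>U. e w u)) *\<^sub>R (LINT s|M. f s) + (\<Sum>u\<in>U. e w u *\<^sub>R (LINT s|N u. f s)))" ..
  have K: "K w \<in> strings l" "continuous_on {0..l} f \<Longrightarrow>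
    (LINT s|K w. f s) = (1 - (\<Sum>u\<in>U. e w u)) *\<^sub>R (LINT s|M. f s) + (\<Sum>u\<in>U. e w u *\<^sub>R (LINT s|N u. f s))"
    if "w \<in> cball 0 (\<delta> / 4)" for w and f :: "real \<Rightarrow> complex"
    using bspec[OF K' that] by blast+
  have K_eq: "(LINT s|K w. f s) = (LINT s|M. f s) + (\<Sum>u\<in>U. e w u *\<^sub>R ((LINT s|N u. f s) - (LINT s|M. f s)))"
    if "w \<in> cball 0 (\<delta> / 4)" "continuous_on {0..l} f" for w and f :: "real \<Rightarrow> complex"
    unfolding K(2)[OF that] by (simp add: algebra_simps sum_subtractf scaleR_sum_left)
  have K_adm: "K w \<in> admissible_strings l m" if w: "w \<in> cball 0 (\<delta> / 4)" for w
  proof -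
    have sp: "space L = {0..l}" if "L \<in> strings l" for L
    proof -
      interpret L: krein_string l L by (rule krein_stringI[OF l that])
      show ?thesis by simp
    qed
    have "complex_of_real (measure (K w) {0..l}) = complex_of_real
        ((1 - (\<Sum>u\<in>U. e w u)) * measure M {0..l} + (\<Sum>u\<in>U. e w u * measure (N u) {0..l}))"
      using K(2)[OF w, of "\<lambda>_. 1"] by (simp add: sp K(1)[OF w] Ms Ns scaleR_conv_of_real cong: sum.cong)
    then have "measure (K w) {0..l} = (1 - (\<Sum>u\<in>U. e w u)) * measure M {0..l} + (\<Sum>u\<in>U. e w u * measure (N u) {0..l})"
      by (simp only: of_real_eq_iff)
    also have "\<dots> \<le> (1 - (\<Sum>u\<in>U. e w u)) * m + (\<Sum>u\<in>U. e w u * m)"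
      using e_nonneg e_le[of w] w Ms Ns by (intro add_mono mult_left_mono sum_mono) auto
    also have "\<dots> = m" unfolding sum_distrib_right[symmetric] by (simp add: algebra_simps)
    finally show ?thesis using K(1)[OF w] adm by simp
  qed
  \<comment> \<open>8 is 4 directions times 2: exchanging M for N u changes an integral by at most 2
    B m.\<close>
  define C where "C = 8 * m / \<delta>"
  have C: "0 \<le> C" using m \<delta> by (simp add: C_def)
  have variation: "variation_le l L L' (C * norm d)"
    if LL: "\<And>f::real \<Rightarrow> complex. continuous_on {0..l} f \<Longrightarrow>
      (LINT s|L. f s) - (LINT s|L'. f s) = (\<Sum>u\<in>U. h u *\<^sub>R ((LINT s|N u. f s) - (LINT s|M. f s)))"
      and h: "\<And>u. u \<in> U \<Longrightarrow> \<bar>h u\<bar> \<le> norm d / \<delta>" for L L' h and d :: complex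
    unfolding variation_le_def
  proof (intro allI impI)
    fix f :: "real \<Rightarrow> complex" and B assume f: "continuous_on {0..l} f" "\<forall>x\<in>{0..l}. norm (f x) \<le> B"
    have "norm (f 0) \<le> B" using f(2) l by auto
    then have B: "0 \<le> B" using norm_ge_zero[of "f 0"] by linarith
    have bound: "norm (LINT s|L. f s) \<le> B * m" if "L \<in> strings l" "measure L {0..l} \<le> m" for L
    proof -
      interpret L: krein_string l L by (rule krein_stringI[OF l that(1)])
      have "norm (LINT s|L. f s) \<le> B * measure L {0..l}" using f B by (intro L.norm_integral_le) auto
      also have "\<dots> \<le> B * m" using that B by (intro mult_left_mono)
      finally show ?thesis .
    qed
    have "norm (h u *\<^sub>R ((LINT s|N u. f s) - (LINT s|M. f s))) \<le> norm d / \<delta> * (2 * B * m)" if "u \<in> U" for u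
    proof -
      have "norm ((LINT s|N u. f s) - (LINT s|M. f s)) \<le> 2 * B * m"
        using norm_triangle_ineq4[of "LINT s|N u. f s" "LINT s|M. f s"] bound[OF Ns[OF that]] bound[OF Ms] by linarith
      then show ?thesis using h[OF that] B m unfolding norm_scaleR by (intro mult_mono) auto
    qed
    then have "norm (\<Sum>u\<in>U. h u *\<^sub>R ((LINT s|N u. f s) - (LINT s|M. f s))) \<le> (\<Sum>u\<in>U. norm d / \<delta> * (2 * B * m))"
      by (intro order_trans[OF norm_sum] sum_mono)
    also have "\<dots> = C * norm d * B" by (simp add: U(2) C_def)
    finally show "norm ((LINT s|L. f s) - (LINT s|L'. f s)) \<le> C * norm d * B"
      unfolding LL[OF f(1)] .
  qed
  have var_KM: "variation_le l (K w) M (C * norm w)" if w: "w \<in> cball 0 (\<delta> / 4)" for w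
    by (rule variation[where h = "e w"]) (use e_lip[of _ w 0] in \<open>auto simp: K_eq[OF w] e0\<close>)
  have var_KK: "variation_le l (K w) (K w') (C * norm (w - w'))"
    if w: "w \<in> cball 0 (\<delta> / 4)" "w' \<in> cball 0 (\<delta> / 4)" for w w'
    by (rule variation[where h = "\<lambda>u. e w u - e w' u"])
       (use e_lip in \<open>auto simp: K_eq[OF w(1)] K_eq[OF w(2)] scaleR_left_diff_distrib sum_subtractf\<close>)

  define R where "R = norm \<omega> + 1"
  obtain P where P: "0 \<le> P" "\<And>M M' z z' \<rho> x. M \<in> admissible_strings l m \<Longrightarrow> M' \<in> admissible_strings l m \<Longrightarrow>
    norm z \<le> R \<Longrightarrow> norm z' \<le> R \<Longrightarrow> variation_le l M M' \<rho> \<Longrightarrow> 0 \<le> \<rho> \<Longrightarrow> x \<in> {0..l} \<Longrightarrow>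
    norm (phi l M' z' x - phi l M z x) \<le> P * (\<rho> + norm (z - z'))"
    using phi_stable[OF l m', of R] by metis
  define \<Phi> where "\<Phi> = 2 * exp (2 * (2 * R\<^sup>2 * m + 1) * l)"
  have \<Phi>: "0 < \<Phi>" by (simp add: \<Phi>_def)
  \<comment> \<open>In the scale of H, a \<eta> will bound the effect of moving \<omega> to z, and b
    |w| (C |w| + \<eta>) that of the change of the solution.\<close>
  define a b where "a = (\<Phi> * \<Phi> + 2 * R * (\<Phi> * \<Phi> * m)) / (norm \<omega>)\<^sup>2" and "b = C * P * \<Phi>"
  have R: "0 < R" "norm \<omega> \<le> R" by (auto simp: R_def intro!: add_nonneg_pos)
  have ab: "0 \<le> a" "0 \<le> b" using \<Phi> R m C P by (auto simp: a_def b_def)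
  \<comment> \<open>r depends on b, C and \<delta>, and \<eta> afterwards on a and r; each of the
    two errors is then at most r / 2.\<close>
  define r where "r = min (\<delta> / 4) (1 / (2 * (b * (C + 1) + 1)))"
  define \<eta> where "\<eta> = min 1 (min r (r / (2 * (a + 1))))"
  have bC: "0 < b * (C + 1) + 1" using ab C by (intro add_nonneg_pos) auto
  have r: "0 < r" "r \<le> \<delta> / 4" "(b * (C + 1) + 1) * r \<le> 1 / 2"
  proof -
    show "0 < r" "r \<le> \<delta> / 4" using \<delta> bC by (auto simp: r_def)
    have "r \<le> 1 / (2 * (b * (C + 1) + 1))" by (simp add: r_def)
    then show "(b * (C + 1) + 1) * r \<le> 1 / 2" using bC by (simp add: field_simps)
  qed
  have \<eta>: "0 < \<eta>" "\<eta> \<le> 1" "\<eta> \<le> r" "(a + 1) * \<eta> \<le> r / 2"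
  proof -
    show "0 < \<eta>" "\<eta> \<le> 1" "\<eta> \<le> r" using r ab by (auto simp: \<eta>_def)
    have "\<eta> \<le> r / (2 * (a + 1))" by (simp add: \<eta>_def)
    then show "(a + 1) * \<eta> \<le> r / 2" using ab by (simp add: field_simps)
  qed
  define z where "z = \<omega> + \<i> * complex_of_real \<eta>"
  have z: "norm (z - \<omega>) = \<eta>" using \<eta> by (simp add: z_def norm_mult)
  have zR: "norm z \<le> R" unfolding z_def R_def using norm_triangle_ineq[of \<omega> "\<i> * complex_of_real \<eta>"] \<eta> by (simp add: norm_mult)
  have "Re z = Re \<omega>" by (simp add: z_def)
  then have z0: "z \<noteq> 0" using Re by auto
  define H where "H w = \<i> * z * \<psi> l * char_fun l (K w) z / \<omega>\<^sup>2" for w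
  have H_approx: "norm (H w - w) \<le> r" if w: "w \<in> cball 0 r" for w
  proof -
    have w': "w \<in> cball 0 (\<delta> / 4)" "norm w \<le> r" using w r by auto
    have Ks: "K w \<in> strings l" "measure (K w) {0..l} \<le> m" using K_adm[OF w'(1)] adm by auto
    interpret K: krein_string l "K w" by (rule krein_stringI[OF l Ks(1)])
    define f where "f = phi l (K w) z"
    have fc: "continuous_on {0..l} f" unfolding f_def by (rule K.volterra_continuous[OF K.phi_volterra])
    have f_le: "norm (f x) \<le> \<Phi>" if "x \<in> {0..l}" for x
      unfolding f_def \<Phi>_def by (rule K.phi_le[OF Ks(2) zR that])
    have psi_le: "norm (\<psi> x) \<le> \<Phi>" if "x \<in> {0..l}" for x
      unfolding \<psi>_def \<Phi>_def by (rule M.phi_le[OF Ms(2) R(2) that])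
    have close: "norm (f x - \<psi> x) \<le> P * (C * norm w + \<eta>)" if "x \<in> {0..l}" for x
      using P(2)[OF K_adm[OF w'(1)] M zR R(2) var_KM[OF w'(1)] _ that] C z
      by (simp add: f_def \<psi>_def norm_minus_commute)
    define A B where "A = (LINT s|K w. f s * \<psi> s)" and "B = (LINT s|M. f s * \<psi> s)"
    define G where "G = (LINT s|K w. (f s - \<psi> s) * \<psi> s) - (LINT s|M. (f s - \<psi> s) * \<psi> s)"
    have "norm G \<le> C * norm w * (P * (C * norm w + \<eta>) * \<Phi>)"
      unfolding G_def
    proof (rule variation_leD[OF var_KM[OF w'(1)]])
      show "continuous_on {0..l} (\<lambda>s. (f s - \<psi> s) * \<psi> s)" by (intro continuous_intros fc psi_c)
      show "norm ((f x - \<psi> x) * \<psi> x) \<le> P * (C * norm w + \<eta>) * \<Phi>" if "x \<in> {0..l}" for x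
        unfolding norm_mult using close[OF that] psi_le[OF that] P C \<eta> by (intro mult_mono) auto
    qed
    also have "\<dots> = b * (norm w * (C * norm w + \<eta>))" by (simp add: b_def)
    also have "\<dots> \<le> b * (r * (C * r + r))"
      using ab w' C \<eta> r by (intro mult_left_mono mult_mono add_mono) auto
    also have "\<dots> = (b * (C + 1) * r) * r" by (simp add: algebra_simps)
    also have "\<dots> \<le> (1 / 2) * r" using r by (intro mult_right_mono) (auto simp: algebra_simps)
    finally have G_le: "norm G \<le> r / 2" by simp
    have split: "(LINT s|L. (f s - \<psi> s) * \<psi> s) = (LINT s|L. f s * \<psi> s) - (LINT s|L. (\<psi> s)\<^sup>2)" if "L \<in> strings l" for L
    proof -
      interpret L: krein_string l L by (rule krein_stringI[OF l that])
      have "(LINT s|L. (f s - \<psi> s) * \<psi> s) = (LINT s|L. f s * \<psi> s - (\<psi> s)\<^sup>2)"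
        by (simp add: algebra_simps power2_eq_square)
      also have "\<dots> = (LINT s|L. f s * \<psi> s) - (LINT s|L. (\<psi> s)\<^sup>2)"
        by (intro Bochner_Integration.integral_diff L.integrable_continuous continuous_intros fc psi_c)
      finally show ?thesis .
    qed
    have "(LINT s|K w. (\<psi> s)\<^sup>2) = v + (\<Sum>u\<in>U. e w u *\<^sub>R (\<delta> *\<^sub>R u))"
      using K_eq[OF w'(1), of "\<lambda>s. (\<psi> s)\<^sup>2"] N(2) psi_c
      by (simp add: v_def continuous_intros cong: sum.cong)
    then have "(LINT s|K w. (\<psi> s)\<^sup>2) = v + w" by (simp only: e_sum)
    then have w_eq: "w = A - B - G"
      unfolding G_def A_def B_def split[OF Ks(1)] split[OF Ms(1)] v_def by simp
    define T where "T = \<i> * (z - \<omega>) * f l * \<psi> l + (z\<^sup>2 - \<omega>\<^sup>2) * A"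
    have "\<i> * z * \<psi> l * char_fun l (K w) z = T + \<omega>\<^sup>2 * (A - B)"
      using char_fun_variation[OF l Ms(1) Ks(1) zero z0 om]
      unfolding f_def[symmetric] \<psi>_def[symmetric] A_def[symmetric] B_def[symmetric] T_def by (simp add: algebra_simps)
    then have "H w = T / \<omega>\<^sup>2 + (A - B)" unfolding H_def using om by (simp add: field_simps)
    then have "H w - w = T / \<omega>\<^sup>2 + G" unfolding w_eq by simp
    then have "norm (H w - w) \<le> norm T / (norm \<omega>)\<^sup>2 + norm G"
      using norm_triangle_ineq[of "T / \<omega>\<^sup>2" G] by (simp add: norm_divide norm_power)
    moreover have "norm T / (norm \<omega>)\<^sup>2 \<le> a * \<eta>"
    proof -
      have A_le: "norm A \<le> \<Phi> * \<Phi> * m"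
      proof -
        have "norm A \<le> \<Phi> * \<Phi> * measure (K w) {0..l}"
          unfolding A_def using f_le psi_le \<Phi> by (intro K.norm_integral_le) (auto simp: norm_mult intro!: mult_mono)
        also have "\<dots> \<le> \<Phi> * \<Phi> * m" using Ks \<Phi> by (intro mult_left_mono) auto
        finally show ?thesis .
      qed
      have zz: "norm (z\<^sup>2 - \<omega>\<^sup>2) \<le> 2 * R * \<eta>"
      proof -
        have "z\<^sup>2 - \<omega>\<^sup>2 = (z + \<omega>) * (z - \<omega>)" by (simp add: power2_eq_square algebra_simps)
        then have "norm (z\<^sup>2 - \<omega>\<^sup>2) = norm (z + \<omega>) * \<eta>" by (simp only: norm_mult z)
        also have "\<dots> \<le> 2 * R * \<eta>"
          using norm_triangle_ineq[of z \<omega>] zR R \<eta> by (intro mult_right_mono) auto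
        finally show ?thesis .
      qed
      have "norm T \<le> norm (z - \<omega>) * (norm (f l) * norm (\<psi> l)) + norm (z\<^sup>2 - \<omega>\<^sup>2) * norm A"
        unfolding T_def using norm_triangle_ineq[of "\<i> * (z - \<omega>) * f l * \<psi> l" "(z\<^sup>2 - \<omega>\<^sup>2) * A"]
        by (simp add: norm_mult mult.assoc)
      also have "\<dots> \<le> \<eta> * (\<Phi> * \<Phi>) + (2 * R * \<eta>) * (\<Phi> * \<Phi> * m)"
        using f_le[of l] psi_le[of l] l z zz A_le \<Phi> R \<eta> by (intro add_mono mult_mono) auto
      also have "\<dots> = (\<Phi> * \<Phi> + 2 * R * (\<Phi> * \<Phi> * m)) * \<eta>" by (simp add: algebra_simps)
      finally show ?thesis using om by (simp add: a_def divide_right_mono)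
    qed
    moreover have "a * \<eta> \<le> r / 2" using \<eta> by (simp add: algebra_simps)
    ultimately show ?thesis using G_le by linarith
  qed
  obtain Lip where Lip: "0 \<le> Lip" "\<And>M M' \<rho>. M \<in> admissible_strings l m \<Longrightarrow> M' \<in> admissible_strings l m \<Longrightarrow>
    variation_le l M M' \<rho> \<Longrightarrow> 0 \<le> \<rho> \<Longrightarrow> norm (char_fun l M z - char_fun l M' z) \<le> Lip * \<rho>"
    using char_fun_lipschitz[OF l m', of z] by metis
  have "(Lip * C)-lipschitz_on (cball 0 r) (\<lambda>w. char_fun l (K w) z)"
  proof (rule lipschitz_onI)
    fix w w' :: complex assume w: "w \<in> cball 0 r" "w' \<in> cball 0 r"
    then have w': "w \<in> cball 0 (\<delta> / 4)" "w' \<in> cball 0 (\<delta> / 4)" using r by auto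
    show "dist (char_fun l (K w) z) (char_fun l (K w') z) \<le> Lip * C * dist w w'"
      using Lip(2)[OF K_adm[OF w'(1)] K_adm[OF w'(2)] var_KK[OF w']] C by (simp add: dist_norm mult.assoc)
  qed (use Lip C in auto)
  then have "continuous_on (cball 0 r) (\<lambda>w. char_fun l (K w) z)" by (rule lipschitz_on_continuous_on)
  then have "continuous_on (cball 0 r) (\<lambda>w. w - H w)"
    unfolding H_def by (intro continuous_intros) (use om in auto)
  moreover have "(\<lambda>w. w - H w) \<in> cball 0 r \<rightarrow> cball 0 r"
    using H_approx by (auto simp: norm_minus_commute)
  ultimately obtain w where w: "w \<in> cball 0 r" "w - H w = w"
    by (rule brouwer_ball[OF r(1)])
  then have "H w = 0" by simp
  then have "char_fun l (K w) z = 0"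
    using z0 om end_nz by (auto simp: H_def \<psi>_def)
  moreover have "K w \<in> admissible_strings l m" using w r by (intro K_adm) auto
  ultimately show ?thesis using \<eta>(1) unfolding z_def by blast
qed

lemma first_order_condition:
  assumes l: "0 < l" and m: "0 < m" and M: "M \<in> admissible_strings l m"
    and zero: "char_fun l M \<omega> = 0" and Re: "Re \<omega> \<noteq> 0" and end_nz: "phi l M \<omega> l \<noteq> 0"
    and min: "\<And>\<eta> K. 0 < \<eta> \<Longrightarrow> K \<in> admissible_strings l m \<Longrightarrow> char_fun l K (\<omega> + \<i> * complex_of_real \<eta>) \<noteq> 0"
  obtains \<kappa> where "\<kappa> \<noteq> 0" "\<And>N. N \<in> admissible_strings l m \<Longrightarrow>
    Re (\<kappa> * (LINT s|N. (phi l M \<omega> s)\<^sup>2)) \<le> Re (\<kappa> * (LINT s|M. (phi l M \<omega> s)\<^sup>2))"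
proof -
  have m': "0 \<le> m" using m by simp
  note adm = admissible_iff[OF l m']
  have Ms: "M \<in> strings l" using M adm by auto
  interpret M: krein_string l M by (rule krein_stringI[OF l Ms])
  define I where "I N = (LINT s|N. (phi l M \<omega> s)\<^sup>2)" for N
  define C where "C = I ` admissible_strings l m"
  have sq_c: "continuous_on {0..l} (\<lambda>s. (phi l M \<omega> s)\<^sup>2)"
    by (intro continuous_intros M.volterra_continuous[OF M.phi_volterra])
  have "convex C"
  proof (rule convexI)
    fix x y p q assume "x \<in> C" "y \<in> C" and pq: "0 \<le> (p::real)" "0 \<le> q" "p + q = 1"
    then obtain N N' where N: "N \<in> admissible_strings l m" "N' \<in> admissible_strings l m" "x = I N" "y = I N'"
      by (auto simp: C_def)
    then have Ns: "N \<in> strings l" "N' \<in> strings l" "measure N {0..l} \<le> m" "measure N' {0..l} \<le> m" using adm by auto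
    interpret N: krein_string l N by (rule krein_stringI[OF l Ns(1)])
    interpret N': krein_string l N' by (rule krein_stringI[OF l Ns(2)])
    interpret K: krein_string l "mix p q N N'" by (rule krein_stringI[OF l mix_in_strings[OF Ns(1,2)]])
    have "complex_of_real (measure (mix p q N N') {0..l}) = complex_of_real (p * measure N {0..l} + q * measure N' {0..l})"
      using integral_mix[OF l Ns(1,2) pq(1,2), of "\<lambda>_. 1"] K.space_M by (simp add: scaleR_conv_of_real)
    then have "measure (mix p q N N') {0..l} = p * measure N {0..l} + q * measure N' {0..l}" by (simp only: of_real_eq_iff)
    also have "\<dots> \<le> p * m + q * m" using Ns pq by (intro add_mono mult_left_mono)
    finally have "mix p q N N' \<in> admissible_strings l m"
      using K.in_strings adm pq by (simp flip: distrib_right)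
    moreover have "p *\<^sub>R x + q *\<^sub>R y = I (mix p q N N')"
      unfolding N(3,4) I_def by (rule integral_mix[OF l Ns(1,2) pq(1,2) sq_c, symmetric])
    ultimately show "p *\<^sub>R x + q *\<^sub>R y \<in> C" by (auto simp: C_def)
  qed
  have v: "I M \<in> C" using M by (simp add: C_def)
  have not_int: "I M \<notin> interior C"
    using resonance_perturbation[OF l m M zero Re end_nz] min unfolding C_def I_def by blast
  have inner: "a \<bullet> x = Re (cnj a * x)" for a x :: complex by (simp add: inner_complex_def)
  \<comment> \<open>A set C without interior lies on a line, and I M may be in its relative
    interior, where the normal of that line serves. Otherwise I M is a boundary point of C and has a
    supporting line.\<close>
  have "\<exists>a. a \<noteq> 0 \<and> (\<forall>y\<in>C. a \<bullet> I M \<le> a \<bullet> y)"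
  proof (cases "interior C = {}")
    case True
    then obtain a b where "a \<noteq> 0" "C \<subseteq> {x. a \<bullet> x = b}"
      using empty_interior_subset_hyperplane[OF \<open>convex C\<close>] by blast
    then have "a \<bullet> y = b" if "y \<in> C" for y using that by blast
    then show ?thesis using v \<open>a \<noteq> 0\<close> by (intro exI[of _ a]) simp
  next
    case False
    then have "I M \<notin> rel_interior C" using not_int by (simp add: rel_interior_nonempty_interior)
    moreover have cl: "y \<in> closure C" if "y \<in> C" for y using closure_subset that by (rule subsetD)
    ultimately obtain a where "a \<noteq> 0" "\<And>y. y \<in> closure C \<Longrightarrow> a \<bullet> I M \<le> a \<bullet> y"
      using supporting_hyperplane_relative_frontier[OF \<open>convex C\<close> cl[OF v]] by metis
    then show ?thesis using cl by (intro exI[of _ a]) simp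
  qed
  then obtain a where a: "a \<noteq> 0" "\<And>N. N \<in> admissible_strings l m \<Longrightarrow> Re (cnj a * I M) \<le> Re (cnj a * I N)"
    unfolding inner by (auto simp: C_def)
  show ?thesis
  \<comment> \<open>The inner product of a and x is Re (cnj a * x), and the change of sign turns the
    minimum at M into a maximum.\<close>
  proof (rule that[of "- cnj a"])
    show "- cnj a \<noteq> 0" using a(1) by simp
    fix N assume "N \<in> admissible_strings l m"
    then have "- Re (cnj a * I N) \<le> - Re (cnj a * I M)" using a(2) by (simp only: neg_le_iff_le)
    then show "Re (- cnj a * (LINT s|N. (phi l M \<omega> s)\<^sup>2)) \<le> Re (- cnj a * (LINT s|M. (phi l M \<omega> s)\<^sup>2))"
      unfolding I_def by (simp only: mult_minus_left uminus_complex.simps)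
  qed
qed

section \<open>Competitors concentrated in one point\<close>

definition lump :: "real \<Rightarrow> real measure \<Rightarrow> real \<Rightarrow> real measure" where
  "lump l M x = distr M (restrict_space borel {0..l}) (\<lambda>_. x)"

context krein_string
begin

lemma lump_in_strings:
  assumes x: "x \<in> {0..l}"
  shows "lump l M x \<in> strings l"
proof -
  have "(\<lambda>_. x) \<in> M \<rightarrow>\<^sub>M restrict_space borel {0..l}"
    using x by (intro measurable_const) (simp add: space_restrict_space)
  then have "finite_measure (lump l M x)"
    unfolding lump_def by (rule finite_measure_distr)
  then show ?thesis by (simp add: strings_def lump_def)
qed

lemma integral_lump:
  fixes f :: "real \<Rightarrow> complex"
  assumes x: "x \<in> {0..l}" and f: "continuous_on {0..l} f"
  shows "(LINT s|lump l M x. f s) = measure M {0..l} *\<^sub>R f x"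
proof -
  have "(\<lambda>_. x) \<in> M \<rightarrow>\<^sub>M restrict_space borel {0..l}"
    using x by (intro measurable_const) (simp add: space_restrict_space)
  then have "(LINT s|lump l M x. f s) = (LINT s|M. f x)"
    unfolding lump_def by (rule integral_distr) (rule borel_measurable_continuous_on_restrict[OF f])
  then show ?thesis by simp
qed

lemma measure_lump:
  assumes "x \<in> {0..l}"
  shows "measure (lump l M x) {0..l} = measure M {0..l}"
proof -
  interpret L: krein_string l "lump l M x" by unfold_locales (rule length_pos, rule lump_in_strings[OF assms])
  have "complex_of_real (measure (lump l M x) {0..l}) = complex_of_real (measure M {0..l})"
    using integral_lump[OF assms, of "\<lambda>_. 1"] by (simp add: scaleR_conv_of_real)
  then show ?thesis by (simp only: of_real_eq_iff)
qed

section \<open>Location of the quasi-eigenvalues\<close>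

lemma mass_pos_if_resonance:
  assumes "char_fun l M z = 0"
  shows "0 < measure M {0..l}"
proof (rule ccontr)
  assume "\<not> ?thesis"
  then have 0: "measure M {0..l} = 0" using measure_nonneg[of M "{0..l}"] by linarith
  have null: "(LINT s|M. f s) = 0" if fc: "continuous_on {0..l} f" for f :: "real \<Rightarrow> complex"
  proof -
    obtain B where B: "0 < B" "\<And>x. x \<in> {0..l} \<Longrightarrow> norm (f x) \<le> B" using bounded_continuous[OF fc] by blast
    have "norm (LINT s|M. f s) \<le> B * measure M {0..l}" using B by (intro norm_integral_le) auto
    then show ?thesis by (simp add: 0)
  qed
  have c: "continuous_on {0..l} (phi l M z)" by (rule volterra_continuous[OF phi_volterra])
  \<comment> \<open>Without mass both integrals vanish, so \<open>char_fun\<close> would be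
    1.\<close>
  have "phi l M z l = 1"
    using volterra_eq[OF phi_volterra, of l z] length_pos null[of "\<lambda>s. complex_of_real (max 0 (l - s)) * phi l M z s"]
    by (simp add: continuous_intros c)
  then show False using assms null[OF c] by (simp add: char_fun_eq)
qed

text \<open>Zero value and zero derivative at l propagate to the left: rewritten from l, the
  equation has the kernel max 0 (s - x) and no inhomogeneity, so Gronwall with \<sigma> = -1 forces
  f 0 = 0 instead of 1.\<close>

lemma backward_unique:
  assumes f: "volterra \<nu> f" and "f l = 0" "(LINT s|M. f s) = 0"
  shows False
proof -
  have fc: "continuous_on {0..l} f" using f by (rule volterra_continuous)
  have from_end: "f x = - \<nu> * (LINT s|M. complex_of_real (max 0 (s - x)) * f s)" if x: "x \<in> {0..l}" for x
  proof -
    have i: "integrable M (\<lambda>s. complex_of_real (h s) * f s)" if "continuous_on {0..l} h" for h :: "real \<Rightarrow> real"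
      by (intro integrable_continuous continuous_intros fc that)
    \<comment> \<open>Pointwise, max 0 (l - s) = max 0 (x - s) + (l - x) - max 0 (s - x); the middle
      term drops out because f has integral 0.\<close>
    have "(LINT s|M. complex_of_real (max 0 (l - s)) * f s) = (LINT s|M. complex_of_real (max 0 (x - s)) * f s
        + complex_of_real (l - x) * f s - complex_of_real (max 0 (s - x)) * f s)"
      by (intro Bochner_Integration.integral_cong refl) (auto simp: max_def algebra_simps)
    also have "\<dots> = (LINT s|M. complex_of_real (max 0 (x - s)) * f s) + (LINT s|M. complex_of_real (l - x) * f s)
        - (LINT s|M. complex_of_real (max 0 (s - x)) * f s)"
      by (subst Bochner_Integration.integral_diff Bochner_Integration.integral_add;
          (intro Bochner_Integration.integrable_add i continuous_intros)?)+ (rule refl)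
    also have "(LINT s|M. complex_of_real (l - x) * f s) = complex_of_real (l - x) * (LINT s|M. f s)"
      by (rule integral_mult_right_zero)
    finally have eq: "(LINT s|M. complex_of_real (max 0 (x - s)) * f s)
        = (LINT s|M. complex_of_real (max 0 (l - s)) * f s) + (LINT s|M. complex_of_real (max 0 (s - x)) * f s)"
      using assms(3) by simp
    have "0 = 1 - \<nu> * (LINT s|M. complex_of_real (max 0 (l - s)) * f s)"
      using volterra_eq[OF f, of l] assms(2) length_pos by simp
    then show ?thesis
      using volterra_eq[OF f x] unfolding eq by (simp add: distrib_left)
  qed
  have "norm (f 0) \<le> 2 * 0 * exp (2 * (2 * norm \<nu> * measure M {0..l} + 1) * l)"
  proof (rule gronwall[where d = "\<lambda>x. norm (f x)" and L = "norm \<nu>" and \<sigma> = "-1"])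
    fix x assume x: "x \<in> {0..l}"
    have "norm (f x) = norm \<nu> * norm (LINT s|M. complex_of_real (max 0 (s - x)) * f s)"
      using from_end[OF x] by (simp add: norm_mult)
    also have "\<dots> \<le> norm \<nu> * (LINT s|M. norm (complex_of_real (max 0 (s - x)) * f s))"
      by (intro mult_left_mono integral_norm_bound) auto
    finally show "norm (f x) \<le> 0 + norm \<nu> * (LINT s|M. max 0 (- 1 * (x - s)) * norm (f s))"
      by (simp add: norm_mult)
  qed (use length_pos in \<open>auto intro!: continuous_intros fc add_nonneg_pos\<close>)
  moreover interpret string_solution l M \<nu> f by unfold_locales (rule f)
  have "f 0 = 1" by (rule phi_0)
  ultimately show False by simp
qed

text \<open>A zero of \<open>char_fun\<close> means that \<open>slope {..l}\<close> is i z
  \<phi>(l), so the flux at l is Re z |\<phi>(l)|^2, and \<open>flux\<close> evaluates it as - 2 Re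
  z Im z E. Cancelling Re z leaves |\<phi>(l)|^2 = - 2 Im z E, where \<phi>(l) \<noteq> 0 by
  \<open>backward_unique\<close>.\<close>

lemma resonance_lower_half_plane:
  assumes zero: "char_fun l M z = 0" and Re: "Re z \<noteq> 0"
  shows "Im z < 0" "phi l M z l \<noteq> 0"
proof -
  interpret string_solution l M "z\<^sup>2" "phi l M z" by (rule phi_solution)
  define J where "J = (LINT s|M. phi l M z s)"
  define E where "E = (LINT s|M. indicat_real {..l} s * (norm (phi l M z s))\<^sup>2)"
  have E: "0 \<le> E" unfolding E_def by (intro integral_nonneg_AE) auto
  have end_eq: "phi l M z l = \<i> * z * J" using zero by (simp add: char_fun_eq J_def)
  have "z \<noteq> 0" using Re by auto
  show nz: "phi l M z l \<noteq> 0"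
  proof
    assume 0: "phi l M z l = 0"
    then have "J = 0" using end_eq \<open>z \<noteq> 0\<close> by simp
    then show False using backward_unique[OF solution 0] by (simp add: J_def)
  qed
  have "(LINT s|M. indicat_real {..l} s *\<^sub>R phi l M z s) = J"
    unfolding J_def by (intro Bochner_Integration.integral_cong) auto
  then have "slope {..l} = \<i> * z * phi l M z l"
    unfolding slope_def end_eq by (simp add: power2_eq_square algebra_simps)
  then have "slope {..l} * cnj (phi l M z l) = \<i> * z * complex_of_real ((norm (phi l M z l))\<^sup>2)"
    unfolding complex_norm_square by (simp add: mult.assoc)
  then have "Im (slope {..l} * cnj (phi l M z l)) = Re z * (norm (phi l M z l))\<^sup>2" by simp
  moreover have "Im (slope {..l} * cnj (phi l M z l)) = - Im (z\<^sup>2) * E"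
    unfolding E_def by (rule flux) (use length_pos in \<open>auto simp: subset_eq\<close>)
  moreover have "Im (z\<^sup>2) = 2 * Re z * Im z" by (simp add: power2_eq_square)
  ultimately have "Re z * (norm (phi l M z l))\<^sup>2 = Re z * (- 2 * Im z * E)" by simp
  then have eq: "(norm (phi l M z l))\<^sup>2 = - 2 * Im z * E" by (rule mult_left_cancel[OF Re, THEN iffD1])
  have "0 < (norm (phi l M z l))\<^sup>2" using nz by simp
  then have pos: "0 < (- 2 * Im z) * E" using eq by simp
  show "Im z < 0"
  proof (rule ccontr)
    assume "\<not> Im z < 0"
    then have "(- 2 * Im z) * E \<le> 0" using E by (intro mult_nonpos_nonneg) auto
    then show False using pos by linarith
  qed
qed

section \<open>From finite support to ordered point masses\<close>

lemma finite_support_expansion: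
  assumes X: "finite X" "X \<subseteq> {0..l}" "AE s in M. s \<in> X" and pos: "0 < measure M {0..l}"
  shows "\<exists>(n::nat) (\<mu> :: nat \<Rightarrow> real) (a :: nat \<Rightarrow> real).
           n \<ge> 1 \<and>
           (\<forall>j\<in>{1..n}. \<mu> j > 0 \<and> a j \<in> {0..l}) \<and>
           strict_mono_on {1..n} a \<and>
           (\<forall>A\<in>sets M. emeasure M A = (\<Sum>j=1..n. ennreal (\<mu> j) * indicator A (a j)))"
proof -
  have sing: "{x} \<in> sets M" if "x \<in> {0..l}" for x using in_sets_M[of "{x}"] that by auto
  \<comment> \<open>X may contain points without mass, whereas the weights have to be
    positive.\<close>
  define Y where "Y = {x \<in> X. 0 < measure M {x}}"
  have Y: "finite Y" "Y \<subseteq> {0..l}" using X by (auto simp: Y_def)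
  have "AE s in M. s \<notin> {x}" if "x \<in> X - Y" for x
  proof -
    have "measure M {x} = 0" using that measure_nonneg[of M "{x}"] by (auto simp: Y_def not_less)
    then have "{x} \<in> null_sets M" using sing[of x] that X by (auto simp: null_sets_def emeasure_eq_measure)
    then show ?thesis by (rule AE_not_in)
  qed
  then have "AE s in M. \<forall>x\<in>X - Y. s \<notin> {x}" using X(1) by (intro AE_finite_allI) auto
  then have AE_Y: "AE s in M. s \<in> Y" using X(3) by eventually_elim auto
  have emeasure_Y: "emeasure M A = (\<Sum>x\<in>Y. ennreal (measure M {x}) * indicator A x)" if A: "A \<in> sets M" for A
  proof -
    have "(\<Union>x\<in>A \<inter> Y. {x}) \<in> sets M" using Y sing by (intro sets.finite_UN) auto
    then have AY: "A \<inter> Y \<in> sets M" by simp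
    have "emeasure M A = emeasure M (A \<inter> Y)"
      using AE_Y A AY by (intro emeasure_eq_AE) auto
    also have "\<dots> = (\<Sum>x\<in>A \<inter> Y. emeasure M {x})"
      using Y sing by (intro emeasure_eq_sum_singleton) auto
    also have "\<dots> = (\<Sum>x\<in>Y. ennreal (measure M {x}) * indicator A x)"
      using Y by (intro sum.mono_neutral_cong_left) (auto simp: emeasure_eq_measure indicator_def)
    finally show ?thesis .
  qed
  define n xs where "n = card Y" and "xs = sorted_list_of_set Y"
  \<comment> \<open>The statement counts from 1, lists count from 0.\<close>
  define a \<mu> where "a j = xs ! (j - 1)" and "\<mu> j = measure M {a j}" for j :: nat
  have xs: "length xs = n" "set xs = Y" "sorted_wrt (<) xs" "distinct xs"
    using Y by (auto simp: xs_def n_def)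
  have aY: "a j \<in> Y" if "j \<in> {1..n}" for j
    unfolding a_def xs(2)[symmetric] using that xs(1) by (intro nth_mem) auto
  have "Y \<noteq> {}"
  proof
    assume "Y = {}"
    then have "emeasure M {0..l} = 0" using emeasure_Y[of "{0..l}"] sets.top[of M] by simp
    then show False using pos by (simp add: emeasure_eq_measure)
  qed
  then have n: "1 \<le> n" using Y by (simp add: n_def Suc_le_eq card_gt_0_iff)
  have mono: "strict_mono_on {1..n} a"
  proof (rule strict_mono_onI)
    fix i j assume "i \<in> {1..n}" "j \<in> {1..n}" "i < j"
    then show "a i < a j" unfolding a_def using xs by (intro sorted_wrt_nth_less[OF xs(3)]) auto
  qed
  have "inj_on a {1..n}" using mono by (rule strict_mono_on_imp_inj_on)
  moreover have "a ` {1..n} = Y"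
  proof (rule card_subset_eq)
    show "card (a ` {1..n}) = card Y" using \<open>inj_on a {1..n}\<close> by (simp add: card_image n_def)
  qed (use Y aY in auto)
  ultimately have bij: "bij_betw a {1..n} Y" by (simp add: bij_betw_def)
  have "emeasure M A = (\<Sum>j=1..n. ennreal (\<mu> j) * indicator A (a j))" if "A \<in> sets M" for A
    unfolding emeasure_Y[OF that] \<mu>_def by (rule sum.reindex_bij_betw[OF bij, symmetric])
  moreover have "\<mu> j > 0 \<and> a j \<in> {0..l}" if "j \<in> {1..n}" for j
    using aY[OF that] Y by (auto simp: \<mu>_def Y_def)
  ultimately show ?thesis using n mono by blast
qed

end

section \<open>Strings of minimal decay\<close>

context krein_string
begin

text \<open>Here \<open>z\<^sup>2\<close> is the real number - \<beta>^2, so the solution equals its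
  conjugate and solves \<open>\<rho>'' = \<beta>\<^sup>2 \<rho> dM\<close>. Once \<rho> is known to
  be nonnegative, the equation gives \<rho> >= 1, and \<beta> > 0 follows from the condition at
  l.\<close>

lemma imaginary_axis:
  fixes \<beta> :: real
  defines "z \<equiv> - \<i> * complex_of_real \<beta>"
  defines "\<rho> \<equiv> \<lambda>x. Re (phi l M z x)"
  assumes zero: "char_fun l M z = 0"
  shows "0 < \<beta>" "\<rho> l = \<beta> * (LINT s|M. \<rho> s)" "continuous_on {0..l} \<rho>" "\<And>x. x \<in> {0..l} \<Longrightarrow> 1 \<le> \<rho> x"
    "\<And>x. x \<in> {0..l} \<Longrightarrow> \<rho> x = 1 + \<beta>\<^sup>2 * (LINT s|M. max 0 (x - s) * \<rho> s)"
proof -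
  have z2: "z\<^sup>2 = - complex_of_real (\<beta>\<^sup>2)" by (simp add: z_def power_mult_distrib)
  interpret string_solution l M "z\<^sup>2" "phi l M z" by (rule phi_solution)
  have c: "continuous_on {0..l} (phi l M z)" by (rule continuous)
  show rc: "continuous_on {0..l} \<rho>" unfolding \<rho>_def by (intro continuous_intros c)
  have "cnj (z\<^sup>2) = z\<^sup>2" unfolding z2 by simp
  then have "volterra (z\<^sup>2) (\<lambda>x. cnj (phi l M z x))" using volterra_cnj by simp
  then have "phi l M z x = cnj (phi l M z x)" if "x \<in> {0..l}" for x
    by (rule volterra_unique[OF solution _ that])
  then have real: "phi l M z x = complex_of_real (\<rho> x)" if "x \<in> {0..l}" for x
    using that unfolding \<rho>_def by (metis complex_cnj_cancel_iff of_real_Re Reals_cnj_iff)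
  have int: "(LINT s|M. complex_of_real (h s) * phi l M z s) = complex_of_real (LINT s|M. h s * \<rho> s)" for h
  proof -
    have "(LINT s|M. complex_of_real (h s) * phi l M z s) = (LINT s|M. complex_of_real (h s * \<rho> s))"
      by (intro Bochner_Integration.integral_cong) (auto simp: real)
    then show ?thesis by (simp only: integral_complex_of_real)
  qed
  show eq: "\<rho> x = 1 + \<beta>\<^sup>2 * (LINT s|M. max 0 (x - s) * \<rho> s)" if x: "x \<in> {0..l}" for x
  proof -
    have "complex_of_real (\<rho> x) = complex_of_real (1 + \<beta>\<^sup>2 * (LINT s|M. max 0 (x - s) * \<rho> s))"
      using phi_eq[OF x] unfolding real[OF x] int z2 by simp
    then show ?thesis by (simp only: of_real_eq_iff)
  qed
  \<comment> \<open>No sign of \<rho> is known yet; its negative part satisfies the Gronwall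
    inequality with D = 0 and therefore vanishes.\<close>
  have "max 0 (- \<rho> x) \<le> 2 * 0 * exp (2 * (2 * \<beta>\<^sup>2 * measure M {0..l} + 1) * l)" if x: "x \<in> {0..l}" for x
  proof (rule gronwall[where d = "\<lambda>x. max 0 (- \<rho> x)" and L = "\<beta>\<^sup>2" and \<sigma> = 1])
    fix x assume x: "x \<in> {0..l}"
    have i: "integrable M (\<lambda>s. max 0 (x - s) * h s)" if "continuous_on {0..l} h" for h :: "real \<Rightarrow> real"
      by (intro integrable_continuous continuous_intros that)
    have nc: "continuous_on {0..l} (\<lambda>s. max 0 (- \<rho> s))" by (intro continuous_intros rc)
    have pos: "0 \<le> (LINT s|M. max 0 (x - s) * max 0 (- \<rho> s))" by (intro integral_nonneg_AE) auto
    have "0 \<le> (LINT s|M. max 0 (x - s) * \<rho> s) + (LINT s|M. max 0 (x - s) * max 0 (- \<rho> s))"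
      unfolding Bochner_Integration.integral_add[OF i[OF rc] i[OF nc], symmetric]
      by (intro integral_nonneg_AE AE_I2) (auto simp: max_def)
    then have "0 \<le> \<beta>\<^sup>2 * ((LINT s|M. max 0 (x - s) * \<rho> s) + (LINT s|M. max 0 (x - s) * max 0 (- \<rho> s)))"
      by (intro mult_nonneg_nonneg) auto
    then have "- \<rho> x \<le> \<beta>\<^sup>2 * (LINT s|M. max 0 (x - s) * max 0 (- \<rho> s))"
      using eq[OF x] by (simp add: distrib_left)
    moreover have "0 \<le> \<beta>\<^sup>2 * (LINT s|M. max 0 (x - s) * max 0 (- \<rho> s))" using pos by simp
    ultimately show "max 0 (- \<rho> x) \<le> 0 + \<beta>\<^sup>2 * (LINT s|M. max 0 (1 * (x - s)) * max 0 (- \<rho> s))"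
      by simp
  qed (use x in \<open>auto intro!: continuous_intros rc add_nonneg_pos\<close>)
  then have nonneg: "0 \<le> \<rho> x" if "x \<in> {0..l}" for x using that by fastforce
  show ge: "1 \<le> \<rho> x" if x: "x \<in> {0..l}" for x
  proof -
    have "0 \<le> (LINT s|M. max 0 (x - s) * \<rho> s)" using nonneg by (intro integral_nonneg_AE AE_I2) auto
    then show ?thesis unfolding eq[OF x] by simp
  qed
  have "(LINT s|M. phi l M z s) = complex_of_real (LINT s|M. \<rho> s)" using int[of "\<lambda>_. 1"] by simp
  then have "complex_of_real (\<rho> l) - complex_of_real (\<beta> * (LINT s|M. \<rho> s)) = 0"
    using zero real[of l] length_pos unfolding char_fun_eq by (simp add: z_def mult.assoc[symmetric])
  then show end_eq: "\<rho> l = \<beta> * (LINT s|M. \<rho> s)" by (simp del: of_real_mult)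
  have "0 \<le> (LINT s|M. \<rho> s)" using nonneg by (intro integral_nonneg_AE AE_I2) auto
  moreover have "0 < \<beta> * (LINT s|M. \<rho> s)" using ge[of l] length_pos unfolding end_eq by auto
  ultimately show "0 < \<beta>" by (simp add: zero_less_mult_iff)
qed

text \<open>The kernel vanishes at s = x = l, so mass at l leaves \<phi> l = 1. For positive mass
  the only zero is - i divided by the mass.\<close>

lemma char_fun_lump_end:
  "char_fun l (lump l M l) z = 1 - \<i> * z * complex_of_real (measure M {0..l})"
proof -
  have l: "l \<in> {0..l}" using length_pos by simp
  interpret L: krein_string l "lump l M l" by unfold_locales (rule length_pos, rule lump_in_strings[OF l])
  have c: "continuous_on {0..l} (phi l (lump l M l) z)" by (rule L.volterra_continuous[OF L.phi_volterra])
  have "phi l (lump l M l) z l = 1"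
    using L.volterra_eq[OF L.phi_volterra l, of z]
      integral_lump[OF l, of "\<lambda>s. complex_of_real (max 0 (l - s)) * phi l (lump l M l) z s"]
    by (simp add: continuous_intros c)
  then show ?thesis
    using integral_lump[OF l c] by (simp add: L.char_fun_eq scaleR_conv_of_real)
qed

end

text \<open>Bounds the set in \<open>beta_min\<close> from below, so that its infimum is a genuine
  one. The imaginary axis is separate because \<open>resonance_lower_half_plane\<close> cancels Re
  z.\<close>

lemma admissible_resonance:
  assumes l: "0 < l" and m: "0 < m" and M: "M \<in> admissible_strings l m"
    and zero: "char_fun l M (complex_of_real \<alpha> - \<i> * complex_of_real \<beta>) = 0"
  shows "0 < \<beta>"
proof -
  have "M \<in> strings l" using M by (simp add: admissible_strings_def)
  then interpret krein_string l M by (rule krein_stringI[OF l])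
  show ?thesis
  proof (cases "\<alpha> = 0")
    case True
    then show ?thesis using imaginary_axis(1)[of \<beta>] zero by simp
  next
    case False
    then show ?thesis using resonance_lower_half_plane(1)[OF zero] by simp
  qed
qed

lemma beta_min_le:
  assumes l: "0 < l" and m: "0 < m" and M: "M \<in> admissible_strings l m"
    and zero: "char_fun l M (complex_of_real \<alpha> - \<i> * complex_of_real \<beta>) = 0"
  shows "beta_min l m \<alpha> \<le> \<beta>"
  unfolding beta_min_def
proof (rule cInf_lower)
  show "\<beta> \<in> {\<beta>. complex_of_real \<alpha> - \<i> * complex_of_real \<beta> \<in> admissible_spectrum l m}"
    using M zero by (auto simp: admissible_spectrum_def quasi_eigenvalues_def)
  show "bdd_below {\<beta>. complex_of_real \<alpha> - \<i> * complex_of_real \<beta> \<in> admissible_spectrum l m}"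
    by (rule bdd_belowI[of _ 0])
       (auto simp: admissible_spectrum_def quasi_eigenvalues_def intro!: less_imp_le admissible_resonance[OF l m])
qed

text \<open>On the imaginary axis no perturbation argument is needed: a single mass at \<open>l\<close> is optimal.\<close>
lemma finite_support_imaginary:
  assumes l: "0 < l" and m: "0 < m" and M: "M \<in> admissible_strings l m"
    and zero: "char_fun l M (- \<i> * complex_of_real (beta_min l m 0)) = 0"
  shows "\<exists>X. finite X \<and> X \<subseteq> {0..l} \<and> (AE s in M. s \<in> X)"
proof -
  define \<beta> where "\<beta> = beta_min l m 0"
  have Ms: "M \<in> strings l" "measure M {0..l} \<le> m" using M admissible_iff[OF l] m by auto
  interpret krein_string l M by (rule krein_stringI[OF l Ms(1)])
  define \<rho> where "\<rho> = (\<lambda>x. Re (phi l M (- \<i> * complex_of_real \<beta>) x))"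
  have \<rho>: "0 < \<beta>" "\<rho> l = \<beta> * (LINT s|M. \<rho> s)" "continuous_on {0..l} \<rho>" "\<And>x. x \<in> {0..l} \<Longrightarrow> 1 \<le> \<rho> x"
    "\<And>x. x \<in> {0..l} \<Longrightarrow> \<rho> x = 1 + \<beta>\<^sup>2 * (LINT s|M. max 0 (x - s) * \<rho> s)"
    using imaginary_axis[OF zero] unfolding \<rho>_def \<beta>_def by blast+
  define m0 where "m0 = measure M {0..l}"
  have m0: "0 < m0" unfolding m0_def by (rule mass_pos_if_resonance[OF zero])
  have ll: "l \<in> {0..l}" using l by simp
  \<comment> \<open>The competitor has the whole mass of M moved to l; its decay rate is 1 /
    m0.\<close>
  have "lump l M l \<in> admissible_strings l m"
    using lump_in_strings[OF ll] measure_lump[OF ll] Ms admissible_iff[OF l] m by simp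
  moreover have "char_fun l (lump l M l) (complex_of_real 0 - \<i> * complex_of_real (1 / m0)) = 0"
    using m0 unfolding char_fun_lump_end m0_def[symmetric] by (simp add: field_simps)
  ultimately have "\<beta> \<le> 1 / m0" unfolding \<beta>_def by (rule beta_min_le[OF l m])
  then have bm: "\<beta> * m0 \<le> 1" using m0 by (simp add: field_simps)
  \<comment> \<open>\<rho> is increasing, with a quantitative gain: mass in [0,x] makes it grow on
    [x,l] by at least \<beta>^2 (l - x) times that mass. The gain later excludes mass below
    l.\<close>
  have mono: "\<rho> s \<le> \<rho> l - \<beta>\<^sup>2 * ((l - x) * measure M ({..x} \<inter> {0..l}))"
    if x: "x \<le> l" and s: "s \<in> {0..l}" "s \<le> x" for x s
  proof -
    have i: "integrable M (\<lambda>r. max 0 (y - r) * \<rho> r)" for y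
      by (intro integrable_continuous continuous_intros \<rho>(3))
    have sx: "{..x} \<inter> {0..l} \<in> sets M" by (rule in_sets_M) simp
    have "(l - x) * measure M ({..x} \<inter> {0..l}) = (LINT r|M. (l - x) * indicat_real ({..x} \<inter> {0..l}) r)"
      using sx sets.sets_into_space[OF sx] by (simp add: Int_absorb2)
    also have "\<dots> \<le> (LINT r|M. max 0 (l - r) * \<rho> r - max 0 (s - r) * \<rho> r)"
    proof (rule integral_mono)
      show "integrable M (\<lambda>r. (l - x) * indicat_real ({..x} \<inter> {0..l}) r)"
        using sx by (intro integrable_mult_right integrable_real_indicator) (auto simp: less_top[symmetric])
      show "integrable M (\<lambda>r. max 0 (l - r) * \<rho> r - max 0 (s - r) * \<rho> r)"
        by (intro Bochner_Integration.integrable_diff i)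
      fix r assume "r \<in> space M"
      then have r: "r \<in> {0..l}" by simp
      have "(l - x) * indicat_real ({..x} \<inter> {0..l}) r \<le> (max 0 (l - r) - max 0 (s - r)) * 1"
        using x s r by (auto simp: indicator_def max_def)
      also have "\<dots> \<le> (max 0 (l - r) - max 0 (s - r)) * \<rho> r"
        using \<rho>(4)[OF r] s r by (intro mult_left_mono) auto
      finally show "(l - x) * indicat_real ({..x} \<inter> {0..l}) r \<le> max 0 (l - r) * \<rho> r - max 0 (s - r) * \<rho> r"
        by (simp only: left_diff_distrib)
    qed
    also have "\<dots> = (LINT r|M. max 0 (l - r) * \<rho> r) - (LINT r|M. max 0 (s - r) * \<rho> r)"
      by (intro Bochner_Integration.integral_diff i)
    finally have "\<beta>\<^sup>2 * ((l - x) * measure M ({..x} \<inter> {0..l}))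
        \<le> \<beta>\<^sup>2 * ((LINT r|M. max 0 (l - r) * \<rho> r) - (LINT r|M. max 0 (s - r) * \<rho> r))"
      by (intro mult_left_mono) auto
    also have "\<dots> = \<rho> l - \<rho> s" unfolding \<rho>(5)[OF ll] \<rho>(5)[OF s(1)] by (simp add: right_diff_distrib)
    finally show ?thesis by simp
  qed
  have rho_le: "\<rho> s \<le> \<rho> l" if "s \<in> {0..l}" for s using mono[of l s] that by simp
  have int_diff: "integrable M (\<lambda>s. \<rho> l - \<rho> s)" by (intro integrable_continuous continuous_intros \<rho>(3))
  \<comment> \<open>From \<rho> l = \<beta> times the integral of \<rho>, together with \<beta> m0
    <= 1, the integral of \<rho> l - \<rho> is at most 0, while the integrand is
    nonnegative.\<close>
  have "AE s in M. \<rho> l - \<rho> s = 0"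
  proof -
    have "(LINT s|M. \<rho> l - \<rho> s) = (LINT s|M. \<rho> l) - (LINT s|M. \<rho> s)"
      by (intro Bochner_Integration.integral_diff integrable_continuous continuous_intros \<rho>(3))
    then have I: "(LINT s|M. \<rho> l - \<rho> s) = m0 * \<rho> l - (LINT s|M. \<rho> s)" by (simp add: m0_def mult.commute)
    have "\<beta> * (LINT s|M. \<rho> l - \<rho> s) = (\<beta> * m0) * \<rho> l - \<rho> l"
      unfolding I right_diff_distrib \<rho>(2)[symmetric] by simp
    also have "\<dots> \<le> 0" using mult_right_mono[OF bm, of "\<rho> l"] \<rho>(4)[OF ll] by simp
    finally have "(LINT s|M. \<rho> l - \<rho> s) \<le> 0" using \<rho>(1) by (simp add: mult_le_0_iff)
    moreover have "0 \<le> (LINT s|M. \<rho> l - \<rho> s)" using rho_le by (intro integral_nonneg_AE AE_I2) auto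
    ultimately have "(LINT s|M. \<rho> l - \<rho> s) = 0" by linarith
    then show ?thesis
      by (subst (asm) integral_nonneg_eq_0_iff_AE[OF int_diff]) (use rho_le in auto)
  qed
  note AE_eq = this
  interpret string_solution l M "(- \<i> * complex_of_real \<beta>)\<^sup>2" "phi l M (- \<i> * complex_of_real \<beta>)" by (rule phi_solution)
  obtain a where a: "a \<in> {0..l}" "AE s in M. a \<le> s"
    "\<And>y. a < y \<Longrightarrow> y \<le> l \<Longrightarrow> 0 < measure M ({..<y} \<inter> {0..l})"
    using start_of_support by blast
  have "a = l"
  proof (rule ccontr)
    assume "a \<noteq> l"
    define x where "x = (a + l) / 2"
    have x: "a < x" "x < l" using a \<open>a \<noteq> l\<close> by (auto simp: x_def)
    have "measure M ({..<x} \<inter> {0..l}) \<le> measure M ({..x} \<inter> {0..l})"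
      by (intro finite_measure_mono in_sets_M) auto
    then have pos: "0 < measure M ({..x} \<inter> {0..l})" using a(3)[of x] x by linarith
    then have "0 < \<beta>\<^sup>2 * ((l - x) * measure M ({..x} \<inter> {0..l}))" using \<rho>(1) x by simp
    then have less: "\<rho> s < \<rho> l" if "s \<in> {..x} \<inter> {0..l}" for s using mono[of x s] x that by auto
    have "AE s in M. s \<notin> {..x} \<inter> {0..l}"
      using AE_eq
    proof eventually_elim
      case (elim s)
      then show ?case using less[of s] by linarith
    qed
    then have "{..x} \<inter> {0..l} \<in> null_sets M" using AE_iff_null_sets[OF in_sets_M[of "{..x}"]] by simp
    then have "measure M ({..x} \<inter> {0..l}) = 0" by (rule measure_eq_0_null_sets)
    then show False using pos by simp
  qed
  then have "AE s in M. s \<in> {l}" using a(2) AE_space by (auto elim!: eventually_elim2)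
  then show ?thesis using ll by blast
qed

lemma finite_support_oblique:
  assumes l: "0 < l" and m: "0 < m" and M: "M \<in> admissible_strings l m" and \<alpha>: "\<alpha> \<noteq> 0"
    and zero: "char_fun l M (complex_of_real \<alpha> - \<i> * complex_of_real (beta_min l m \<alpha>)) = 0"
  shows "\<exists>X. finite X \<and> X \<subseteq> {0..l} \<and> (AE s in M. s \<in> X)"
proof -
  define \<omega> where "\<omega> = complex_of_real \<alpha> - \<i> * complex_of_real (beta_min l m \<alpha>)"
  have Re: "Re \<omega> \<noteq> 0" using \<alpha> by (simp add: \<omega>_def)
  have zero': "char_fun l M \<omega> = 0" using zero by (simp add: \<omega>_def)
  have Ms: "M \<in> strings l" "measure M {0..l} \<le> m" using M admissible_iff[OF l] m by auto
  interpret krein_string l M by (rule krein_stringI[OF l Ms(1)])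
  interpret string_solution l M "\<omega>\<^sup>2" "phi l M \<omega>" by (rule phi_solution)
  \<comment> \<open>A zero at \<omega> + i \<eta> would have the decay rate
    \<open>beta_min l m \<alpha> - \<eta>\<close>, below the infimum.\<close>
  have min: "char_fun l K (\<omega> + \<i> * complex_of_real \<eta>) \<noteq> 0" if "0 < \<eta>" "K \<in> admissible_strings l m" for \<eta> K
  proof
    assume "char_fun l K (\<omega> + \<i> * complex_of_real \<eta>) = 0"
    moreover have "\<omega> + \<i> * complex_of_real \<eta> = complex_of_real \<alpha> - \<i> * complex_of_real (beta_min l m \<alpha> - \<eta>)"
      by (simp add: \<omega>_def algebra_simps)
    ultimately have "beta_min l m \<alpha> \<le> beta_min l m \<alpha> - \<eta>" using beta_min_le[OF l m that(2)] by simp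
    then show False using that by simp
  qed
  obtain \<kappa> where \<kappa>: "\<kappa> \<noteq> 0" "\<And>N. N \<in> admissible_strings l m \<Longrightarrow>
    Re (\<kappa> * (LINT s|N. (phi l M \<omega> s)\<^sup>2)) \<le> Re (\<kappa> * (LINT s|M. (phi l M \<omega> s)\<^sup>2))"
    by (rule first_order_condition[OF l m M zero' Re resonance_lower_half_plane(2)[OF zero' Re] min]) auto
  \<comment> \<open>The comparison uses the mass of M itself, not m: then I / m0 is the mean of Re
    (\<kappa> \<phi>^2) over M, and every lump of M is admissible.\<close>
  define m0 where "m0 = measure M {0..l}"
  have m0: "0 < m0" unfolding m0_def by (rule mass_pos_if_resonance[OF zero'])
  define I where "I = Re (\<kappa> * (LINT s|M. (phi l M \<omega> s)\<^sup>2))"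
  have sq_c: "continuous_on {0..l} (\<lambda>s. (phi l M \<omega> s)\<^sup>2)" by (intro continuous_intros continuous)
  have g_c: "continuous_on {0..l} (\<lambda>s. Re (\<kappa> * (phi l M \<omega> s)\<^sup>2))" by (intro continuous_intros continuous)
  \<comment> \<open>This mixture is the zero string; comparison with it yields I >= 0.\<close>
  have "mix 0 0 M M \<in> admissible_strings l m"
  proof -
    interpret K: krein_string l "mix 0 0 M M" by (rule krein_stringI[OF l mix_in_strings[OF Ms(1) Ms(1)]])
    have "emeasure (mix 0 0 M M) {0..l} = 0" using sets.top[of M] by (simp add: emeasure_mix)
    then show ?thesis using mix_in_strings[OF Ms(1) Ms(1)] by (simp add: admissible_strings_def)
  qed
  from \<kappa>(2)[OF this] have I: "0 \<le> I"
    unfolding I_def integral_mix[OF l Ms(1) Ms(1) order_refl order_refl sq_c] by simp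
  have le: "Re (\<kappa> * (phi l M \<omega> x)\<^sup>2) \<le> I / m0" if x: "x \<in> {0..l}" for x
  proof -
    have "lump l M x \<in> admissible_strings l m"
      using lump_in_strings[OF x] measure_lump[OF x] Ms admissible_iff[OF l] m by simp
    from \<kappa>(2)[OF this] have "Re (\<kappa> * (m0 *\<^sub>R (phi l M \<omega> x)\<^sup>2)) \<le> I"
      unfolding I_def m0_def integral_lump[OF x sq_c] .
    then have "m0 * Re (\<kappa> * (phi l M \<omega> x)\<^sup>2) \<le> I" by (simp only: mult_scaleR_right scaleR_complex.simps)
    then show ?thesis using m0 by (simp only: pos_le_divide_eq mult.commute)
  qed
  \<comment> \<open>An upper bound that equals the mean is attained almost everywhere.\<close>
  have "I = (LINT s|M. Re (\<kappa> * (phi l M \<omega> s)\<^sup>2))"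
  proof -
    have "I = Re (LINT s|M. \<kappa> * (phi l M \<omega> s)\<^sup>2)" unfolding I_def by (subst integral_mult_right_zero) (rule refl)
    also have "\<dots> = (LINT s|M. Re (\<kappa> * (phi l M \<omega> s)\<^sup>2))"
      by (intro integral_Re[symmetric] integrable_continuous continuous_intros continuous)
    finally show ?thesis .
  qed
  moreover have "(LINT s|M. I / m0 - Re (\<kappa> * (phi l M \<omega> s)\<^sup>2)) = (LINT s|M. I / m0) - (LINT s|M. Re (\<kappa> * (phi l M \<omega> s)\<^sup>2))"
    by (intro Bochner_Integration.integral_diff integrable_continuous g_c continuous_intros)
  moreover have "(LINT s|M. I / m0) = I" using m0 by (simp add: m0_def)
  ultimately have "(LINT s|M. I / m0 - Re (\<kappa> * (phi l M \<omega> s)\<^sup>2)) = 0" by linarith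
  moreover have "integrable M (\<lambda>s. I / m0 - Re (\<kappa> * (phi l M \<omega> s)\<^sup>2))"
    by (intro integrable_continuous continuous_on_diff g_c continuous_on_const)
  moreover have "AE s in M. 0 \<le> I / m0 - Re (\<kappa> * (phi l M \<omega> s)\<^sup>2)"
    using AE_space by eventually_elim (use le in \<open>simp only: space_M diff_ge_0_iff_ge\<close>)
  ultimately have "AE s in M. I / m0 - Re (\<kappa> * (phi l M \<omega> s)\<^sup>2) = 0"
    by (simp only: integral_nonneg_eq_0_iff_AE)
  then have AE_eq: "AE s in M. Re (\<kappa> * (phi l M \<omega> s)\<^sup>2) = I / m0"
    by eventually_elim linarith
  have "Im (\<omega>\<^sup>2) \<noteq> 0"
    using resonance_lower_half_plane(1)[OF zero' Re] Re by (simp add: power2_eq_square)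
  then show ?thesis
    using finite_support[OF _ \<kappa>(1) _ le AE_eq] I m0 by (simp only: divide_nonneg_pos simp_thms)
qed

theorem theorem5p2:
  fixes l m \<alpha> :: real and M\<^sub>0 :: "real measure"
  assumes "l > 0" and "m > 0"
    and "minimal_decay l m \<alpha> M\<^sub>0"
  shows "\<exists>(n::nat) (\<mu> :: nat \<Rightarrow> real) (a :: nat \<Rightarrow> real).
           n \<ge> 1 \<and>
           (\<forall>j\<in>{1..n}. \<mu> j > 0 \<and> a j \<in> {0..l}) \<and>
           strict_mono_on {1..n} a \<and>
           (\<forall>A\<in>sets M\<^sub>0. emeasure M\<^sub>0 A = (\<Sum>j=1..n. ennreal (\<mu> j) * indicator A (a j)))"
proof -
  have M: "M\<^sub>0 \<in> admissible_strings l m"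
    and zero: "char_fun l M\<^sub>0 (complex_of_real \<alpha> - \<i> * complex_of_real (beta_min l m \<alpha>)) = 0"
    using assms(3) by (auto simp: minimal_decay_def quasi_eigenvalues_def)
  have "M\<^sub>0 \<in> strings l" using M by (simp add: admissible_strings_def)
  then interpret krein_string l M\<^sub>0 by (rule krein_stringI[OF assms(1)])
  obtain X where "finite X" "X \<subseteq> {0..l}" "AE s in M\<^sub>0. s \<in> X"
  proof (cases "\<alpha> = 0")
    case True
    then show ?thesis using finite_support_imaginary[OF assms(1,2) M] zero that by auto
  next
    case False
    then show ?thesis using finite_support_oblique[OF assms(1,2) M False zero] that by auto
  qed
  then show ?thesis using finite_support_expansion[OF _ _ _ mass_pos_if_resonance[OF zero]] by blast
qed

end
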